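(* Let $0<\alpha_1<\alpha_2$, and let $(k_n)$, $(Q_n)$, $(P_n)$ satisfy assumption $\mathbf{A}(\alpha_1,\alpha_2)$, with limits $\Delta_{\alpha_i}=\lim_n D_{\alpha_i}(P_n,Q_n)\in\,]0,\infty[$ for $i=1,2$. Write $k=k_n$. (1) If $\dfrac{k\ln n}{n}\to 0$, then the statistics $\widehat D_{\alpha_1,n}=D_{\alpha_1}(\hat P_n,Q_n)$ and $\widehat D_{\alpha_2,n}=D_{\alpha_2}(\hat P_n,Q_n)$ satisfy $$\mathrm{BE}\left(\widehat D_{\alpha_1,n};\widehat D_{\alpha_2,n}\right)=\begin{cases}\dfrac{\alpha_2-1}{\alpha_1-1}\cdot\dfrac{\ln\left(1+\alpha_1(\alpha_1-1)\Delta_{\alpha_1}\right)}{\ln\left(1+\alpha_2(\alpha_2-1)\Delta_{\alpha_2}\right)} & \text{for }\alpha_2<1,\\[3mm] \dfrac{1}{\alpha_1-1}\cdot\dfrac{\ln\left(1+\alpha_1(\alpha_1-1)\Delta_{\alpha_1}\right)}{\Delta_{\alpha_2}} & \text{for }\alpha_2=1.\end{cases}$$ (2) If $\dfrac{k^{2-1/\alpha_2}\ln n}{n}\to 0$, then, for the uniform hypothetical distributions $Q_n=U=(1/k,\dots,1/k)$, the statistics $\widehat D_{\alpha_1,n}=D_{\alpha_1}(\hat P_n,U)$ and $\widehat D_{\alpha_2,n}=D_{\alpha_2}(\hat P_n,U)$ satisfy $$\mathrm{BE}\left(\widehat D_{\alpha_1,n};\widehat D_{\alpha_2,n}\right)=\infty\qquad\text{for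 }\alpha_2>1 .$$
   Context: All limits are for $n\to\infty$. $M(k)$ is the set of probability vectors $P=(p_1,\dots,p_k)$. For $\alpha>0$, $P\in M(k)$ and $Q\in M(k)$ with positive coordinates, the power divergence is $D_\alpha(P,Q)=\frac{1}{\alpha(\alpha-1)}\left(\sum_{j=1}^k p_j^\alpha q_j^{1-\alpha}-1\right)$ for $\alpha\ne1$, and $D_1(P,Q)=\sum_{j=1}^k p_j\ln\frac{p_j}{q_j}$ (with $0\ln 0=0$). Model: $P_n=(p_{nj}),\,Q_n=(q_{nj})\in M(k_n)$; $\mathbf X_n=(X_{n1},\dots,X_{nk})$ is multinomially distributed, $\mathrm{Mult}_{k}(n,P_n)$ with $k=k_n$; $\hat P_n=\mathbf X_n/n$ is the empirical distribution; $\widehat D_{\alpha,n}=D_\alpha(\hat P_n,Q_n)$. The hypothesis $\mathcal H$ means $P_n=Q_n$ (so $\mathbf X_n\sim\mathrm{Mult}_k(n,Q_n)$); the alternative $\mathcal A$ means $\mathbf X_n\sim\mathrm{Mult}_k(n,P_n)$ with the given sequence $(P_n)$. $\mathsf P(\cdot\mid\mathcal H)$ denotes probability under $\mathcal H$. Assumptions. A1: $k_n\le n$ and $k_n$ increases to infinity. A2: $q_{nj}>0$, $\max_j q_{nj}\to0$, and there is $\varrho>0$ with $q_{nj}>\varrho/k_n$ for all $1\le j\le k_n$ and all $n$. A3$\alpha$: there is $0<\Delta_\alpha<\infty$ with $D_\alpha(P_n,Q_n)\to\Delta_\alpha$ under $\mathcal A$. $\mathbf A(\alpha_1,\alpha_2)$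 means A1, A2, A3$\alpha_1$ and A3$\alpha_2$. Consistency: $\widehat D_{\alpha,n}$ is consistent (with parameter $\Delta_\alpha$) if $\widehat D_{\alpha,n}\to\Delta_\alpha$ in probability under $\mathcal A$ and $\widehat D_{\alpha,n}\to0$ in probability under $\mathcal H$. Bahadur function: a continuous function $g_\alpha:\,]0,\infty[\,\to\,]0,\infty[$ is the Bahadur function of $\widehat D_{\alpha,n}$ generated by a sequence $c_\alpha(n)$ if for all $x>0$, $-\frac{c_\alpha(n)}{n}\ln\mathsf P(\widehat D_{\alpha,n}>x\mid\mathcal H)\to g_\alpha(x)$. Bahadur efficiency: suppose that $\mathbf A(\alpha_1,\alpha_2)$ holds, that for each $\alpha\in\{\alpha_1,\alpha_2\}$ the statistic $\widehat D_{\alpha,n}$ is consistent with parameter $\Delta_\alpha$ and has a Bahadur function $g_\alpha$ generated by $c_\alpha(n)$, and that for sample sizes $m_n\to\infty$ satisfying $\frac{m_n}{c_{\alpha_2}(m_n)}=\frac{g_{\alpha_1}(\Delta_{\alpha_1})}{g_{\alpha_2}(\Delta_{\alpha_2})}\cdot\frac{n}{c_{\alpha_1}(n)}(1+o(1))$ one has $\frac{c_{\alpha_2}(m_n)}{c_{\alpha_1}(n)}\to c_{\alpha_2/\alpha_1}$ for some $0\le c_{\alpha_2/\alpha_1}\le\infty$. Then the Bahadur efficiency of $\widehat D_{\alpha_1,n}$ with respect to $\widehat D_{\alpha_2,n}$ is $\mathrm{BE}(\widehat D_{\alpha_1,n};\widehat D_{\alpha_2,n})=\frac{g_{\alpha_1}(\Delta_{\alpha_1})}{g_{\alpha_2}(\Delta_{\alpha_2})}\cdot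 c_{\alpha_2/\alpha_1}\in[0,\infty]$. The claim that BE has a given value includes the claim that these requirements are met.
   Formalization: For α<1 the Bahadur function is taken only at x<1/(α(1-α)); for α2<1 it is assumed that 1+α2(α2-1)Δ2>0 (else ln 0); sample sizes m_n≤n count only if no size in [m_n,n] is asymptotically worse for the second statistic. *)

theory Defs
  imports "HOL-Probability.Probability" "HOL-Library.Landau_Symbols"
begin

definition prob_vector :: "nat \<Rightarrow> (nat \<Rightarrow> real) \<Rightarrow> bool" where
  "prob_vector k p \<longleftrightarrow> (\<forall>j\<in>{1..k}. 0 \<le> p j) \<and> (\<Sum>j=1..k. p j) = 1"

text \<open>Only used for \<open>\<alpha> > 0\<close> and positive \<open>q\<close>; then \<open>0 powr \<alpha> = 0\<close> and the convention
  \<open>0 ln 0 = 0\<close> come out as intended.\<close>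

definition power_divergence :: "real \<Rightarrow> nat \<Rightarrow> (nat \<Rightarrow> real) \<Rightarrow> (nat \<Rightarrow> real) \<Rightarrow> real" where
  "power_divergence \<alpha> k p q =
     (if \<alpha> = 1 then \<Sum>j=1..k. p j * ln (p j / q j)
      else ((\<Sum>j=1..k. p j powr \<alpha> * q j powr (1 - \<alpha>)) - 1) / (\<alpha> * (\<alpha> - 1)))"

definition cell_pmf :: "nat \<Rightarrow> (nat \<Rightarrow> real) \<Rightarrow> nat pmf" where
  "cell_pmf k p = embed_pmf (\<lambda>j. if j \<in> {1..k} then p j else 0)"

lemma pmf_cell_pmf:
  assumes "prob_vector k p"
  shows "pmf (cell_pmf k p) j = (if j \<in> {1..k} then p j else 0)"
  unfolding cell_pmf_def
proof (rule pmf_embed_pmf)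
  show "0 \<le> (if j \<in> {1..k} then p j else 0)" for j
    using assms by (simp add: prob_vector_def)
  have "(\<integral>\<^sup>+ j. ennreal (if j \<in> {1..k} then p j else 0) \<partial>count_space UNIV)
      = (\<Sum>j\<in>{1..k}. ennreal (p j))"
    by (subst nn_integral_count_space'[where A = "{1..k}"]) auto
  also have "\<dots> = ennreal (\<Sum>j=1..k. p j)"
    using assms by (intro sum_ennreal) (simp add: prob_vector_def)
  also have "\<dots> = 1"
    using assms by (simp add: prob_vector_def)
  finally show "(\<integral>\<^sup>+ j. ennreal (if j \<in> {1..k} then p j else 0) \<partial>count_space UNIV) = 1" .
qed

text \<open>The multinomial distribution \<open>Mult\<^sub>k(n, p)\<close> as the law of the cell counts of \<open>n\<close>
  independent draws from \<open>p\<close>.\<close>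

definition multinomial_pmf :: "nat \<Rightarrow> nat \<Rightarrow> (nat \<Rightarrow> real) \<Rightarrow> (nat \<Rightarrow> nat) pmf" where
  "multinomial_pmf k n p = map_pmf count_list (replicate_pmf n (cell_pmf k p))"

definition divergence_statistic ::
  "real \<Rightarrow> (nat \<Rightarrow> nat) \<Rightarrow> (nat \<Rightarrow> nat \<Rightarrow> real) \<Rightarrow> nat \<Rightarrow> (nat \<Rightarrow> nat) \<Rightarrow> real" where
  "divergence_statistic \<alpha> k Q n X =
     power_divergence \<alpha> (k n) (\<lambda>j. real (X j) / real n) (Q n)"

text \<open>Sample sizes start at \<open>1\<close>. In A1, "increases" is nondecreasing: a strictly increasing
  integer sequence with \<open>k n \<le> n\<close> cannot satisfy \<open>k n / n \<longlonglongrightarrow> 0\<close>.\<close>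

definition assumption_A1 :: "(nat \<Rightarrow> nat) \<Rightarrow> bool" where
  "assumption_A1 k \<longleftrightarrow>
     (\<forall>n\<ge>1. k n \<le> n) \<and> mono_on {1..} k \<and> filterlim k at_top sequentially"

definition assumption_A2 :: "(nat \<Rightarrow> nat) \<Rightarrow> (nat \<Rightarrow> nat \<Rightarrow> real) \<Rightarrow> bool" where
  "assumption_A2 k Q \<longleftrightarrow>
     (\<forall>n\<ge>1. \<forall>j\<in>{1..k n}. Q n j > 0) \<and>
     (\<lambda>n. Max (Q n ` {1..k n})) \<longlonglongrightarrow> 0 \<and>
     (\<exists>\<rho>>0. \<forall>n\<ge>1. \<forall>j\<in>{1..k n}. Q n j > \<rho> / real (k n))"

definition assumption_A3 ::
  "real \<Rightarrow> real \<Rightarrow> (nat \<Rightarrow> nat) \<Rightarrow> (nat \<Rightarrow> nat \<Rightarrow> real) \<Rightarrow> (nat \<Rightarrow> nat \<Rightarrow> real) \<Rightarrow> bool" where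
  "assumption_A3 \<alpha> \<Delta> k P Q \<longleftrightarrow>
     0 < \<Delta> \<and> (\<lambda>n. power_divergence \<alpha> (k n) (P n) (Q n)) \<longlonglongrightarrow> \<Delta>"

definition assumption_A ::
  "real \<Rightarrow> real \<Rightarrow> real \<Rightarrow> real \<Rightarrow> (nat \<Rightarrow> nat) \<Rightarrow> (nat \<Rightarrow> nat \<Rightarrow> real) \<Rightarrow> (nat \<Rightarrow> nat \<Rightarrow> real) \<Rightarrow> bool"
  where
  "assumption_A \<alpha>1 \<alpha>2 \<Delta>1 \<Delta>2 k P Q \<longleftrightarrow>
     (\<forall>n\<ge>1. prob_vector (k n) (P n) \<and> prob_vector (k n) (Q n)) \<and>
     assumption_A1 k \<and> assumption_A2 k Q \<and>
     assumption_A3 \<alpha>1 \<Delta>1 k P Q \<and> assumption_A3 \<alpha>2 \<Delta>2 k P Q"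

definition tendsto_in_prob :: "(nat \<Rightarrow> 'a pmf) \<Rightarrow> (nat \<Rightarrow> 'a \<Rightarrow> real) \<Rightarrow> real \<Rightarrow> bool" where
  "tendsto_in_prob M T a \<longleftrightarrow>
     (\<forall>\<epsilon>>0. (\<lambda>n. measure_pmf.prob (M n) {\<omega>. \<bar>T n \<omega> - a\<bar> > \<epsilon>}) \<longlonglongrightarrow> 0)"

definition consistent ::
  "real \<Rightarrow> real \<Rightarrow> (nat \<Rightarrow> nat) \<Rightarrow> (nat \<Rightarrow> nat \<Rightarrow> real) \<Rightarrow> (nat \<Rightarrow> nat \<Rightarrow> real) \<Rightarrow> bool" where
  "consistent \<alpha> \<Delta> k P Q \<longleftrightarrow>
     tendsto_in_prob (\<lambda>n. multinomial_pmf (k n) n (P n)) (divergence_statistic \<alpha> k Q) \<Delta> \<and>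
     tendsto_in_prob (\<lambda>n. multinomial_pmf (k n) n (Q n)) (divergence_statistic \<alpha> k Q) 0"

text \<open>The levels on which a Bahadur function lives. For \<open>\<alpha> \<ge> 1\<close> this is the whole half-line
  \<open>x > 0\<close>. For \<open>\<alpha> < 1\<close> the divergence of two probability vectors, the second one positive,
  never reaches \<open>1 / (\<alpha> (1 - \<alpha>))\<close>, so that \<open>D > x\<close> has probability \<open>0\<close> for all larger \<open>x\<close>
  and a real-valued exponent exists only for \<open>x < 1 / (\<alpha> (1 - \<alpha>))\<close>.\<close>

definition divergence_levels :: "real \<Rightarrow> real set" where
  "divergence_levels \<alpha> = {x. 0 < x \<and> 0 < 1 + \<alpha> * (\<alpha> - 1) * x}"

text \<open>The convention \<open>ln 0 = 0\<close> is harmless: as \<open>g x > 0\<close>, the limit forces the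
  probabilities to be positive, and \<open>c n > 0\<close>, for all large \<open>n\<close>.\<close>

definition bahadur_function ::
  "real \<Rightarrow> (nat \<Rightarrow> nat) \<Rightarrow> (nat \<Rightarrow> nat \<Rightarrow> real) \<Rightarrow> (nat \<Rightarrow> real) \<Rightarrow> (real \<Rightarrow> real) \<Rightarrow> bool" where
  "bahadur_function \<alpha> k Q c g \<longleftrightarrow>
     continuous_on (divergence_levels \<alpha>) g \<and>
     (\<forall>x\<in>divergence_levels \<alpha>. g x > 0 \<and>
        (\<lambda>n. - (c n / real n) *
           ln (measure_pmf.prob (multinomial_pmf (k n) n (Q n))
                 {X. divergence_statistic \<alpha> k Q n X > x})) \<longlonglongrightarrow> g x)"

text \<open>Sample sizes \<open>m n\<close> at which the second statistic matches the first one at sample size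
  \<open>n\<close>; \<open>r\<close> is the quotient of the Bahadur functions. If \<open>k\<close> has large jumps,
  \<open>n \<mapsto> n / c2 n\<close> can be far from monotone and the matching equation can have asymptotically
  different solutions. The last clause discards spurious ones: when \<open>m n \<le> n\<close>, no sample size
  between \<open>m n\<close> and \<open>n\<close> may be asymptotically worse for the second statistic than \<open>m n\<close>.
  It is void where \<open>m n > n\<close> and automatic if \<open>n / c2 n\<close> is eventually nondecreasing, in
  particular for constant \<open>c2\<close>.\<close>

definition matching_sample_sizes ::
  "(nat \<Rightarrow> real) \<Rightarrow> (nat \<Rightarrow> real) \<Rightarrow> real \<Rightarrow> (nat \<Rightarrow> nat) \<Rightarrow> bool" where
  "matching_sample_sizes c1 c2 r m \<longleftrightarrow>
     filterlim m at_top sequentially \<and>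
     (\<lambda>n. real (m n) / c2 (m n)) \<sim>[sequentially] (\<lambda>n. r * (real n / c1 n)) \<and>
     (\<forall>\<epsilon>>0. \<forall>\<^sub>F n in sequentially. \<forall>l\<in>{m n..n}.
        real l / c2 l \<ge> (1 - \<epsilon>) * (real (m n) / c2 (m n)))"

text \<open>The Bahadur efficiency of the statistic of order \<open>\<alpha>1\<close> with respect to the one of order
  \<open>\<alpha>2\<close> exists and equals \<open>b\<close>.\<close>

definition has_bahadur_efficiency ::
  "real \<Rightarrow> real \<Rightarrow> real \<Rightarrow> real \<Rightarrow> (nat \<Rightarrow> nat) \<Rightarrow> (nat \<Rightarrow> nat \<Rightarrow> real) \<Rightarrow> (nat \<Rightarrow> nat \<Rightarrow> real) \<Rightarrow>
     ereal \<Rightarrow> bool" where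
  "has_bahadur_efficiency \<alpha>1 \<alpha>2 \<Delta>1 \<Delta>2 k P Q b \<longleftrightarrow>
     assumption_A \<alpha>1 \<alpha>2 \<Delta>1 \<Delta>2 k P Q \<and>
     consistent \<alpha>1 \<Delta>1 k P Q \<and> consistent \<alpha>2 \<Delta>2 k P Q \<and>
     \<Delta>1 \<in> divergence_levels \<alpha>1 \<and> \<Delta>2 \<in> divergence_levels \<alpha>2 \<and>
     (\<exists>c1 c2 g1 g2 L.
        bahadur_function \<alpha>1 k Q c1 g1 \<and> bahadur_function \<alpha>2 k Q c2 g2 \<and>
        (\<exists>m. matching_sample_sizes c1 c2 (g1 \<Delta>1 / g2 \<Delta>2) m) \<and>
        (\<forall>m. matching_sample_sizes c1 c2 (g1 \<Delta>1 / g2 \<Delta>2) m \<longrightarrow>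
           (\<lambda>n. ereal (c2 (m n) / c1 n)) \<longlonglongrightarrow> L) \<and>
        0 \<le> L \<and> b = ereal (g1 \<Delta>1 / g2 \<Delta>2) * L)"

end

theory Submission
  imports Defs "HOL-Real_Asymp.Real_Asymp"
begin

text \<open>A power divergence under the hypothesis is governed by the information divergence \<open>D\<^sub>1\<close>: the
probability of seeing the empirical distribution \<open>p\<close> under \<open>q\<close> is at most \<open>exp (- n D\<^sub>1(p, q))\<close>, and
there are at most \<open>(n + 1) ^ k\<close> empirical distributions
(\<open>multinomial_prob_divergence_ge\<close>). Under the sparsity conditions on \<open>k\<close> the second factor does
not affect the exponent. The large deviation rate of \<open>{D\<^sub>\<alpha> > x}\<close> is therefore the infimum of \<open>D\<^sub>1\<close>
over this set, provided that this infimum is nearly attained by an explicit event.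

For \<open>\<alpha> \<le> 1\<close> the infimum is the Renyi divergence that belongs to the level \<open>x\<close>, since the Renyi
divergences of order \<open>\<alpha> < 1\<close> lie below \<open>D\<^sub>1\<close> (\<open>exp_divergence_le_power_sum\<close>). It is attained by
conditioning \<open>q\<close> on a set \<open>A\<close> of cells: if all observations fall into \<open>A\<close>, which has probability
\<open>q(A) ^ n\<close>, then the Renyi divergence of order \<open>\<alpha>\<close> of the empirical distribution is at least
\<open>- ln q(A)\<close> (\<open>power_sum_le_supported\<close>, \<open>divergence_ge_supported\<close>). As the cell probabilities tend to \<open>0\<close>, the
mass \<open>q(A)\<close> can be tuned to any value. So \<open>\<alpha> \<le> 1\<close> has a Bahadur function for the constant
sequence \<open>1\<close> (\<open>bahadur_function_le_1\<close>), and two such statistics have the quotient of their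
Bahadur functions as efficiency.

For \<open>\<alpha> > 1\<close> and uniform \<open>q\<close> it is cheapest to overload one single cell: mass
\<open>s = (\<alpha>(\<alpha>-1)x)^(1/\<alpha>) k^(1/\<alpha>-1)\<close> in one cell makes \<open>D\<^sub>\<alpha>\<close> about \<open>x\<close>, and costs only
\<open>D\<^sub>1 = s ln (k s)\<close>, about \<open>s ln k / \<alpha>\<close>, which tends to \<open>0\<close>. That nothing is cheaper is
\<open>uniform_divergence_lower_asymptotic\<close>: at densities below \<open>k^\<eta>\<close> with \<open>\<eta> < 1/\<alpha>\<close>, the information
divergence dominates the power divergence, so the excess of the latter must come from cells of
density above \<open>k^\<eta>\<close>, and there mass is charged by at least \<open>\<eta> ln k - 1\<close>. Hence the generating
sequence \<open>k^(1-1/\<alpha>) / ln k\<close> (\<open>bahadur_function_gt_1\<close>), which grows faster for larger \<open>\<alpha>\<close>. The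
statistic of order \<open>\<alpha>2 > 1\<close> then needs \<open>m n \<ge> n\<close> observations to match the other one with \<open>n\<close>, and
the quotient of the generating sequences at \<open>m n\<close> and \<open>n\<close> tends to infinity
(\<open>matching_sample_sizes_ratio_infinite\<close>).

Consistency, under the alternative and under the hypothesis alike, holds because all cell
frequencies are within \<open>\<epsilon> (p j + q j)\<close> of their means with high probability, and the power
divergences are uniformly continuous with respect to such relative perturbations
(\<open>power_divergence_modulus\<close>).\<close>

section \<open>Cell counts of multinomial samples\<close>

lemma map_replicate_pmf:
  "map_pmf (map f) (replicate_pmf n D) = replicate_pmf n (map_pmf f D)"
proof (induction n)
  case (Suc n)
  show ?case
    by (simp add: Suc[symmetric]) (simp add: map_pmf_def bind_assoc_pmf bind_return_pmf)
qed simp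

lemma map_pmf_eq_bernoulli:
  "map_pmf P D = bernoulli_pmf (measure_pmf.prob D {x. P x})"
proof (rule pmf_eqI)
  fix b
  have "pmf (map_pmf P D) True = measure_pmf.prob D {x. P x}"
    by (simp add: pmf_map vimage_def)
  moreover have "pmf (map_pmf P D) False = 1 - measure_pmf.prob D {x. P x}"
    using measure_pmf.prob_compl[of "{x. P x}" D]
    by (simp add: pmf_map vimage_def set_diff_eq)
  ultimately show "pmf (map_pmf P D) b = pmf (bernoulli_pmf (measure_pmf.prob D {x. P x})) b"
    by (cases b) auto
qed

text \<open>The number of draws that satisfy a predicate is binomial. This yields both the law of a single
cell count and the probability that all draws fall into a given set of cells.\<close>

lemma map_length_filter_replicate_pmf:
  "map_pmf (\<lambda>xs. length (filter P xs)) (replicate_pmf n D) =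
     binomial_pmf n (measure_pmf.prob D {x. P x})"
proof -
  have "(\<lambda>xs. length (filter P xs)) = (length \<circ> filter id) \<circ> map P"
    by (auto simp: fun_eq_iff filter_map)
  then have "map_pmf (\<lambda>xs. length (filter P xs)) (replicate_pmf n D) =
    map_pmf (length \<circ> filter id) (map_pmf (map P) (replicate_pmf n D))"
    by (simp add: pmf.map_comp)
  also have "\<dots> = binomial_pmf n (measure_pmf.prob D {x. P x})"
    by (subst binomial_pmf_altdef) (simp_all add: map_replicate_pmf map_pmf_eq_bernoulli)
  finally show ?thesis .
qed

lemma set_cell_pmf: "prob_vector k p \<Longrightarrow> set_pmf (cell_pmf k p) \<subseteq> {1..k}"
  by (auto simp: set_pmf_eq pmf_cell_pmf split: if_splits)

lemma prob_cell_pmf: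
  assumes "prob_vector k p"
  shows "measure_pmf.prob (cell_pmf k p) A = (\<Sum>j\<in>A \<inter> {1..k}. p j)"
proof -
  have "measure_pmf.prob (cell_pmf k p) A = measure_pmf.prob (cell_pmf k p) (A \<inter> {1..k})"
    using set_cell_pmf[OF assms]
    by (intro measure_pmf.finite_measure_eq_AE) (auto simp: AE_measure_pmf_iff)
  also have "\<dots> = (\<Sum>j\<in>A \<inter> {1..k}. p j)"
    by (subst measure_measure_pmf_finite) (auto simp: pmf_cell_pmf[OF assms])
  finally show ?thesis .
qed

lemma map_multinomial_pmf_cell:
  assumes "prob_vector k p" "j \<in> {1..k}"
  shows "map_pmf (\<lambda>X. X j) (multinomial_pmf k n p) = binomial_pmf n (p j)"
proof -
  have "{x. j = x} \<inter> {1..k} = {j}" using assms(2) by auto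
  then have "measure_pmf.prob (cell_pmf k p) {x. j = x} = p j"
    by (simp only: prob_cell_pmf[OF assms(1)]) simp
  moreover have "map_pmf (\<lambda>X. X j) (multinomial_pmf k n p) =
      map_pmf (\<lambda>xs. length (filter ((=) j) xs)) (replicate_pmf n (cell_pmf k p))"
    by (simp add: multinomial_pmf_def pmf.map_comp o_def count_list_eq_length_filter)
  ultimately show ?thesis
    by (simp add: map_length_filter_replicate_pmf)
qed

lemma multinomial_support:
  assumes "prob_vector k p" "X \<in> set_pmf (multinomial_pmf k n p)"
  shows "(\<Sum>j=1..k. X j) = n" and "j \<notin> {1..k} \<Longrightarrow> X j = 0" and "X j \<le> n"
proof -
  obtain xs where xs: "X = count_list xs" "set xs \<subseteq> {1..k}" "length xs = n"
    using assms(2) set_cell_pmf[OF assms(1)]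
    by (fastforce simp: multinomial_pmf_def set_replicate_pmf)
  show "(\<Sum>j=1..k. X j) = n"
    using sum_list_map_eq_sum_count2[OF xs(2), of "\<lambda>_. 1"] xs(1,3)
    by (simp add: sum_list_triv)
  show "j \<notin> {1..k} \<Longrightarrow> X j = 0"
    using xs by (auto intro!: count_notin)
  show "X j \<le> n" using xs count_le_length by metis
qed

lemma prob_vector_empirical:
  assumes "prob_vector k p" "X \<in> set_pmf (multinomial_pmf k n p)" "n \<ge> 1"
  shows "prob_vector k (\<lambda>j. real (X j) / real n)"
proof -
  have "(\<Sum>j=1..k. real (X j)) = real n"
    unfolding of_nat_sum[symmetric] multinomial_support(1)[OF assms(1,2)] ..
  then show ?thesis
    using assms(3) by (simp add: prob_vector_def flip: sum_divide_distrib)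
qed

lemma multinomial_prob_mono:
  assumes "\<And>X. X \<in> set_pmf (multinomial_pmf k n p) \<Longrightarrow> X \<in> A \<Longrightarrow> X \<in> B"
  shows "measure_pmf.prob (multinomial_pmf k n p) A \<le> measure_pmf.prob (multinomial_pmf k n p) B"
  using assms by (intro measure_pmf.finite_measure_mono_AE) (auto simp: AE_measure_pmf_iff)

text \<open>The event occurs as soon as all \<open>n\<close> independent draws fall into \<open>A\<close>.\<close>

lemma multinomial_prob_supported:
  assumes "prob_vector k p" "A \<subseteq> {1..k}"
  shows "measure_pmf.prob (multinomial_pmf k n p) {X. \<forall>j\<in>{1..k} - A. X j = 0} \<ge> (\<Sum>j\<in>A. p j) ^ n"
proof -
  have "A \<inter> {1..k} = A" using assms(2) by auto
  then have q: "measure_pmf.prob (cell_pmf k p) {x. x \<in> A} = (\<Sum>j\<in>A. p j)"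
    using prob_cell_pmf[OF assms(1), of A] by simp
  have "0 \<le> (\<Sum>j\<in>A. p j)" "(\<Sum>j\<in>A. p j) \<le> 1"
    unfolding q[symmetric] by auto
  then have "(\<Sum>j\<in>A. p j) ^ n = pmf (binomial_pmf n (\<Sum>j\<in>A. p j)) n"
    by simp
  also have "\<dots> = measure_pmf.prob (replicate_pmf n (cell_pmf k p)) ((\<lambda>xs. length (filter (\<lambda>x. x \<in> A) xs)) -` {n})"
    by (simp only: q[symmetric] map_length_filter_replicate_pmf[symmetric] pmf_map)
  also have "\<dots> \<le> measure_pmf.prob (replicate_pmf n (cell_pmf k p))
      (count_list -` {X. \<forall>j\<in>{1..k} - A. X j = 0})"
  proof (intro measure_pmf.finite_measure_mono_AE)
    have "set xs \<subseteq> A" if "length (filter (\<lambda>x. x \<in> A) xs) = length xs" for xs :: "nat list"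
      using that by (metis filter_id_conv length_filter_less less_irrefl subsetI)
    then show "AE xs in replicate_pmf n (cell_pmf k p).
        xs \<in> (\<lambda>xs. length (filter (\<lambda>x. x \<in> A) xs)) -` {n} \<longrightarrow>
        xs \<in> count_list -` {X. \<forall>j\<in>{1..k} - A. X j = 0}"
      by (auto simp: AE_measure_pmf_iff set_replicate_pmf count_list_0_iff)
  qed auto
  finally show ?thesis by (simp add: multinomial_pmf_def)
qed

lemma exp_le_quadratic:
  fixes x :: real
  assumes "\<bar>x\<bar> \<le> 1"
  shows "exp x \<le> 1 + x + x\<^sup>2"
proof (cases "x \<ge> 0")
  case True
  then show ?thesis using exp_bound assms by auto
next
  case False
  define y where "y = - x"
  have y: "0 < y" "y \<le> 1" using False assms by (auto simp: y_def)
  have "1 + y + y\<^sup>2 / 2 \<le> exp y" using exp_lower_Taylor_quadratic[of y] y by simp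
  moreover have "1 \<le> (1 + y + y\<^sup>2 / 2) * (1 - y + y\<^sup>2)"
  proof -
    have "(1 + y + y\<^sup>2 / 2) * (1 - y + y\<^sup>2) = 1 + y\<^sup>2 * (1/2 + y / 2 + y\<^sup>2 / 2)"
      by (simp add: field_simps power2_eq_square)
    then show ?thesis using y by simp
  qed
  moreover have "1 - y + y\<^sup>2 > 0" using y by (simp add: add_nonneg_pos)
  ultimately have "1 \<le> exp y * (1 - y + y\<^sup>2)"
    by (smt (verit) mult_right_mono)
  then have "exp (- y) \<le> 1 - y + y\<^sup>2"
    by (simp add: exp_minus field_simps)
  then show ?thesis by (simp add: y_def)
qed

lemma binomial_mgf:
  assumes "p \<in> {0..1}"
  shows "measure_pmf.expectation (binomial_pmf n p) (\<lambda>i. exp (s * real i)) = (1 + p * (exp s - 1)) ^ n"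
proof -
  have "measure_pmf.expectation (binomial_pmf n p) (\<lambda>i. exp (s * real i)) =
     (\<Sum>i\<le>n. real (n choose i) * (p * exp s) ^ i * (1 - p) ^ (n - i))"
    by (subst expectation_binomial_pmf'[OF assms])
      (simp add: power_mult_distrib exp_of_nat_mult mult_ac atMost_def atLeast0AtMost[symmetric] flip: exp_of_nat_mult)
  also have "\<dots> = (p * exp s + (1 - p)) ^ n"
    by (simp add: binomial_ring)
  also have "p * exp s + (1 - p) = 1 + p * (exp s - 1)"
    by (simp add: algebra_simps)
  finally show ?thesis .
qed

text \<open>Chernoff bound with exponent \<open>\<epsilon> / 2\<close>. The extra \<open>q\<close> in the permitted deviation makes the bound
useful for cells whose own probability \<open>p\<close> is tiny or \<open>0\<close>.\<close>

lemma binomial_relative_deviation: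
  assumes p: "p \<in> {0..1}" and q: "0 \<le> q" and e: "0 < \<epsilon>" "\<epsilon> \<le> 1"
  shows "measure_pmf.prob (binomial_pmf n p) {i. \<bar>real i - real n * p\<bar> \<ge> real n * (\<epsilon> * (p + q))}
     \<le> 2 * exp (- (real n * \<epsilon>\<^sup>2 * q / 2))"
proof -
  let ?M = "binomial_pmf n p"
  define s where "s = \<epsilon> / 2"
  have mgf: "measure_pmf.expectation ?M (\<lambda>i. exp (t * real i)) \<le> exp (real n * (p * (t + t\<^sup>2)))"
    if "\<bar>t\<bar> \<le> 1" for t
  proof -
    have "0 \<le> (1 - p) + p * exp t" using p by simp
    then have "0 \<le> 1 + p * (exp t - 1)" by (simp add: right_diff_distrib)
    moreover have "1 + p * (exp t - 1) \<le> exp (p * (t + t\<^sup>2))"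
    proof -
      have "p * (exp t - 1) \<le> p * (t + t\<^sup>2)"
        using exp_le_quadratic[OF that] p by (intro mult_left_mono) auto
      then show ?thesis using exp_ge_add_one_self[of "p * (t + t\<^sup>2)"] by linarith
    qed
    ultimately show ?thesis
      unfolding binomial_mgf[OF p] exp_of_nat_mult by (intro power_mono)
  qed
  have bound: "exp (- t) * u \<le> exp (- (real n * \<epsilon>\<^sup>2 * q / 2))"
    if "u \<le> exp v" "v - t \<le> real n * (p * s\<^sup>2 - s * (\<epsilon> * (p + q)))" for t u v
  proof -
    have "exp (- t) * u \<le> exp (v - t)"
      using that(1) by (simp add: exp_diff exp_minus field_simps)
    also have "p * s\<^sup>2 - s * (\<epsilon> * (p + q)) = - (\<epsilon>\<^sup>2 * q / 2) - \<epsilon>\<^sup>2 * p / 4"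
      by (simp add: s_def power2_eq_square field_simps)
    then have "v - t \<le> real n * (- (\<epsilon>\<^sup>2 * q / 2))"
      using that(2) p by (smt (verit) mult_left_mono atLeastAtMost_iff divide_nonneg_nonneg mult_nonneg_nonneg of_nat_0_le_iff zero_le_power2)
    then have "exp (v - t) \<le> exp (- (real n * \<epsilon>\<^sup>2 * q / 2))" by (simp add: mult_ac)
    finally show ?thesis .
  qed
  have s: "0 < s" "\<bar>s\<bar> \<le> 1" using e by (auto simp: s_def)
  have up: "measure_pmf.prob ?M {i. real i \<ge> real n * p + real n * (\<epsilon> * (p + q))} \<le> exp (- (real n * \<epsilon>\<^sup>2 * q / 2))"
  proof -
    have "measure_pmf.prob ?M {i. real i \<ge> real n * p + real n * (\<epsilon> * (p + q))} \<le>
        exp (- (s * (real n * p + real n * (\<epsilon> * (p + q))))) * measure_pmf.expectation ?M (\<lambda>i. exp (s * real i))"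
      using measure_pmf.Chernoff_ineq_ge[where M = ?M and s = s and A = UNIV and f = real and a = "real n * p + real n * (\<epsilon> * (p + q))"] s p
      by (simp add: set_integrable_def set_lebesgue_integral_def)
    also have "\<dots> \<le> exp (- (real n * \<epsilon>\<^sup>2 * q / 2))"
      by (rule bound[OF mgf[OF s(2)]]) (simp add: algebra_simps)
    finally show ?thesis by simp
  qed
  have lo: "measure_pmf.prob ?M {i. real i \<le> real n * p - real n * (\<epsilon> * (p + q))} \<le> exp (- (real n * \<epsilon>\<^sup>2 * q / 2))"
  proof -
    have "measure_pmf.prob ?M {i. real i \<le> real n * p - real n * (\<epsilon> * (p + q))} \<le>
        exp (s * (real n * p - real n * (\<epsilon> * (p + q)))) * measure_pmf.expectation ?M (\<lambda>i. exp (- s * real i))"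
      using measure_pmf.Chernoff_ineq_le[where M = ?M and s = s and A = UNIV and f = real and a = "real n * p - real n * (\<epsilon> * (p + q))"] s p
      by (simp add: set_integrable_def set_lebesgue_integral_def)
    also have "\<dots> = exp (- (- (s * (real n * p - real n * (\<epsilon> * (p + q)))))) * measure_pmf.expectation ?M (\<lambda>i. exp (- s * real i))"
      by simp
    also have "\<dots> \<le> exp (- (real n * \<epsilon>\<^sup>2 * q / 2))"
      by (rule bound[OF mgf]) (use s in \<open>simp_all add: algebra_simps\<close>)
    finally show ?thesis by simp
  qed
  have "measure_pmf.prob ?M {i. \<bar>real i - real n * p\<bar> \<ge> real n * (\<epsilon> * (p + q))} \<le>
     measure_pmf.prob ?M ({i. real i \<ge> real n * p + real n * (\<epsilon> * (p + q))} \<union> {i. real i \<le> real n * p - real n * (\<epsilon> * (p + q))})"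
    by (intro measure_pmf.finite_measure_mono) auto
  also have "\<dots> \<le> exp (- (real n * \<epsilon>\<^sup>2 * q / 2)) + exp (- (real n * \<epsilon>\<^sup>2 * q / 2))"
    by (intro order.trans[OF measure_Un_le] add_mono up lo) auto
  finally show ?thesis by simp
qed

lemma pmf_replicate_pmf:
  "pmf (replicate_pmf n D) xs = (if length xs = n then \<Prod>x\<leftarrow>xs. pmf D x else 0)"
proof (induction n arbitrary: xs)
  case 0
  then show ?case by (cases xs) (auto simp: pmf_return)
next
  case (Suc n)
  have *: "replicate_pmf (Suc n) D = map_pmf (\<lambda>(x, xs). x # xs) (pair_pmf D (replicate_pmf n D))"
    by (simp add: pair_pmf_def map_pmf_def bind_assoc_pmf bind_return_pmf)
  show ?case
  proof (cases xs)
    case Nil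
    then show ?thesis unfolding * by (auto intro!: pmf_map_outside)
  next
    case (Cons y ys)
    have "pmf (replicate_pmf (Suc n) D) ((\<lambda>(x, xs). x # xs) (y, ys)) =
        pmf (pair_pmf D (replicate_pmf n D)) (y, ys)"
      unfolding * by (rule pmf_map_inj') (auto simp: inj_def)
    then show ?thesis using Suc Cons by (simp add: pmf_pair)
  qed
qed

lemma prod_list_map_eq_prod_count:
  fixes f :: "'a \<Rightarrow> real"
  assumes "set xs \<subseteq> A" "finite A"
  shows "(\<Prod>x\<leftarrow>xs. f x) = (\<Prod>x\<in>A. f x ^ count_list xs x)"
  using assms(1)
proof (induction xs)
  case (Cons x xs)
  have "(\<Prod>y\<in>A. f y ^ count_list (x # xs) y) = (\<Prod>y\<in>A. (if y = x then f x else 1) * f y ^ count_list xs y)"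
    by (intro prod.cong) auto
  also have "\<dots> = f x * (\<Prod>y\<in>A. f y ^ count_list xs y)"
    using Cons assms(2) by (simp add: prod.distrib prod.delta)
  finally show ?case using Cons by simp
qed simp

text \<open>The likelihood of a sample with empirical distribution \<open>h\<close> under \<open>p\<close> is \<open>exp (- n D\<^sub>1(h, p))\<close>
times its likelihood under \<open>h\<close> itself, and the latter likelihoods sum to at most \<open>1\<close>.\<close>

lemma multinomial_type_bound:
  assumes p: "prob_vector k p" and pos: "\<And>j. j \<in> {1..k} \<Longrightarrow> p j > 0" and n: "n \<ge> 1"
    and X: "X \<in> set_pmf (multinomial_pmf k n p)"
  shows "pmf (multinomial_pmf k n p) X \<le> exp (- (n * power_divergence 1 k (\<lambda>j. X j / n) p))"
proof -
  define D where "D = power_divergence 1 k (\<lambda>j. X j / n) p"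
  define h where "h = (\<lambda>j. real (X j) / real n)"
  have h: "prob_vector k h"
    unfolding h_def by (rule prob_vector_empirical[OF p X n])
  define S where "S = {xs. set xs \<subseteq> {1..k} \<and> length xs = n \<and> count_list xs = X}"
  have fin: "finite S"
    by (rule finite_subset[OF _ finite_lists_length_eq[of "{1..k}" n]]) (auto simp: S_def)
  \<comment> \<open>change of measure from \<open>p\<close> to the empirical distribution \<open>h\<close>, sample by sample\<close>
  have weight: "pmf (replicate_pmf n (cell_pmf k p)) xs =
      exp (- (n * D)) * pmf (replicate_pmf n (cell_pmf k h)) xs" if "xs \<in> S" for xs
  proof -
    have xs: "set xs \<subseteq> {1..k}" "length xs = n" "count_list xs = X" using that by (auto simp: S_def)
    have weight_of: "pmf (replicate_pmf n (cell_pmf k r)) xs = (\<Prod>j\<in>{1..k}. r j ^ X j)"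
      if "prob_vector k r" for r
    proof -
      have "pmf (replicate_pmf n (cell_pmf k r)) xs = (\<Prod>j\<in>{1..k}. pmf (cell_pmf k r) j ^ X j)"
        using prod_list_map_eq_prod_count[OF xs(1)] xs(2,3) by (simp add: pmf_replicate_pmf)
      also have "\<dots> = (\<Prod>j\<in>{1..k}. r j ^ X j)"
        by (intro prod.cong) (auto simp: pmf_cell_pmf[OF that])
      finally show ?thesis .
    qed
    have "exp (- (n * D)) = (\<Prod>j\<in>{1..k}. exp (- (n * (h j * ln (h j / p j)))))"
      by (simp add: D_def power_divergence_def h_def sum_distrib_left exp_sum flip: sum_negf)
    moreover have "exp (- (n * (h j * ln (h j / p j)))) * h j ^ X j = p j ^ X j"
      if j: "j \<in> {1..k}" for j
    proof (cases "X j = 0")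
      case False
      then have hj: "h j > 0" using n by (simp add: h_def)
      have "n * (h j * ln (h j / p j)) = X j * ln (h j / p j)" using n by (simp add: h_def)
      then have "exp (- (n * (h j * ln (h j / p j)))) = (exp (- ln (h j / p j))) ^ X j"
        by (simp flip: exp_of_nat_mult)
      also have "exp (- ln (h j / p j)) = p j / h j"
        using hj pos[OF j] by (simp add: exp_minus)
      finally show ?thesis using hj by (simp flip: power_mult_distrib)
    qed (simp add: h_def)
    ultimately show ?thesis
      by (simp add: weight_of p h flip: prod.distrib)
  qed
  have "pmf (multinomial_pmf k n p) X = measure_pmf.prob (replicate_pmf n (cell_pmf k p)) (count_list -` {X})"
    by (simp add: multinomial_pmf_def pmf_map)
  also have "\<dots> \<le> measure_pmf.prob (replicate_pmf n (cell_pmf k p)) S"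
    using set_cell_pmf[OF p]
    by (intro measure_pmf.finite_measure_mono_AE)
      (auto simp: AE_measure_pmf_iff S_def set_replicate_pmf)
  also have "\<dots> = (\<Sum>xs\<in>S. exp (- (n * D)) * pmf (replicate_pmf n (cell_pmf k h)) xs)"
    using fin by (simp add: measure_measure_pmf_finite weight)
  also have "\<dots> = exp (- (n * D)) * measure_pmf.prob (replicate_pmf n (cell_pmf k h)) S"
    using fin by (simp add: measure_measure_pmf_finite sum_distrib_left)
  also have "\<dots> \<le> exp (- (n * D))"
    by simp
  finally show ?thesis by (simp add: D_def)
qed

text \<open>Union bound over the at most \<open>(n + 1) ^ k\<close> possible count vectors.\<close>

lemma multinomial_prob_divergence_ge:
  assumes p: "prob_vector k p" and pos: "\<And>j. j \<in> {1..k} \<Longrightarrow> p j > 0" and n: "n \<ge> 1"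
  shows "measure_pmf.prob (multinomial_pmf k n p) {X. power_divergence 1 k (\<lambda>j. X j / n) p \<ge> r}
     \<le> (real n + 1) ^ k * exp (- (n * r))"
proof -
  let ?M = "multinomial_pmf k n p"
  define T where "T = set_pmf ?M \<inter> {X. power_divergence 1 k (\<lambda>j. X j / n) p \<ge> r}"
  have sub: "T \<subseteq> PiE_dflt {1..k} 0 (\<lambda>_. {..n})"
    using multinomial_support(2,3)[OF p] by (auto simp: T_def PiE_dflt_def)
  have finD: "finite (PiE_dflt {1..k} 0 (\<lambda>_. {..n}))"
    by (rule finite_PiE_dflt) auto
  then have fin: "finite T" using sub by (rule finite_subset[rotated])
  have "card T \<le> card (PiE_dflt {1..k} (0::nat) (\<lambda>_. {..n}))"
    by (rule card_mono[OF finD sub])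
  also have "\<dots> = (n + 1) ^ k"
    by (subst card_PiE_dflt) auto
  finally have card: "real (card T) \<le> (real n + 1) ^ k"
    by (metis of_nat_1 of_nat_add of_nat_le_iff of_nat_power)
  have "measure_pmf.prob ?M {X. power_divergence 1 k (\<lambda>j. X j / n) p \<ge> r} \<le> measure_pmf.prob ?M T"
    by (rule multinomial_prob_mono) (auto simp: T_def)
  also have "\<dots> = (\<Sum>X\<in>T. pmf ?M X)"
    by (rule measure_measure_pmf_finite[OF fin])
  also have "\<dots> \<le> (\<Sum>X\<in>T. exp (- (n * r)))"
  proof (rule sum_mono)
    fix X assume "X \<in> T"
    then have "pmf ?M X \<le> exp (- (n * power_divergence 1 k (\<lambda>j. X j / n) p))"
      and "r \<le> power_divergence 1 k (\<lambda>j. X j / n) p"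
      using multinomial_type_bound[OF p pos n] by (auto simp: T_def)
    then show "pmf ?M X \<le> exp (- (n * r))"
      using n by (smt (verit) exp_le_cancel_iff mult_left_mono of_nat_0_le_iff)
  qed
  also have "\<dots> \<le> (real n + 1) ^ k * exp (- (n * r))"
    using card by (simp add: mult_right_mono)
  finally show ?thesis .
qed

lemma multinomial_prob_cell_deviates:
  assumes p: "prob_vector k p" and n: "n \<ge> 1" and k: "k \<ge> 1"
    and q: "\<And>j. j \<in> {1..k} \<Longrightarrow> q j \<ge> \<rho> / real k" and "\<rho> > 0"
    and e: "0 < \<epsilon>" "\<epsilon> \<le> 1"
  shows "measure_pmf.prob (multinomial_pmf k n p)
     {X. \<exists>j\<in>{1..k}. \<bar>X j / n - p j\<bar> > \<epsilon> * (p j + q j)} \<le> 2 * k * exp (- (\<epsilon>\<^sup>2 * \<rho> / 2 * (n / k)))"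
proof -
  let ?M = "multinomial_pmf k n p"
  define B where "B = (\<lambda>j. {X::nat \<Rightarrow> nat. \<bar>real (X j) - n * p j\<bar> \<ge> n * (\<epsilon> * (p j + q j))})"
  have one: "measure_pmf.prob ?M (B j) \<le> 2 * exp (- (\<epsilon>\<^sup>2 * \<rho> / 2 * (n / k)))" if j: "j \<in> {1..k}" for j
  proof -
    have "p j \<ge> 0" using p j by (auto simp: prob_vector_def)
    moreover have "p j \<le> (\<Sum>j=1..k. p j)" 
      using p j by (intro member_le_sum) (auto simp: prob_vector_def)
    ultimately have pj: "p j \<in> {0..1}" using p by (auto simp: prob_vector_def)
    have qj: "0 \<le> q j" using q[OF j] \<open>\<rho> > 0\<close> by (smt (verit) divide_nonneg_nonneg of_nat_0_le_iff)
    have "measure_pmf.prob ?M (B j) =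
        measure_pmf.prob (map_pmf (\<lambda>X. X j) ?M) {i. \<bar>real i - n * p j\<bar> \<ge> n * (\<epsilon> * (p j + q j))}"
      by (simp add: B_def vimage_def)
    also have "\<dots> \<le> 2 * exp (- (n * \<epsilon>\<^sup>2 * q j / 2))"
      unfolding map_multinomial_pmf_cell[OF p j] by (rule binomial_relative_deviation[OF pj qj e])
    also have "\<dots> \<le> 2 * exp (- (\<epsilon>\<^sup>2 * \<rho> / 2 * (n / k)))"
    proof -
      have "(n * \<epsilon>\<^sup>2 / 2) * (\<rho> / k) \<le> (n * \<epsilon>\<^sup>2 / 2) * q j"
        by (rule mult_left_mono[OF q[OF j]]) simp
      then show ?thesis by (simp add: field_simps)
    qed
    finally show ?thesis .
  qed
  have "\<bar>X j / n - p j\<bar> * n = \<bar>real (X j) - n * p j\<bar>" for X :: "nat \<Rightarrow> nat" and j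
  proof -
    have "\<bar>X j / n - p j\<bar> * n = \<bar>(X j / n - p j) * n\<bar>" by (simp add: abs_mult)
    also have "(X j / n - p j) * n = X j - n * p j" using n by (simp add: field_simps)
    finally show ?thesis .
  qed
  then have "X \<in> B j" if "\<bar>X j / n - p j\<bar> > \<epsilon> * (p j + q j)" for X j
    using mult_right_mono[OF less_imp_le[OF that], of "real n"] by (simp add: B_def mult.commute)
  then have "{X. \<exists>j\<in>{1..k}. \<bar>X j / n - p j\<bar> > \<epsilon> * (p j + q j)} \<subseteq> (\<Union>j\<in>{1..k}. B j)"
    by blast
  then have "measure_pmf.prob ?M {X. \<exists>j\<in>{1..k}. \<bar>X j / n - p j\<bar> > \<epsilon> * (p j + q j)} \<le>
      measure_pmf.prob ?M (\<Union>j\<in>{1..k}. B j)"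
    by (rule measure_pmf.finite_measure_mono) simp
  also have "\<dots> \<le> (\<Sum>j\<in>{1..k}. measure_pmf.prob ?M (B j))"
    by (rule measure_UNION_le) auto
  also have "\<dots> \<le> (\<Sum>j\<in>{1..k}. 2 * exp (- (\<epsilon>\<^sup>2 * \<rho> / 2 * (n / k))))"
    by (intro sum_mono one)
  finally show ?thesis by simp
qed

section \<open>Power divergences and information divergence\<close>

text \<open>The Hellinger integral of order \<open>\<alpha>\<close>; its logarithm divided by \<open>\<alpha> - 1\<close> is the Renyi divergence.\<close>

definition power_sum :: "real \<Rightarrow> nat \<Rightarrow> (nat \<Rightarrow> real) \<Rightarrow> (nat \<Rightarrow> real) \<Rightarrow> real" where
  "power_sum \<alpha> k p q = (\<Sum>j=1..k. p j powr \<alpha> * q j powr (1 - \<alpha>))"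

lemma power_sum_eq_divergence:
  "\<alpha> \<noteq> 0 \<Longrightarrow> \<alpha> \<noteq> 1 \<Longrightarrow> power_sum \<alpha> k p q = 1 + \<alpha> * (\<alpha> - 1) * power_divergence \<alpha> k p q"
  by (simp add: power_sum_def power_divergence_def)

lemma power_divergence_cong:
  assumes "\<And>j. j \<in> {1..k} \<Longrightarrow> p j = p' j" "\<And>j. j \<in> {1..k} \<Longrightarrow> q j = q' j"
  shows "power_divergence \<alpha> k p q = power_divergence \<alpha> k p' q'"
  unfolding power_divergence_def using assms by (auto intro!: sum.cong)

lemma power_sum_pos:
  assumes "prob_vector k p" "\<And>j. j \<in> {1..k} \<Longrightarrow> q j > 0"
  shows "power_sum \<alpha> k p q > 0"
proof -
  obtain j where j: "j \<in> {1..k}" "p j \<noteq> 0"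
    using assms(1) by (metis prob_vector_def sum.neutral zero_neq_one)
  then have "p j > 0" using assms(1) by (auto simp: prob_vector_def order.strict_iff_order)
  with j assms(2)[OF j(1)] show ?thesis
    unfolding power_sum_def by (intro sum_pos2[of _ j]) auto
qed

text \<open>Jensen's inequality for \<open>exp\<close> and the random variable \<open>(\<alpha> - 1) ln (p / q)\<close> under \<open>p\<close>. It says that
the information divergence lies above the Renyi divergences of order \<open>\<alpha> < 1\<close> and below those of
order \<open>\<alpha> > 1\<close>.\<close>

lemma exp_divergence_le_power_sum:
  assumes p: "prob_vector k p" and q: "\<And>j. j \<in> {1..k} \<Longrightarrow> q j > 0"
  shows "exp ((\<alpha> - 1) * power_divergence 1 k p q) \<le> power_sum \<alpha> k p q"
proof -
  define D where "D = power_divergence 1 k p q"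
  have D: "D = (\<Sum>j=1..k. p j * ln (p j / q j))" by (simp add: D_def power_divergence_def)
  have term_le: "p j * (1 - (\<alpha> - 1) * D) + (\<alpha> - 1) * (p j * ln (p j / q j)) \<le>
      p j powr \<alpha> * q j powr (1 - \<alpha>) * exp (- ((\<alpha> - 1) * D))" if j: "j \<in> {1..k}" for j
  proof (cases "p j = 0")
    case False
    then have pj: "p j > 0" using p j by (auto simp: prob_vector_def order.strict_iff_order)
    have "p j powr \<alpha> * q j powr (1 - \<alpha>) * exp (- ((\<alpha> - 1) * D)) = p j * exp ((\<alpha> - 1) * (ln (p j / q j) - D))"
      using pj q[OF j] by (simp add: powr_def ln_div mult_exp_exp[symmetric] algebra_simps exp_add exp_diff exp_minus)
    also have "\<dots> \<ge> p j * (1 + (\<alpha> - 1) * (ln (p j / q j) - D))"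
      using pj exp_ge_add_one_self by (intro mult_left_mono) auto
    finally show ?thesis by (simp add: algebra_simps)
  qed auto
  have "1 = (\<Sum>j=1..k. p j) * (1 - (\<alpha> - 1) * D) + (\<alpha> - 1) * (\<Sum>j=1..k. p j * ln (p j / q j))"
    using p unfolding D[symmetric] by (simp add: prob_vector_def)
  also have "\<dots> = (\<Sum>j=1..k. p j * (1 - (\<alpha> - 1) * D) + (\<alpha> - 1) * (p j * ln (p j / q j)))"
    by (simp add: sum.distrib sum_distrib_left sum_distrib_right)
  also have "\<dots> \<le> (\<Sum>j=1..k. p j powr \<alpha> * q j powr (1 - \<alpha>) * exp (- ((\<alpha> - 1) * D)))"
    by (intro sum_mono term_le)
  also have "\<dots> = power_sum \<alpha> k p q * exp (- ((\<alpha> - 1) * D))"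
    by (simp add: power_sum_def sum_distrib_right)
  finally have "exp ((\<alpha> - 1) * D) * 1 \<le> exp ((\<alpha> - 1) * D) * (power_sum \<alpha> k p q * exp (- ((\<alpha> - 1) * D)))"
    by (intro mult_left_mono) auto
  also have "\<dots> = power_sum \<alpha> k p q" by (simp add: exp_minus)
  finally show ?thesis by (simp add: D_def)
qed

lemma weighted_geometric_le_arithmetic:
  fixes a b :: real
  assumes "0 < t" "t < 1" "0 \<le> a" "0 \<le> b"
  shows "a powr t * b powr (1 - t) \<le> t * a + (1 - t) * b"
  using assms Youngs_inequality_0[of t "1 - t" a b] by (cases "a = 0"; cases "b = 0") auto

lemma supported_mass_pos:
  fixes q :: "nat \<Rightarrow> real"
  assumes p: "prob_vector k p" and q: "\<And>j. j \<in> {1..k} \<Longrightarrow> q j > 0"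
    and A: "A \<subseteq> {1..k}" "\<And>j. j \<in> {1..k} - A \<Longrightarrow> p j = 0"
  shows "(\<Sum>j\<in>A. p j) = 1" "0 < (\<Sum>j\<in>A. q j)" "finite A"
proof -
  show fin: "finite A" using A(1) finite_subset by blast
  have "(\<Sum>j\<in>A. p j) = (\<Sum>j=1..k. p j)" using A by (intro sum.mono_neutral_left) auto
  then show one: "(\<Sum>j\<in>A. p j) = 1" using p by (simp add: prob_vector_def)
  then have "A \<noteq> {}" by auto
  show "0 < (\<Sum>j\<in>A. q j)" by (rule sum_pos[OF fin \<open>A \<noteq> {}\<close>]) (use q A(1) in auto)
qed

text \<open>Hoelder's inequality on \<open>A\<close>. Equality holds when \<open>p\<close> is \<open>q\<close> conditioned on \<open>A\<close>.\<close>

lemma power_sum_le_supported: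
  assumes p: "prob_vector k p" and q: "\<And>j. j \<in> {1..k} \<Longrightarrow> q j > 0"
    and A: "A \<subseteq> {1..k}" "\<And>j. j \<in> {1..k} - A \<Longrightarrow> p j = 0" and \<alpha>: "0 < \<alpha>" "\<alpha> < 1"
  shows "power_sum \<alpha> k p q \<le> (\<Sum>j\<in>A. q j) powr (1 - \<alpha>)"
proof -
  define w where "w = (\<Sum>j\<in>A. q j)"
  note A' = supported_mass_pos[OF p q A]
  have w: "0 < w" using A' by (simp add: w_def)
  have "power_sum \<alpha> k p q = (\<Sum>j\<in>A. p j powr \<alpha> * q j powr (1 - \<alpha>))"
    unfolding power_sum_def using A \<alpha> by (intro sum.mono_neutral_right) auto
  also have "\<dots> \<le> (\<Sum>j\<in>A. w powr (1 - \<alpha>) * (\<alpha> * p j + (1 - \<alpha>) * (q j / w)))"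
  proof (rule sum_mono)
    fix j assume "j \<in> A"
    then have j: "j \<in> {1..k}" using A by auto
    have "p j powr \<alpha> * q j powr (1 - \<alpha>) = w powr (1 - \<alpha>) * (p j powr \<alpha> * (q j / w) powr (1 - \<alpha>))"
      using w q[OF j] by (simp add: powr_divide)
    also have "\<dots> \<le> w powr (1 - \<alpha>) * (\<alpha> * p j + (1 - \<alpha>) * (q j / w))"
      using p j q[OF j] w \<alpha>
      by (intro mult_left_mono weighted_geometric_le_arithmetic) (auto simp: prob_vector_def)
    finally show "p j powr \<alpha> * q j powr (1 - \<alpha>) \<le> w powr (1 - \<alpha>) * (\<alpha> * p j + (1 - \<alpha>) * (q j / w))" .
  qed
  also have "\<dots> = w powr (1 - \<alpha>) * (\<alpha> * (\<Sum>j\<in>A. p j) + (1 - \<alpha>) * ((\<Sum>j\<in>A. q j) / w))"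
    by (simp only: sum_distrib_left[symmetric] sum.distrib sum_divide_distrib[symmetric])
  also have "\<dots> = w powr (1 - \<alpha>)"
    using w A' by (simp flip: w_def)
  finally show ?thesis by (simp add: w_def)
qed

text \<open>The limiting case \<open>\<alpha> = 1\<close> of the preceding bound.\<close>

lemma divergence_ge_supported:
  assumes p: "prob_vector k p" and q: "\<And>j. j \<in> {1..k} \<Longrightarrow> q j > 0"
    and A: "A \<subseteq> {1..k}" "\<And>j. j \<in> {1..k} - A \<Longrightarrow> p j = 0"
  shows "power_divergence 1 k p q \<ge> - ln (\<Sum>j\<in>A. q j)"
proof -
  define w where "w = (\<Sum>j\<in>A. q j)"
  note A' = supported_mass_pos[OF p q A]
  have w: "0 < w" using A' by (simp add: w_def)
  have "- ln w = (\<Sum>j\<in>A. p j * (1 - ln w) - q j / w)"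
    using w A' by (simp add: sum_subtractf flip: w_def sum_divide_distrib sum_distrib_right)
  also have "\<dots> \<le> (\<Sum>j\<in>A. p j * ln (p j / q j))"
  proof (rule sum_mono)
    fix j assume "j \<in> A"
    then have j: "j \<in> {1..k}" using A by auto
    show "p j * (1 - ln w) - q j / w \<le> p j * ln (p j / q j)"
    proof (cases "p j = 0")
      case True
      then show ?thesis using w q[OF j] by simp
    next
      case False
      then have pj: "p j > 0" using p j by (auto simp: prob_vector_def order.strict_iff_order)
      have "ln (q j / (w * p j)) \<le> q j / (w * p j) - 1"
        using pj q[OF j] w by (intro ln_le_minus_one) auto
      then have "p j * ln (q j / (w * p j)) \<le> p j * (q j / (w * p j) - 1)"
        using pj by (intro mult_left_mono) auto
      also have "\<dots> = q j / w - p j" using pj w by (simp add: field_simps)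
      finally show ?thesis using pj q[OF j] w by (simp add: ln_div ln_mult algebra_simps)
    qed
  qed
  also have "\<dots> = power_divergence 1 k p q"
    using A by (simp add: power_divergence_def) (intro sum.mono_neutral_left, auto)
  finally show ?thesis by (simp add: w_def)
qed

text \<open>Log-convexity of \<open>\<alpha> \<mapsto> power_sum \<alpha>\<close> between \<open>\<alpha>1\<close> and \<open>1\<close>, where the power sum is \<open>1\<close>.\<close>

lemma power_sum_lyapunov:
  assumes p: "prob_vector k p" and q: "\<And>j. j \<in> {1..k} \<Longrightarrow> q j > 0"
    and \<alpha>: "\<alpha>1 < \<alpha>2" "\<alpha>2 < 1"
  shows "power_sum \<alpha>2 k p q \<le> power_sum \<alpha>1 k p q powr ((1 - \<alpha>2) / (1 - \<alpha>1))"
proof -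
  define t where "t = (1 - \<alpha>2) / (1 - \<alpha>1)"
  define H where "H = power_sum \<alpha>1 k p q"
  have t: "0 < t" "t < 1" using \<alpha> by (auto simp: t_def field_simps)
  have t2: "(1 - \<alpha>1) * t = 1 - \<alpha>2"
    using \<alpha> by (auto simp: t_def)
  then have t': "\<alpha>1 * t + (1 - t) = \<alpha>2" "(1 - \<alpha>1) * t = 1 - \<alpha>2"
    by (simp_all add: algebra_simps)
  have H: "H > 0" unfolding H_def by (rule power_sum_pos[OF p q])
  have "power_sum \<alpha>2 k p q \<le> (\<Sum>j=1..k. H powr t * (t * (p j powr \<alpha>1 * q j powr (1 - \<alpha>1) / H) + (1 - t) * p j))"
    unfolding power_sum_def
  proof (rule sum_mono)
    fix j assume j: "j \<in> {1..k}"
    have pj: "p j \<ge> 0" using p j by (auto simp: prob_vector_def)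
    have "p j powr \<alpha>2 * q j powr (1 - \<alpha>2) = p j powr (\<alpha>1 * t + (1 - t)) * q j powr ((1 - \<alpha>1) * t)"
      by (simp only: t')
    also have "\<dots> = (p j powr \<alpha>1 * q j powr (1 - \<alpha>1)) powr t * p j powr (1 - t)"
      using pj q[OF j] by (simp add: powr_add powr_mult powr_powr)
    also have "\<dots> = H powr t * ((p j powr \<alpha>1 * q j powr (1 - \<alpha>1) / H) powr t * p j powr (1 - t))"
      using H by (simp add: powr_divide)
    also have "\<dots> \<le> H powr t * (t * (p j powr \<alpha>1 * q j powr (1 - \<alpha>1) / H) + (1 - t) * p j)"
      using H pj t by (intro mult_left_mono weighted_geometric_le_arithmetic) auto
    finally show "p j powr \<alpha>2 * q j powr (1 - \<alpha>2) \<le>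
      H powr t * (t * (p j powr \<alpha>1 * q j powr (1 - \<alpha>1) / H) + (1 - t) * p j)" .
  qed
  also have "\<dots> = H powr t * (t * (power_sum \<alpha>1 k p q / H) + (1 - t) * (\<Sum>j=1..k. p j))"
    by (simp only: sum_distrib_left[symmetric] sum.distrib sum_divide_distrib[symmetric] power_sum_def)
  also have "\<dots> = H powr t"
    using H p by (simp add: prob_vector_def flip: H_def)
  finally show ?thesis by (simp add: H_def t_def)
qed

text \<open>Both remainders vanish to first order at \<open>u = 1\<close>, and the quotient of their second derivatives
\<open>\<alpha> (\<alpha> - 1) u powr (\<alpha> - 2)\<close> and \<open>1 / u\<close> is at most \<open>\<alpha> (\<alpha> - 1) M powr (\<alpha> - 1)\<close> on \<open>u \<le> M\<close>.\<close>

lemma powr_remainder_le_entropy_remainder: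
  fixes u M \<alpha> :: real
  assumes "1 < \<alpha>" "1 \<le> M" "0 \<le> u" "u \<le> M"
  shows "u powr \<alpha> - 1 - \<alpha> * (u - 1) \<le> \<alpha> * (\<alpha> - 1) * M powr (\<alpha> - 1) * (u * ln u - u + 1)"
proof -
  define K where "K = M powr (\<alpha> - 1)"
  have K: "1 \<le> K" using assms by (simp add: K_def ge_one_powr_ge_zero)
  define F where "F = (\<lambda>u. \<alpha> * (\<alpha> - 1) * K * (u * ln u - u + 1) - (u powr \<alpha> - 1 - \<alpha> * (u - 1)))"
  define F' where "F' = (\<lambda>u. \<alpha> * ((\<alpha> - 1) * K * ln u - (u powr (\<alpha> - 1) - 1)))"
  have deriv: "(F has_real_derivative F' u) (at u)" if "u > 0" for u
    unfolding F_def F'_def using that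
    by (auto intro!: derivative_eq_intros simp: powr_diff field_simps)
  have F1: "F 1 = 0" by (simp add: F_def)
  have pos: "F' u \<ge> 0" if "1 \<le> u" "u \<le> M" for u
  proof -
    define v where "v = u powr (\<alpha> - 1)"
    have v: "1 \<le> v" "v \<le> K" "ln v = (\<alpha> - 1) * ln u"
      using that assms by (auto simp: v_def K_def ge_one_powr_ge_zero powr_mono2 ln_powr)
    have "ln (1 / v) \<le> 1 / v - 1" using v by (intro ln_le_minus_one) auto
    then have "v - 1 \<le> v * ln v" using v(1,2) by (simp add: ln_div field_simps)
    also have "\<dots> \<le> K * ln v" using v(1,2) by (intro mult_right_mono) auto
    finally have "v - 1 \<le> (\<alpha> - 1) * K * ln u" using v by (simp add: mult_ac)
    then show ?thesis using assms by (simp add: F'_def v_def)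
  qed
  have neg: "F' u \<le> 0" if "0 < u" "u \<le> 1" for u
  proof -
    define v where "v = u powr (\<alpha> - 1)"
    have v: "0 < v" "v \<le> 1" "ln v = (\<alpha> - 1) * ln u"
      using that assms powr_mono2[of "\<alpha> - 1" u 1] by (auto simp: v_def ln_powr)
    have "K * ln v \<le> 1 * ln v" using v(1,2) K by (intro mult_right_mono_neg) auto
    also have "\<dots> \<le> v - 1" using ln_le_minus_one[OF v(1)] by simp
    finally have "(\<alpha> - 1) * K * ln u \<le> v - 1" using v by (simp add: mult_ac)
    then show ?thesis using assms by (simp add: F'_def v_def mult_le_0_iff)
  qed
  have "F u \<ge> 0"
  proof (cases "u = 0")
    case True
    have "\<alpha> * (\<alpha> - 1) * K \<ge> \<alpha> * (\<alpha> - 1) * 1" using assms K by (intro mult_left_mono) auto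
    moreover have "\<alpha> * (\<alpha> - 1) \<ge> 1 * (\<alpha> - 1)" using assms by (intro mult_right_mono) auto
    ultimately show ?thesis using True by (simp add: F_def)
  next
    case False
    show ?thesis
    proof (cases "1 \<le> u")
      case True
      have "F 1 \<le> F u"
      proof (rule DERIV_nonneg_imp_nondecreasing[OF True])
        fix x assume "1 \<le> x" "x \<le> u"
        then show "\<exists>y. DERIV F x :> y \<and> 0 \<le> y"
          using deriv[of x] pos[of x] assms(4) by (intro exI[of _ "F' x"]) auto
      qed
      then show ?thesis using F1 by simp
    next
      case u: False
      have "F u \<ge> F 1"
      proof (rule DERIV_nonpos_imp_nonincreasing[of u 1 F])
        show "u \<le> 1" using u by simp
        fix x assume "u \<le> x" "x \<le> 1"
        then show "\<exists>y. DERIV F x :> y \<and> y \<le> 0"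
          using deriv[of x] neg[of x] assms(3) \<open>u \<noteq> 0\<close> by (intro exI[of _ "F' x"]) auto
      qed
      then show ?thesis using F1 by simp
    qed
  qed
  then show ?thesis by (simp add: F_def K_def)
qed

text \<open>An upper bound on the excess of the power sum in terms of the information divergence, both in
terms of the densities \<open>u j = k p j\<close>, obtained by cutting at a level \<open>M\<close>. Densities up to \<open>M\<close>
contribute the first summand. The mass \<open>T\<close> of the densities above \<open>M\<close> is at most \<open>I / (ln M - 1)\<close>,
and their \<open>\<alpha>\<close>-th powers sum to at most \<open>T powr \<alpha>\<close>.\<close>

lemma uniform_divergence_tradeoff:
  assumes p: "prob_vector k p" and k: "k \<ge> 1" and \<alpha>: "1 < \<alpha>" and M: "0 < M" "1 < ln M"
    and y: "1 + y \<le> power_sum \<alpha> k p (\<lambda>_. 1 / real k)"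
  defines "I \<equiv> real k * power_divergence 1 k p (\<lambda>_. 1 / real k)"
  shows "real k * y \<le> \<alpha> * (\<alpha> - 1) * M powr (\<alpha> - 1) * I + (I / (ln M - 1)) powr \<alpha>" and "0 \<le> I"
proof -
  define u where "u = (\<lambda>j. real k * p j)"
  define \<phi> where "\<phi> = (\<lambda>u::real. u * ln u - u + 1)"
  have M0: "M > 1" using M by (intro ln_gt_zero_imp_gt_one) linarith+
  have u: "u j \<ge> 0" if "j \<in> {1..k}" for j using p that by (auto simp: u_def prob_vector_def)
  have sum_u: "(\<Sum>j=1..k. u j) = real k"
    using p by (simp add: u_def prob_vector_def flip: sum_distrib_left)
  have \<phi>: "\<phi> v \<ge> 0" if "v \<ge> 0" for v
  proof (cases "v = 0")
    case False
    then have "ln (1 / v) \<le> 1 / v - 1" using that by (intro ln_le_minus_one) auto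
    then show ?thesis using False that by (simp add: \<phi>_def ln_div field_simps)
  qed (simp add: \<phi>_def)
  have "I = (\<Sum>j=1..k. u j * ln (u j))"
    by (simp add: I_def power_divergence_def u_def sum_distrib_left mult_ac)
  then have I: "I = (\<Sum>j=1..k. \<phi> (u j))"
    using sum_u by (simp add: \<phi>_def sum.distrib sum_subtractf)
  then show I0: "0 \<le> I" using u \<phi> by (auto intro!: sum_nonneg)
  define B where "B = {j \<in> {1..k}. u j > M}"
  define T where "T = (\<Sum>j\<in>B. u j)"
  have B: "finite B" "B \<subseteq> {1..k}" by (auto simp: B_def)
  have sum_B: "(\<Sum>j\<in>B. \<phi> (u j)) \<le> I"
    unfolding I using B u \<phi> by (intro sum_mono2) auto
  have sum_nB: "(\<Sum>j\<in>{1..k} - B. \<phi> (u j)) \<le> I"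
    unfolding I using B u \<phi> by (intro sum_mono2) auto
  have T: "(ln M - 1) * T \<le> I"
  proof -
    have "(ln M - 1) * T \<le> (\<Sum>j\<in>B. \<phi> (u j))"
      unfolding T_def sum_distrib_left
    proof (rule sum_mono)
      fix j assume "j \<in> B"
      then have uj: "u j > M" by (simp add: B_def)
      then have "ln M * u j \<le> ln (u j) * u j" using M0 by (intro mult_right_mono) auto
      then show "(ln M - 1) * u j \<le> \<phi> (u j)" by (simp add: \<phi>_def algebra_simps)
    qed
    with sum_B show ?thesis by simp
  qed
  have T0: "T \<ge> 0" unfolding T_def using B u by (auto intro!: sum_nonneg)
  have big: "(\<Sum>j\<in>B. u j powr \<alpha>) \<le> T powr \<alpha>"
  proof -
    have "(\<Sum>j\<in>B. u j powr \<alpha>) \<le> (\<Sum>j\<in>B. T powr (\<alpha> - 1) * u j)"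
    proof (rule sum_mono)
      fix j assume j: "j \<in> B"
      then have uj: "u j > 0" using M0 by (simp add: B_def)
      have "u j \<le> T" unfolding T_def using B u j by (intro member_le_sum) auto
      then have "u j powr (\<alpha> - 1) \<le> T powr (\<alpha> - 1)" using uj \<alpha> by (intro powr_mono2) auto
      then have "u j powr (\<alpha> - 1) * u j \<le> T powr (\<alpha> - 1) * u j" using uj by (intro mult_right_mono) auto
      then show "u j powr \<alpha> \<le> T powr (\<alpha> - 1) * u j" using uj by (simp add: powr_diff)
    qed
    also have "\<dots> = T powr (\<alpha> - 1) * T" by (simp add: T_def sum_distrib_left)
    also have "\<dots> = T powr \<alpha>" using T0 by (cases "T = 0") (simp_all add: powr_diff)
    finally show ?thesis .
  qed
  have "real k * power_sum \<alpha> k p (\<lambda>_. 1 / real k) = (\<Sum>j=1..k. u j powr \<alpha>)"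
  proof -
    have "real k * (p j powr \<alpha> * (1 / real k) powr (1 - \<alpha>)) = u j powr \<alpha>" if "j \<in> {1..k}" for j
      using k p that by (auto simp: u_def powr_mult powr_divide powr_diff prob_vector_def)
    then show ?thesis unfolding power_sum_def sum_distrib_left by (intro sum.cong) auto
  qed
  moreover have "real k * (1 + y) \<le> real k * power_sum \<alpha> k p (\<lambda>_. 1 / real k)"
    using y by (intro mult_left_mono) auto
  ultimately have "real k * y \<le> (\<Sum>j=1..k. u j powr \<alpha>) - real k"
    by (simp add: algebra_simps)
  also have "\<dots> = (\<Sum>j=1..k. u j powr \<alpha> - 1 - \<alpha> * (u j - 1))"
    using sum_u by (simp add: sum_subtractf flip: sum_distrib_left)
  also have "\<dots> = (\<Sum>j\<in>{1..k} - B. u j powr \<alpha> - 1 - \<alpha> * (u j - 1)) + (\<Sum>j\<in>B. u j powr \<alpha> - 1 - \<alpha> * (u j - 1))"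
    using B by (intro sum.subset_diff) auto
  also have "\<dots> \<le> (\<Sum>j\<in>{1..k} - B. \<alpha> * (\<alpha> - 1) * M powr (\<alpha> - 1) * \<phi> (u j)) + (\<Sum>j\<in>B. u j powr \<alpha>)"
  proof (intro add_mono sum_mono)
    fix j assume "j \<in> {1..k} - B"
    then show "u j powr \<alpha> - 1 - \<alpha> * (u j - 1) \<le> \<alpha> * (\<alpha> - 1) * M powr (\<alpha> - 1) * \<phi> (u j)"
      unfolding \<phi>_def using u \<alpha> M0 by (intro powr_remainder_le_entropy_remainder) (auto simp: B_def)
  next
    fix j assume "j \<in> B"
    then have "0 \<le> \<alpha> * (u j - 1)" using \<alpha> M0 by (auto simp: B_def)
    then show "u j powr \<alpha> - 1 - \<alpha> * (u j - 1) \<le> u j powr \<alpha>" by linarith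
  qed
  also have "(\<Sum>j\<in>{1..k} - B. \<alpha> * (\<alpha> - 1) * M powr (\<alpha> - 1) * \<phi> (u j)) \<le> \<alpha> * (\<alpha> - 1) * M powr (\<alpha> - 1) * I"
    unfolding sum_distrib_left[symmetric] using sum_nB \<alpha> by (intro mult_left_mono) auto
  also have "(\<Sum>j\<in>B. u j powr \<alpha>) \<le> (I / (ln M - 1)) powr \<alpha>"
  proof -
    have "T \<le> I / (ln M - 1)" using T M by (simp add: field_simps)
    then have "T powr \<alpha> \<le> (I / (ln M - 1)) powr \<alpha>" using T0 \<alpha> by (intro powr_mono2) auto
    with big show ?thesis by simp
  qed
  finally show "real k * y \<le> \<alpha> * (\<alpha> - 1) * M powr (\<alpha> - 1) * I + (I / (ln M - 1)) powr \<alpha>" by simp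
qed

lemma bernoulli_powr:
  fixes u \<alpha> :: real
  assumes "1 < \<alpha>" "0 \<le> u"
  shows "1 + \<alpha> * (u - 1) \<le> u powr \<alpha>"
proof -
  have "(u powr \<alpha>) powr (1 / \<alpha>) * 1 powr (1 - 1 / \<alpha>) \<le> 1 / \<alpha> * u powr \<alpha> + (1 - 1 / \<alpha>) * 1"
    using assms by (intro weighted_geometric_le_arithmetic) auto
  also have "(u powr \<alpha>) powr (1 / \<alpha>) * 1 powr (1 - 1 / \<alpha>) = u"
    using assms by (simp add: powr_powr)
  finally have "\<alpha> * u \<le> \<alpha> * (1 / \<alpha> * u powr \<alpha> + (1 - 1 / \<alpha>) * 1)"
    using assms by (intro mult_left_mono) auto
  then show ?thesis using assms by (simp add: algebra_simps)
qed

text \<open>What a single cell of mass \<open>p 1\<close> enforces. By the Bernoulli inequality the other cells contribute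
at least \<open>1 - 1 / k - \<alpha> p 1\<close>, however their mass is distributed.\<close>

lemma uniform_power_sum_ge_cell:
  assumes p: "prob_vector k p" and k: "k \<ge> 1" and \<alpha>: "1 < \<alpha>"
  shows "power_sum \<alpha> k p (\<lambda>_. 1 / real k) \<ge> real k powr (\<alpha> - 1) * p 1 powr \<alpha> + 1 - 1 / real k - \<alpha> * p 1"
proof -
  have p1: "0 \<le> p 1" "(\<Sum>j\<in>{1..k} - {1}. p j) = 1 - p 1"
    using p k by (auto simp: prob_vector_def sum_diff1)
  have cell: "p j powr \<alpha> * (1 / real k) powr (1 - \<alpha>) = (k * p j) powr \<alpha> / k" if "p j \<ge> 0" for j
    using k that by (simp add: powr_mult powr_divide powr_diff)
  have split: "power_sum \<alpha> k p (\<lambda>_. 1 / real k) =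
     p 1 powr \<alpha> * (1 / real k) powr (1 - \<alpha>) + (\<Sum>j\<in>{1..k} - {1}. p j powr \<alpha> * (1 / real k) powr (1 - \<alpha>))"
    unfolding power_sum_def using k by (intro sum.remove) auto
  have first: "p 1 powr \<alpha> * (1 / real k) powr (1 - \<alpha>) = real k powr (\<alpha> - 1) * p 1 powr \<alpha>"
    using k by (simp add: powr_divide powr_diff)
  have "1 - 1 / real k - \<alpha> * p 1 \<le> (real k - 1) * ((1 - \<alpha>) / k) + \<alpha> * (1 - p 1)"
    using k \<alpha> by (simp add: field_simps)
  also have "\<dots> = (\<Sum>j\<in>{1..k} - {1}. (1 - \<alpha>) / k + \<alpha> * p j)"
    using k p1 by (simp add: sum.distrib of_nat_diff flip: sum_distrib_left)
  also have "\<dots> \<le> (\<Sum>j\<in>{1..k} - {1}. p j powr \<alpha> * (1 / real k) powr (1 - \<alpha>))"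
  proof (rule sum_mono)
    fix j assume "j \<in> {1..k} - {1}"
    then have pj: "p j \<ge> 0" using p by (auto simp: prob_vector_def)
    have "(1 + \<alpha> * (k * p j - 1)) / k \<le> (k * p j) powr \<alpha> / k"
      using bernoulli_powr[OF \<alpha>, of "k * p j"] pj by (intro divide_right_mono) auto
    then show "(1 - \<alpha>) / k + \<alpha> * p j \<le> p j powr \<alpha> * (1 / real k) powr (1 - \<alpha>)"
      unfolding cell[OF pj] using k by (simp add: field_simps)
  qed
  finally show ?thesis unfolding split first by linarith
qed

lemma powr_relative_modulus:
  fixes \<alpha> :: real
  assumes "0 < \<alpha>" "0 < \<eta>"
  shows "\<exists>\<epsilon>>0. \<forall>a\<in>{0..2}. \<forall>b\<in>{0..2}. \<bar>a - b\<bar> \<le> \<epsilon> \<longrightarrow> \<bar>a powr \<alpha> - b powr \<alpha>\<bar> \<le> \<eta>"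
proof -
  have "uniformly_continuous_on {0..2} (\<lambda>x::real. x powr \<alpha>)"
    using assms by (intro compact_uniformly_continuous continuous_on_powr' continuous_intros) auto
  then obtain d where d: "d > 0" "\<And>a b. a \<in> {0..2} \<Longrightarrow> b \<in> {0..2} \<Longrightarrow> dist b a < d \<Longrightarrow> dist (b powr \<alpha>) (a powr \<alpha>) < \<eta>"
    unfolding uniformly_continuous_on_def using assms(2) by metis
  then show ?thesis
    by (intro exI[of _ "d/2"]) (force simp: dist_real_def)
qed

lemma x_ln_x_modulus:
  assumes "0 < \<eta>"
  shows "\<exists>\<epsilon>>0. \<forall>a\<in>{0..2::real}. \<forall>b\<in>{0..2}. \<bar>a - b\<bar> \<le> \<epsilon> \<longrightarrow> \<bar>a * ln a - b * ln b\<bar> \<le> \<eta>"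
proof -
  have "continuous_on {0..2} (\<lambda>x::real. x * ln x)"
    unfolding continuous_on
  proof
    fix x :: real assume "x \<in> {0..2}"
    show "((\<lambda>x. x * ln x) \<longlongrightarrow> x * ln x) (at x within {0..2})"
    proof (cases "x = 0")
      case True
      have "((\<lambda>x::real. x * ln x) \<longlongrightarrow> 0) (at_right 0)" by real_asymp
      moreover have "at (0::real) within {0..2} = at_right 0"
        by (rule at_within_Icc_at_right) simp
      ultimately show ?thesis using True by simp
    next
      case False
      then show ?thesis by (intro tendsto_intros)
    qed
  qed
  then have "uniformly_continuous_on {0..2} (\<lambda>x::real. x * ln x)"
    by (intro compact_uniformly_continuous) auto
  then obtain d where d: "d > 0" "\<And>a b::real. a \<in> {0..2} \<Longrightarrow> b \<in> {0..2} \<Longrightarrow> dist b a < d \<Longrightarrow> dist (b * ln b) (a * ln a) < \<eta>"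
    unfolding uniformly_continuous_on_def using assms by metis
  then show ?thesis
    by (intro exI[of _ "d/2"]) (force simp: dist_real_def)
qed

text \<open>Uniform continuity of the power divergence in its first argument, on the
set where the divergence is at most \<open>C\<close>, with a modulus that depends neither on the dimension \<open>k\<close> nor on \<open>q\<close>. The weights \<open>s = p j + q j\<close> are the natural scale: in terms
of \<open>p j / s\<close>, which lies in \<open>[0, 1]\<close>, only the uniform continuity of \<open>a powr \<alpha>\<close> or \<open>a ln a\<close> on a
compact interval is needed, and the weights that are left over have a sum bounded in terms of the
divergence itself.\<close>

lemma power_divergence_modulus:
  assumes \<alpha>: "0 < \<alpha>" and \<eta>: "0 < \<eta>" and C: "0 \<le> C"
  obtains \<epsilon> where "0 < \<epsilon>" "\<epsilon> \<le> 1"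
    "\<And>k p p' q. prob_vector k p \<Longrightarrow> prob_vector k q \<Longrightarrow> (\<And>j. j \<in> {1..k} \<Longrightarrow> 0 < q j \<and> 0 \<le> p' j) \<Longrightarrow>
       \<bar>power_divergence \<alpha> k p q\<bar> \<le> C \<Longrightarrow> (\<And>j. j \<in> {1..k} \<Longrightarrow> \<bar>p' j - p j\<bar> \<le> \<epsilon> * (p j + q j)) \<Longrightarrow>
       \<bar>power_divergence \<alpha> k p' q - power_divergence \<alpha> k p q\<bar> \<le> \<eta>"
proof (cases "\<alpha> = 1")
  case False
  define c where "c = \<bar>\<alpha> * (\<alpha> - 1)\<bar>"
  have c: "c > 0" using False \<alpha> by (simp add: c_def)
  define B where "B = 2 powr \<alpha> * (2 + c * C)"
  have B: "B > 0" using c C by (simp add: B_def add_pos_nonneg)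
  \<comment> \<open>\<open>\<omega>\<close> is the precision on \<open>[0, 2]\<close> for which the errors of all cells add up to at most \<open>\<eta>\<close>\<close>
  define \<omega> where "\<omega> = \<eta> * c / B"
  have "\<omega> > 0" using \<eta> c B by (simp add: \<omega>_def)
  then obtain \<epsilon>' where \<epsilon>': "\<epsilon>' > 0" "\<And>a b. a \<in> {0..2} \<Longrightarrow> b \<in> {0..2} \<Longrightarrow> \<bar>a - b\<bar> \<le> \<epsilon>' \<Longrightarrow> \<bar>a powr \<alpha> - b powr \<alpha>\<bar> \<le> \<omega>"
    using powr_relative_modulus[OF \<alpha>] by metis
  define \<epsilon> where "\<epsilon> = min \<epsilon>' 1"
  show ?thesis
  proof (rule that[of \<epsilon>])
    show "0 < \<epsilon>" "\<epsilon> \<le> 1" using \<epsilon>'(1) by (auto simp: \<epsilon>_def)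
    fix k :: nat and p p' q :: "nat \<Rightarrow> real"
    assume p: "prob_vector k p" and q: "prob_vector k q" and pos: "\<And>j. j \<in> {1..k} \<Longrightarrow> 0 < q j \<and> 0 \<le> p' j"
      and D: "\<bar>power_divergence \<alpha> k p q\<bar> \<le> C"
      and close: "\<And>j. j \<in> {1..k} \<Longrightarrow> \<bar>p' j - p j\<bar> \<le> \<epsilon> * (p j + q j)"
    have term_le: "\<bar>p' j powr \<alpha> * q j powr (1 - \<alpha>) - p j powr \<alpha> * q j powr (1 - \<alpha>)\<bar> \<le>
        \<omega> * 2 powr \<alpha> * (p j powr \<alpha> * q j powr (1 - \<alpha>) + q j)" if j: "j \<in> {1..k}" for j
    proof -
      define s where "s = p j + q j"
      have pj: "p j \<ge> 0" using p j by (auto simp: prob_vector_def)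
      have qj: "q j > 0" and p'j: "p' j \<ge> 0" using pos[OF j] by auto
      have s: "s > 0" using pj qj by (simp add: s_def)
      have d: "\<bar>p' j - p j\<bar> \<le> \<epsilon> * s" using close[OF j] by (simp add: s_def)
      have "\<epsilon> * s \<le> s" using s by (simp add: \<epsilon>_def mult_le_cancel_right1)
      then have a': "p' j / s \<in> {0..2}" using d s pj qj p'j by (auto simp: field_simps s_def)
      have a: "p j / s \<in> {0..2}" using s pj qj by (auto simp: field_simps s_def)
      have "\<bar>p' j / s - p j / s\<bar> = \<bar>p' j - p j\<bar> / s" using s by (simp add: diff_divide_distrib[symmetric])
      also have "\<dots> \<le> \<epsilon>" using d s by (simp add: field_simps)
      finally have "\<bar>(p' j / s) powr \<alpha> - (p j / s) powr \<alpha>\<bar> \<le> \<omega>"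
        by (intro \<epsilon>'(2) a a') (simp add: \<epsilon>_def)
      then have "s powr \<alpha> * \<bar>(p' j / s) powr \<alpha> - (p j / s) powr \<alpha>\<bar> \<le> s powr \<alpha> * \<omega>"
        by (intro mult_left_mono) auto
      also have "s powr \<alpha> * \<bar>(p' j / s) powr \<alpha> - (p j / s) powr \<alpha>\<bar> = \<bar>s powr \<alpha> * ((p' j / s) powr \<alpha> - (p j / s) powr \<alpha>)\<bar>"
        by (simp add: abs_mult)
      also have "s powr \<alpha> * ((p' j / s) powr \<alpha> - (p j / s) powr \<alpha>) = p' j powr \<alpha> - p j powr \<alpha>"
        using s pj p'j by (simp add: powr_divide right_diff_distrib)
      finally have diff: "\<bar>p' j powr \<alpha> - p j powr \<alpha>\<bar> \<le> s powr \<alpha> * \<omega>" .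
      \<comment> \<open>returns from the scale \<open>s = p j + q j\<close> to terms that sum to a power sum and to \<open>1\<close>\<close>
      have "s powr \<alpha> \<le> (2 * max (p j) (q j)) powr \<alpha>"
        using s \<alpha> by (intro powr_mono2) (auto simp: s_def)
      also have "\<dots> = 2 powr \<alpha> * max (p j) (q j) powr \<alpha>"
        using qj by (subst powr_mult) auto
      also have "\<dots> \<le> 2 powr \<alpha> * (p j powr \<alpha> + q j powr \<alpha>)"
        by (intro mult_left_mono) (auto simp: max_def)
      finally have s_le: "s powr \<alpha> \<le> 2 powr \<alpha> * (p j powr \<alpha> + q j powr \<alpha>)" .
      have "\<bar>p' j powr \<alpha> * q j powr (1 - \<alpha>) - p j powr \<alpha> * q j powr (1 - \<alpha>)\<bar> =
          \<bar>p' j powr \<alpha> - p j powr \<alpha>\<bar> * q j powr (1 - \<alpha>)"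
        by (simp add: abs_mult flip: left_diff_distrib)
      also have "\<dots> \<le> (2 powr \<alpha> * (p j powr \<alpha> + q j powr \<alpha>) * \<omega>) * q j powr (1 - \<alpha>)"
        using diff s_le \<open>\<omega> > 0\<close>
        by (intro mult_right_mono order.trans[OF diff]) auto
      also have "\<dots> = \<omega> * 2 powr \<alpha> * (p j powr \<alpha> * q j powr (1 - \<alpha>) + q j powr \<alpha> * q j powr (1 - \<alpha>))"
        by (simp add: algebra_simps)
      also have "q j powr \<alpha> * q j powr (1 - \<alpha>) = q j"
        using qj by (simp flip: powr_add)
      finally show ?thesis .
    qed
    have H: "power_sum \<alpha> k p q \<le> 1 + c * C"
    proof -
      have "power_sum \<alpha> k p q \<le> 1 + \<bar>\<alpha> * (\<alpha> - 1) * power_divergence \<alpha> k p q\<bar>"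
        using power_sum_eq_divergence[of \<alpha> k p q] False \<alpha> by simp
      also have "\<dots> \<le> 1 + c * C"
        using mult_left_mono[OF D, of c] c by (simp add: abs_mult c_def)
      finally show ?thesis .
    qed
    have "power_divergence \<alpha> k p' q - power_divergence \<alpha> k p q =
       (power_sum \<alpha> k p' q - power_sum \<alpha> k p q) / (\<alpha> * (\<alpha> - 1))"
      using False by (simp add: power_divergence_def power_sum_def diff_divide_distrib)
    then have "\<bar>power_divergence \<alpha> k p' q - power_divergence \<alpha> k p q\<bar> =
       \<bar>power_sum \<alpha> k p' q - power_sum \<alpha> k p q\<bar> / c"
      by (simp add: c_def)
    also have "\<bar>power_sum \<alpha> k p' q - power_sum \<alpha> k p q\<bar> \<le>
        (\<Sum>j=1..k. \<omega> * 2 powr \<alpha> * (p j powr \<alpha> * q j powr (1 - \<alpha>) + q j))"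
      unfolding power_sum_def sum_subtractf[symmetric]
      by (rule order.trans[OF sum_abs]) (intro sum_mono term_le)
    also have "\<dots> = \<omega> * 2 powr \<alpha> * (power_sum \<alpha> k p q + 1)"
      using q by (simp add: power_sum_def prob_vector_def sum.distrib flip: sum_distrib_left)
    also have "\<dots> \<le> \<omega> * (2 powr \<alpha> * (2 + c * C))"
      unfolding mult.assoc using H \<open>\<omega> > 0\<close> by (intro mult_left_mono) auto
    also have "\<dots> = \<eta> * c"
      using B by (simp add: \<omega>_def flip: B_def)
    finally show "\<bar>power_divergence \<alpha> k p' q - power_divergence \<alpha> k p q\<bar> \<le> \<eta>"
      using c by (simp add: divide_right_mono)
  qed
next
  case True
  obtain \<epsilon>' where \<epsilon>': "\<epsilon>' > 0" "\<And>a b::real. a \<in> {0..2} \<Longrightarrow> b \<in> {0..2} \<Longrightarrow> \<bar>a - b\<bar> \<le> \<epsilon>' \<Longrightarrow> \<bar>a * ln a - b * ln b\<bar> \<le> \<eta> / 4"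
    using x_ln_x_modulus[of "\<eta> / 4"] \<eta> by (metis divide_pos_pos zero_less_numeral)
  define \<epsilon> where "\<epsilon> = min \<epsilon>' (min 1 (\<eta> / (2 * (C + 2))))"
  have \<epsilon>: "0 < \<epsilon>" "\<epsilon> \<le> 1" "\<epsilon> \<le> \<epsilon>'" "\<epsilon> \<le> \<eta> / (2 * (C + 2))"
    using \<epsilon>'(1) \<eta> C by (auto simp: \<epsilon>_def)
  show ?thesis
  proof (rule that[OF \<epsilon>(1,2)])
    fix k :: nat and p p' q :: "nat \<Rightarrow> real"
    assume p: "prob_vector k p" and q: "prob_vector k q" and pos: "\<And>j. j \<in> {1..k} \<Longrightarrow> 0 < q j \<and> 0 \<le> p' j"
      and D: "\<bar>power_divergence \<alpha> k p q\<bar> \<le> C"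
      and close: "\<And>j. j \<in> {1..k} \<Longrightarrow> \<bar>p' j - p j\<bar> \<le> \<epsilon> * (p j + q j)"
    have term_le: "\<bar>p' j * ln (p' j / q j) - p j * ln (p j / q j)\<bar> \<le>
        \<eta> / 4 * (p j + q j) + \<epsilon> * ((p j + q j) * ln ((p j + q j) / q j))" if j: "j \<in> {1..k}" for j
    proof -
      define s where "s = p j + q j"
      have pj: "p j \<ge> 0" using p j by (auto simp: prob_vector_def)
      have qj: "q j > 0" and p'j: "p' j \<ge> 0" using pos[OF j] by auto
      have s: "s > 0" "s \<ge> q j" using pj qj by (simp_all add: s_def)
      have d: "\<bar>p' j - p j\<bar> \<le> \<epsilon> * s" using close[OF j] by (simp add: s_def)
      have "\<epsilon> * s \<le> s" using s \<epsilon> by (simp add: mult_le_cancel_right1)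
      then have a': "p' j / s \<in> {0..2}" using d s pj qj p'j by (auto simp: field_simps s_def)
      have a: "p j / s \<in> {0..2}" using s pj qj by (auto simp: field_simps s_def)
      have "\<bar>p' j / s - p j / s\<bar> = \<bar>p' j - p j\<bar> / s" using s by (simp add: diff_divide_distrib[symmetric])
      also have "\<dots> \<le> \<epsilon>" using d s by (simp add: field_simps)
      finally have "\<bar>p' j / s * ln (p' j / s) - p j / s * ln (p j / s)\<bar> \<le> \<eta> / 4"
        using \<epsilon>(3) by (intro \<epsilon>'(2) a a') simp
      then have 1: "s * \<bar>p' j / s * ln (p' j / s) - p j / s * ln (p j / s)\<bar> \<le> s * (\<eta> / 4)"
        using s by (intro mult_left_mono) auto
      have L: "ln (s / q j) \<ge> 0" using s qj by simp
      then have 2: "\<bar>p' j - p j\<bar> * ln (s / q j) \<le> \<epsilon> * s * ln (s / q j)"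
        using d by (intro mult_right_mono)
      have split: "r * ln (r / q j) = s * (r / s * ln (r / s)) + r * ln (s / q j)" if "r \<ge> 0" for r
        using that s qj by (cases "r = 0") (simp_all add: ln_div algebra_simps)
      have "p' j * ln (p' j / q j) - p j * ln (p j / q j) =
         s * (p' j / s * ln (p' j / s) - p j / s * ln (p j / s)) + (p' j - p j) * ln (s / q j)"
        unfolding split[OF pj] split[OF p'j] by (simp add: algebra_simps)
      also have "\<bar>\<dots>\<bar> \<le> s * \<bar>p' j / s * ln (p' j / s) - p j / s * ln (p j / s)\<bar> + \<bar>p' j - p j\<bar> * ln (s / q j)"
        using s L by (intro order.trans[OF abs_triangle_ineq]) (simp add: abs_mult)
      finally show ?thesis using 1 2 by (simp add: s_def mult_ac)
    qed
    \<comment> \<open>bounds the divergence of \<open>p + q\<close> by that of \<open>p\<close>, up to the two total masses\<close>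
    have entropy: "(p j + q j) * ln ((p j + q j) / q j) \<le> p j * ln (p j / q j) + p j + q j" if j: "j \<in> {1..k}" for j
    proof -
      have pj: "p j \<ge> 0" using p j by (auto simp: prob_vector_def)
      have qj: "q j > 0" using pos[OF j] by auto
      have "ln ((p j + q j) / q j) \<le> p j / q j"
        using ln_le_minus_one[of "(p j + q j) / q j"] pj qj by (simp add: add_divide_distrib add_nonneg_pos)
      then have 1: "q j * ln ((p j + q j) / q j) \<le> p j"
        using qj by (simp add: field_simps)
      have 2: "p j * ln ((p j + q j) / q j) \<le> p j * ln (p j / q j) + q j"
      proof (cases "p j = 0")
        case False
        then have pj: "p j > 0" using pj by simp
        have "ln ((p j + q j) / p j) \<le> q j / p j"
          using ln_le_minus_one[of "(p j + q j) / p j"] pj qj by (simp add: add_divide_distrib add_pos_nonneg)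
        then have "p j * ln ((p j + q j) / p j) \<le> q j"
          using pj by (simp add: field_simps)
        then show ?thesis using pj qj by (simp add: ln_div algebra_simps)
      qed (use qj in simp)
      from 1 2 show ?thesis by (simp add: algebra_simps)
    qed
    have "power_divergence \<alpha> k p' q - power_divergence \<alpha> k p q =
        (\<Sum>j=1..k. p' j * ln (p' j / q j) - p j * ln (p j / q j))"
      by (simp add: power_divergence_def True sum_subtractf)
    also have "\<bar>\<dots>\<bar> \<le> (\<Sum>j=1..k. \<eta> / 4 * (p j + q j) + \<epsilon> * ((p j + q j) * ln ((p j + q j) / q j)))"
      by (rule order.trans[OF sum_abs]) (intro sum_mono term_le)
    also have "\<dots> \<le> (\<Sum>j=1..k. \<eta> / 4 * (p j + q j) + \<epsilon> * (p j * ln (p j / q j) + p j + q j))"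
      using \<epsilon> by (intro sum_mono add_mono mult_left_mono entropy order.refl) auto
    also have "\<dots> = \<eta> / 4 * ((\<Sum>j=1..k. p j) + (\<Sum>j=1..k. q j)) +
        \<epsilon> * ((\<Sum>j=1..k. p j * ln (p j / q j)) + (\<Sum>j=1..k. p j) + (\<Sum>j=1..k. q j))"
      by (simp only: sum.distrib sum_distrib_left[symmetric])
    also have "\<dots> = \<eta> / 4 * 2 + \<epsilon> * (power_divergence \<alpha> k p q + 2)"
      using p q True by (simp add: prob_vector_def power_divergence_def)
    also have "\<dots> \<le> \<eta> / 4 * 2 + \<epsilon> * (C + 2)"
      using \<epsilon> D \<eta> by (intro add_mono mult_left_mono) auto
    also have "\<dots> \<le> \<eta> / 4 * 2 + \<eta> / (2 * (C + 2)) * (C + 2)"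
      using \<epsilon> C by (intro add_mono mult_right_mono) auto
    also have "\<dots> = \<eta>" using C by (simp add: field_simps)
    finally show "\<bar>power_divergence \<alpha> k p' q - power_divergence \<alpha> k p q\<bar> \<le> \<eta>" .
  qed
qed

text \<open>The cut is made at \<open>M = k powr \<eta>\<close>, where \<open>\<kappa> < \<eta> \<alpha> < 1\<close>. The upper bound \<open>\<eta> \<alpha> < 1\<close> makes the
contribution of the small densities negligible against \<open>k\<close>; the lower bound \<open>\<kappa> < \<eta> \<alpha>\<close> makes the
large densities insufficient to reach the level \<open>x\<close> if the information divergence is smaller than
claimed.\<close>

lemma uniform_divergence_lower_asymptotic:
  fixes \<alpha> x \<kappa> :: real
  assumes \<alpha>: "1 < \<alpha>" and x: "0 < x" and \<kappa>: "0 < \<kappa>" "\<kappa> < 1"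
  shows "\<forall>\<^sub>F k in sequentially. \<forall>p. prob_vector k p \<longrightarrow> x < power_divergence \<alpha> k p (\<lambda>_. 1 / real k) \<longrightarrow>
     \<kappa> * ((\<alpha> * (\<alpha> - 1) * x) powr (1 / \<alpha>) / \<alpha>) * (real k powr (1 / \<alpha> - 1) * ln (real k)) \<le>
       power_divergence 1 k p (\<lambda>_. 1 / real k)"
proof -
  define y where "y = \<alpha> * (\<alpha> - 1) * x"
  define g where "g = y powr (1 / \<alpha>) / \<alpha>"
  define \<eta> where "\<eta> = (1 + \<kappa>) / (2 * \<alpha>)"
  have y: "y > 0" using \<alpha> x by (simp add: y_def)
  have g: "g > 0" using y \<alpha> by (simp add: g_def)
  have \<eta>: "\<eta> > 0" "\<kappa> < \<eta> * \<alpha>" "\<eta> * \<alpha> < 1" using \<alpha> \<kappa> by (auto simp: \<eta>_def field_simps)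
  define e where "e = \<eta> * (\<alpha> - 1) + 1 / \<alpha> - 1"
  have "e = (\<eta> * \<alpha> - 1) * ((\<alpha> - 1) / \<alpha>)" using \<alpha> by (simp add: e_def field_simps)
  moreover have "(\<eta> * \<alpha> - 1) * ((\<alpha> - 1) / \<alpha>) < 0" using \<eta> \<alpha> by (intro mult_neg_pos) auto
  ultimately have e: "e < 0" by simp
  define R where "R = (\<lambda>k::nat. \<alpha> * (\<alpha> - 1) * \<kappa> * g * (real k powr e * ln (real k)) + (\<kappa> * g * (ln (real k) / (\<eta> * ln (real k) - 1))) powr \<alpha>)"
  have "(\<lambda>k::nat. real k powr e * ln (real k)) \<longlonglongrightarrow> 0"
    using e by real_asymp
  moreover have "(\<lambda>k::nat. ln (real k) / (\<eta> * ln (real k) - 1)) \<longlonglongrightarrow> 1 / \<eta>"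
    using \<eta>(1) by (real_asymp simp: field_simps)
  ultimately have "R \<longlonglongrightarrow> \<alpha> * (\<alpha> - 1) * \<kappa> * g * 0 + (\<kappa> * g * (1 / \<eta>)) powr \<alpha>"
    unfolding R_def using \<kappa> g \<eta> \<alpha>
    by (intro tendsto_add tendsto_mult_left tendsto_powr tendsto_const) auto
  moreover have "\<alpha> * (\<alpha> - 1) * \<kappa> * g * 0 + (\<kappa> * g * (1 / \<eta>)) powr \<alpha> < y"
  proof -
    have "\<kappa> * g * (1 / \<eta>) = (\<kappa> / (\<eta> * \<alpha>)) * y powr (1 / \<alpha>)" by (simp add: g_def)
    then have "(\<kappa> * g * (1 / \<eta>)) powr \<alpha> = (\<kappa> / (\<eta> * \<alpha>)) powr \<alpha> * (y powr (1 / \<alpha>)) powr \<alpha>"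
      by (simp only: powr_mult)
    also have "(y powr (1 / \<alpha>)) powr \<alpha> = y"
      using \<alpha> y by (simp add: powr_powr)
    also have "(\<kappa> / (\<eta> * \<alpha>)) powr \<alpha> * y < 1 * y"
      using powr_less_mono2[of \<alpha> "\<kappa> / (\<eta> * \<alpha>)" 1] \<kappa> \<eta> \<alpha> y by (intro mult_strict_right_mono) auto
    finally show ?thesis by simp
  qed
  ultimately have R: "\<forall>\<^sub>F k in sequentially. R k < y"
    by (rule order_tendstoD(2))
  have "\<forall>\<^sub>F k::nat in sequentially. 1 < \<eta> * ln (real k)"
    using \<eta>(1) by real_asymp
  with R eventually_ge_at_top[of 1] show ?thesis
  proof eventually_elim
    case (elim k)
    show ?case
    proof (intro allI impI)
      fix p assume p: "prob_vector k p" and D: "x < power_divergence \<alpha> k p (\<lambda>_. 1 / real k)"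
      define I where "I = real k * power_divergence 1 k p (\<lambda>_. 1 / real k)"
      define J where "J = \<kappa> * g * (real k powr (1 / \<alpha>) * ln (real k))"
      define M where "M = real k powr \<eta>"
      have M: "0 < M" "1 < ln M" "ln M = \<eta> * ln (real k)" using elim by (auto simp: M_def ln_powr)
      have "y < \<alpha> * (\<alpha> - 1) * power_divergence \<alpha> k p (\<lambda>_. 1 / real k)"
        unfolding y_def using D \<alpha> by (intro mult_strict_left_mono) auto
      then have "1 + y \<le> power_sum \<alpha> k p (\<lambda>_. 1 / real k)"
        using power_sum_eq_divergence[of \<alpha> k p "\<lambda>_. 1 / real k"] \<alpha> by simp
      note trade = uniform_divergence_tradeoff[OF p _ \<alpha> M(1,2) this, folded I_def]
      have "J \<le> I"
      proof (rule ccontr)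
        assume "\<not> J \<le> I"
        then have J: "I \<le> J" by simp
        have "real k * y \<le> \<alpha> * (\<alpha> - 1) * M powr (\<alpha> - 1) * I + (I / (ln M - 1)) powr \<alpha>"
          using trade(1) elim by simp
        also have "\<dots> \<le> \<alpha> * (\<alpha> - 1) * M powr (\<alpha> - 1) * J + (J / (ln M - 1)) powr \<alpha>"
          using J trade(2) elim \<alpha> M by (intro add_mono mult_left_mono powr_mono2 divide_right_mono) auto
        also have "\<alpha> * (\<alpha> - 1) * M powr (\<alpha> - 1) * J = real k * (\<alpha> * (\<alpha> - 1) * \<kappa> * g * (real k powr e * ln (real k)))"
        proof -
          have "M powr (\<alpha> - 1) * real k powr (1 / \<alpha>) = real k * real k powr e"
          proof -
            have "M powr (\<alpha> - 1) * real k powr (1 / \<alpha>) = real k powr (1 + e)"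
              by (simp add: M_def powr_powr e_def flip: powr_add)
            then show ?thesis using elim by (simp add: powr_add)
          qed
          then show ?thesis by (simp add: J_def mult_ac)
        qed
        also have "(J / (ln M - 1)) powr \<alpha> = real k * (\<kappa> * g * (ln (real k) / (\<eta> * ln (real k) - 1))) powr \<alpha>"
        proof -
          have "J / (ln M - 1) = real k powr (1 / \<alpha>) * (\<kappa> * g * (ln (real k) / (\<eta> * ln (real k) - 1)))"
            by (simp add: J_def M(3))
          then show ?thesis
            using elim \<alpha> by (simp only: powr_mult powr_powr) simp
        qed
        finally have "real k * y \<le> real k * R k"
          by (simp add: R_def distrib_left)
        then show False using elim by simp
      qed
      moreover have "J = real k * (\<kappa> * g * (real k powr (1 / \<alpha> - 1) * ln (real k)))"
        using elim by (simp add: J_def powr_diff)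
      ultimately have "real k * (\<kappa> * g * (real k powr (1 / \<alpha> - 1) * ln (real k))) \<le> real k * power_divergence 1 k p (\<lambda>_. 1 / real k)"
        by (simp only: I_def)
      then have "\<kappa> * g * (real k powr (1 / \<alpha> - 1) * ln (real k)) \<le> power_divergence 1 k p (\<lambda>_. 1 / real k)"
        by (rule mult_left_le_imp_le) (use elim in simp)
      then show "\<kappa> * ((\<alpha> * (\<alpha> - 1) * x) powr (1 / \<alpha>) / \<alpha>) * (real k powr (1 / \<alpha> - 1) * ln (real k)) \<le>
         power_divergence 1 k p (\<lambda>_. 1 / real k)"
        by (simp only: g_def y_def)
    qed
  qed
qed

section \<open>Consistency\<close>

lemma prob_vector_dim_pos: "prob_vector k p \<Longrightarrow> k \<ge> 1"
  by (cases k) (auto simp: prob_vector_def)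

text \<open>The frequency of cell \<open>j\<close> fails to be within \<open>\<epsilon> (p j + q j)\<close> of its mean with probability at most
\<open>2 exp (- c n / k)\<close>. As \<open>k ln n / n\<close> tends to \<open>0\<close>, this beats the number of cells. Taking \<open>P = Q\<close>
covers the hypothesis.\<close>

lemma multinomial_divergence_tendsto:
  assumes \<alpha>: "0 < \<alpha>"
    and PQ: "\<And>n. n \<ge> 1 \<Longrightarrow> prob_vector (k n) (P n) \<and> prob_vector (k n) (Q n)"
    and kn: "\<And>n. n \<ge> 1 \<Longrightarrow> k n \<le> n"
    and \<rho>: "\<rho> > 0" "\<And>n j. n \<ge> 1 \<Longrightarrow> j \<in> {1..k n} \<Longrightarrow> Q n j > \<rho> / real (k n)"
    and sparse: "(\<lambda>n. real (k n) * ln (real n) / real n) \<longlonglongrightarrow> 0"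
    and D: "(\<lambda>n. power_divergence \<alpha> (k n) (P n) (Q n)) \<longlonglongrightarrow> \<Delta>"
  shows "tendsto_in_prob (\<lambda>n. multinomial_pmf (k n) n (P n)) (divergence_statistic \<alpha> k Q) \<Delta>"
  unfolding tendsto_in_prob_def
proof (intro allI impI)
  fix \<eta> :: real assume \<eta>: "\<eta> > 0"
  define C where "C = \<bar>\<Delta>\<bar> + 1"
  have "\<eta> / 2 > 0" "C \<ge> 0" using \<eta> by (auto simp: C_def)
  then obtain \<epsilon> where \<epsilon>: "0 < \<epsilon>" "\<epsilon> \<le> 1"
    "\<And>k p p' q. prob_vector k p \<Longrightarrow> prob_vector k q \<Longrightarrow> (\<And>j. j \<in> {1..k} \<Longrightarrow> 0 < q j \<and> 0 \<le> p' j) \<Longrightarrow>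
       \<bar>power_divergence \<alpha> k p q\<bar> \<le> C \<Longrightarrow> (\<And>j. j \<in> {1..k} \<Longrightarrow> \<bar>p' j - p j\<bar> \<le> \<epsilon> * (p j + q j)) \<Longrightarrow>
       \<bar>power_divergence \<alpha> k p' q - power_divergence \<alpha> k p q\<bar> \<le> \<eta> / 2"
    using power_divergence_modulus[OF \<alpha>] by metis
  define c where "c = \<epsilon>\<^sup>2 * \<rho> / 2"
  have c: "c > 0" using \<epsilon> \<rho> by (simp add: c_def)
  have "\<forall>\<^sub>F n in sequentially. \<bar>power_divergence \<alpha> (k n) (P n) (Q n) - \<Delta>\<bar> < min 1 (\<eta> / 2)"
    using D \<eta> unfolding tendsto_iff dist_real_def by (metis min_less_iff_conj zero_less_one half_gt_zero)
  moreover have "\<forall>\<^sub>F n in sequentially. real (k n) * ln (real n) / real n < c / 2"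
    using c by (intro order_tendstoD(2)[OF sparse]) simp
  ultimately have ev: "\<forall>\<^sub>F n in sequentially. measure_pmf.prob (multinomial_pmf (k n) n (P n))
      {X. \<bar>divergence_statistic \<alpha> k Q n X - \<Delta>\<bar> > \<eta>} \<le> 2 / real n"
    using eventually_ge_at_top[of 1]
  proof eventually_elim
    case (elim n)
    let ?M = "multinomial_pmf (k n) n (P n)"
    let ?B = "{X. \<exists>j\<in>{1..k n}. \<bar>real (X j) / real n - P n j\<bar> > \<epsilon> * (P n j + Q n j)}"
    have P: "prob_vector (k n) (P n)" and Q: "prob_vector (k n) (Q n)" using PQ elim by auto
    have k: "k n \<ge> 1" using P by (rule prob_vector_dim_pos)
    have "\<rho> / real (k n) \<ge> 0" using \<rho>(1) by simp
    then have q: "Q n j > 0" "Q n j \<ge> \<rho> / real (k n)" if "j \<in> {1..k n}" for j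
      using \<rho>(2)[of n j] elim that by auto
    have "measure_pmf.prob ?M {X. \<bar>divergence_statistic \<alpha> k Q n X - \<Delta>\<bar> > \<eta>} \<le>
        measure_pmf.prob ?M ?B"
    proof (intro multinomial_prob_mono, rule ccontr)
      fix X :: "nat \<Rightarrow> nat" assume X: "X \<in> {X. \<bar>divergence_statistic \<alpha> k Q n X - \<Delta>\<bar> > \<eta>}"
        and "X \<notin> ?B"
      then have "\<And>j. j \<in> {1..k n} \<Longrightarrow> \<bar>real (X j) / real n - P n j\<bar> \<le> \<epsilon> * (P n j + Q n j)"
        by force
      then have "\<bar>divergence_statistic \<alpha> k Q n X - power_divergence \<alpha> (k n) (P n) (Q n)\<bar> \<le> \<eta> / 2"
        unfolding divergence_statistic_def using elim q
        by (intro \<epsilon>(3)[OF P Q]) (auto simp: C_def)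
      moreover have "\<bar>power_divergence \<alpha> (k n) (P n) (Q n) - \<Delta>\<bar> < \<eta> / 2"
        using elim by simp
      moreover have "\<eta> < \<bar>divergence_statistic \<alpha> k Q n X - \<Delta>\<bar>"
        using X by simp
      ultimately show False by linarith
    qed
    also have "\<dots> \<le> 2 * real (k n) * exp (- (c * (real n / real (k n))))"
      unfolding c_def using elim q by (intro multinomial_prob_cell_deviates[OF P _ k _ \<rho>(1) \<epsilon>(1,2)]) auto
    also have "\<dots> \<le> 2 * real n * exp (- (2 * ln (real n)))"
    proof (intro mult_mono)
      show "exp (- (c * (real n / real (k n)))) \<le> exp (- (2 * ln (real n)))"
        using elim k by (simp add: field_simps)
    qed (use kn[of n] elim in auto)
    also have "2 * ln (real n) = ln (real n ^ 2)" using elim by (simp add: ln_realpow)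
    also have "2 * real n * exp (- ln (real n ^ 2)) = 2 / real n"
      using elim by (simp add: exp_minus power2_eq_square field_simps)
    finally show ?case .
  qed
  show "(\<lambda>n. measure_pmf.prob (multinomial_pmf (k n) n (P n))
      {X. \<bar>divergence_statistic \<alpha> k Q n X - \<Delta>\<bar> > \<eta>}) \<longlonglongrightarrow> 0"
  proof (rule tendsto_sandwich[where f = "\<lambda>_. 0" and h = "\<lambda>n. 2 / real n", OF _ ev])
    show "(\<lambda>n. 2 / real n) \<longlonglongrightarrow> 0" by real_asymp
  qed auto
qed

lemma consistent_divergence_statistic:
  assumes \<alpha>: "0 < \<alpha>"
    and PQ: "\<And>n. n \<ge> 1 \<Longrightarrow> prob_vector (k n) (P n) \<and> prob_vector (k n) (Q n)"
    and A: "assumption_A1 k" "assumption_A2 k Q" "assumption_A3 \<alpha> \<Delta> k P Q"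
    and sparse: "(\<lambda>n. real (k n) * ln (real n) / real n) \<longlonglongrightarrow> 0"
  shows "consistent \<alpha> \<Delta> k P Q"
proof -
  obtain \<rho> where \<rho>: "\<rho> > 0" "\<And>n j. n \<ge> 1 \<Longrightarrow> j \<in> {1..k n} \<Longrightarrow> Q n j > \<rho> / real (k n)"
    using A(2) unfolding assumption_A2_def by blast
  have kn: "\<And>n. n \<ge> 1 \<Longrightarrow> k n \<le> n" using A(1) by (simp add: assumption_A1_def)
  have "(\<lambda>n. power_divergence \<alpha> (k n) (Q n) (Q n)) \<longlonglongrightarrow> 0"
  proof (rule tendsto_eventually, rule eventually_mono[OF eventually_ge_at_top[of 1]])
    fix n :: nat assume n: "n \<ge> 1"
    have pos: "Q n j > 0" if "j \<in> {1..k n}" for j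
      using A(2) n that by (auto simp: assumption_A2_def)
    have "Q n j powr \<alpha> * Q n j powr (1 - \<alpha>) = Q n j" if "j \<in> {1..k n}" for j
      using pos[OF that] by (simp flip: powr_add)
    then have "(\<Sum>j=1..k n. Q n j powr \<alpha> * Q n j powr (1 - \<alpha>)) = (\<Sum>j=1..k n. Q n j)"
      by (intro sum.cong) auto
    moreover have "(\<Sum>j=1..k n. Q n j * ln (Q n j / Q n j)) = 0"
      by (intro sum.neutral) auto
    ultimately show "power_divergence \<alpha> (k n) (Q n) (Q n) = 0"
      using PQ[OF n] by (simp add: power_divergence_def prob_vector_def)
  qed
  moreover have "(\<lambda>n. power_divergence \<alpha> (k n) (P n) (Q n)) \<longlonglongrightarrow> \<Delta>"
    using A(3) by (simp add: assumption_A3_def)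
  ultimately show ?thesis
    unfolding consistent_def using PQ kn \<rho> sparse \<alpha>
    by (intro conjI multinomial_divergence_tendsto[where \<rho> = \<rho>]) auto
qed

section \<open>Bahadur functions\<close>

text \<open>The exponents \<open>r\<close> and \<open>s\<close> may depend on \<open>n\<close> and on the precision \<open>u\<close>; the factor
\<open>(n + 1) ^ k\<close> is the number of types.\<close>

lemma neg_log_prob_tendstoI:
  fixes pr c :: "nat \<Rightarrow> real" and g :: real
  assumes upper: "\<And>u. u < g \<Longrightarrow> \<forall>\<^sub>F n in sequentially. \<exists>r. pr n \<le> (real n + 1) ^ k n * exp (- (real n * r)) \<and> u < c n * r"
    and lower: "\<And>u. g < u \<Longrightarrow> \<forall>\<^sub>F n in sequentially. \<exists>s. exp (- (real n * s)) \<le> pr n \<and> c n * s < u"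
    and c: "\<forall>\<^sub>F n in sequentially. 0 \<le> c n"
    and types: "(\<lambda>n. c n * (real (k n) * ln (real n + 1) / real n)) \<longlonglongrightarrow> 0"
  shows "(\<lambda>n. - (c n / real n) * ln (pr n)) \<longlonglongrightarrow> g"
proof (rule order_tendstoI)
  fix a assume a: "a < g"
  define u where "u = (a + g) / 2"
  have u: "a < u" "u < g" using a by (auto simp: u_def)
  have "\<forall>\<^sub>F n in sequentially. c n * (real (k n) * ln (real n + 1) / real n) < u - a"
    using u by (intro order_tendstoD(2)[OF types]) simp
  moreover have "\<forall>\<^sub>F n in sequentially. \<exists>s. exp (- (real n * s)) \<le> pr n \<and> c n * s < g + 1"
    by (rule lower) simp
  ultimately show "\<forall>\<^sub>F n in sequentially. a < - (c n / real n) * ln (pr n)"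
    using upper[OF u(2)] c eventually_ge_at_top[of 1]
  proof eventually_elim
    case (elim n)
    have n: "real n \<ge> 1" using elim by simp
    have pr: "pr n > 0" using elim(2) exp_gt_zero less_le_trans by blast
    obtain r where r: "pr n \<le> (real n + 1) ^ k n * exp (- (real n * r))" "u < c n * r"
      using elim by blast
    have "ln (pr n) \<le> ln ((real n + 1) ^ k n * exp (- (real n * r)))"
      using r(1) pr by (intro ln_mono) auto
    also have "\<dots> = real (k n) * ln (real n + 1) - real n * r"
      by (simp add: ln_mult ln_realpow)
    finally have "c n / real n * ln (pr n) \<le> c n / real n * (real (k n) * ln (real n + 1) - real n * r)"
      using elim n by (intro mult_left_mono) auto
    also have "\<dots> = c n * (real (k n) * ln (real n + 1) / real n) - c n * r"
      using n by (simp add: field_simps)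
    finally show ?case using r(2) elim by simp
  qed
next
  fix a assume a: "g < a"
  show "\<forall>\<^sub>F n in sequentially. - (c n / real n) * ln (pr n) < a"
    using lower[OF a] c eventually_ge_at_top[of 1]
  proof eventually_elim
    case (elim n)
    have n: "real n \<ge> 1" using elim by simp
    obtain s where s: "exp (- (real n * s)) \<le> pr n" "c n * s < a"
      using elim by blast
    have "- (real n * s) \<le> ln (pr n)"
      using s(1) by (metis exp_gt_zero ln_exp ln_mono)
    then have "c n / real n * (- (real n * s)) \<le> c n / real n * ln (pr n)"
      using elim n by (intro mult_left_mono) auto
    moreover have "c n / real n * (- (real n * s)) = - (c n * s)" using n by simp
    ultimately show ?case using s(2) by simp
  qed
qed

lemma ln_Suc_le: "n \<ge> 2 \<Longrightarrow> ln (real n + 1) \<le> 2 * ln (real n)"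
proof -
  assume n: "n \<ge> 2"
  have "2 * real n \<le> real n * real n" using n by (intro mult_right_mono) auto
  moreover have "2 \<le> real n" using n by simp
  ultimately have "real n + 1 \<le> real n ^ 2" unfolding power2_eq_square by linarith
  then have "ln (real n + 1) \<le> ln (real n ^ 2)" by (intro ln_mono) auto
  then show ?thesis using n by (simp add: ln_realpow)
qed

lemma type_count_negligible:
  fixes d :: "nat \<Rightarrow> real"
  assumes "(\<lambda>n. d n * ln (real n) / real n) \<longlonglongrightarrow> 0" "\<forall>\<^sub>F n in sequentially. 0 \<le> e n \<and> e n \<le> d n"
  shows "(\<lambda>n. e n * ln (real n + 1) / real n) \<longlonglongrightarrow> 0"
proof (rule tendsto_sandwich[where f = "\<lambda>_. 0" and h = "\<lambda>n. 2 * (d n * ln (real n) / real n)"])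
  show "\<forall>\<^sub>F n in sequentially. 0 \<le> e n * ln (real n + 1) / real n"
    using assms(2) by eventually_elim auto
  show "\<forall>\<^sub>F n in sequentially. e n * ln (real n + 1) / real n \<le> 2 * (d n * ln (real n) / real n)"
    using assms(2) eventually_ge_at_top[of 2]
  proof eventually_elim
    case (elim n)
    have "e n * ln (real n + 1) \<le> d n * (2 * ln (real n))"
      using elim ln_Suc_le[of n] by (intro mult_mono) auto
    then have "e n * ln (real n + 1) / real n \<le> d n * (2 * ln (real n)) / real n"
      by (rule divide_right_mono) simp
    then show ?case by (simp add: mult_ac)
  qed
  show "(\<lambda>n. 2 * (d n * ln (real n) / real n)) \<longlonglongrightarrow> 0"
    using tendsto_mult_left[OF assms(1), of 2] by simp
qed auto

text \<open>The Renyi divergence of order \<open>\<alpha>\<close> of a pair whose power divergence of order \<open>\<alpha>\<close> is \<open>x\<close>.\<close>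

definition renyi_rate :: "real \<Rightarrow> real \<Rightarrow> real" where
  "renyi_rate \<alpha> x = (if \<alpha> = 1 then x else ln (1 + \<alpha> * (\<alpha> - 1) * x) / (\<alpha> - 1))"

lemma renyi_rate_pos:
  assumes "0 < \<alpha>" "\<alpha> \<le> 1" "x \<in> divergence_levels \<alpha>"
  shows "renyi_rate \<alpha> x > 0"
proof (cases "\<alpha> = 1")
  case False
  then have "\<alpha> * (\<alpha> - 1) * x < 0"
    using assms by (auto simp: divergence_levels_def mult_less_0_iff)
  then have "ln (1 + \<alpha> * (\<alpha> - 1) * x) < 0"
    using assms(3) by (auto simp: divergence_levels_def intro!: ln_less_zero)
  then show ?thesis using False assms by (simp add: renyi_rate_def divide_neg_neg)
qed (use assms in \<open>auto simp: renyi_rate_def divergence_levels_def\<close>)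

lemma continuous_on_renyi_rate: "continuous_on (divergence_levels \<alpha>) (renyi_rate \<alpha>)"
  unfolding renyi_rate_def
  by (cases "\<alpha> = 1") (auto intro!: continuous_intros simp: divergence_levels_def)

lemma divergence_ge_renyi_rate:
  assumes \<alpha>: "0 < \<alpha>" "\<alpha> \<le> 1" and x: "x \<in> divergence_levels \<alpha>"
    and p: "prob_vector k p" and q: "\<And>j. j \<in> {1..k} \<Longrightarrow> q j > 0"
    and D: "x < power_divergence \<alpha> k p q"
  shows "renyi_rate \<alpha> x \<le> power_divergence 1 k p q"
proof (cases "\<alpha> = 1")
  case False
  then have neg: "\<alpha> - 1 < 0" "\<alpha> * (\<alpha> - 1) < 0" using \<alpha> by (auto simp: mult_less_0_iff)
  have "exp ((\<alpha> - 1) * power_divergence 1 k p q) \<le> 1 + \<alpha> * (\<alpha> - 1) * power_divergence \<alpha> k p q"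
    using exp_divergence_le_power_sum[where \<alpha> = \<alpha> and q = q, OF p q] power_sum_eq_divergence[of \<alpha> k p q] \<alpha> False by simp
  also have "\<dots> \<le> 1 + \<alpha> * (\<alpha> - 1) * x"
    using neg D by (simp add: mult_le_cancel_left)
  finally have "ln (exp ((\<alpha> - 1) * power_divergence 1 k p q)) \<le> ln (1 + \<alpha> * (\<alpha> - 1) * x)"
    by (intro ln_mono) auto
  then show ?thesis using neg False by (simp add: renyi_rate_def field_simps)
qed (use D in \<open>simp add: renyi_rate_def\<close>)

text \<open>A distribution that lives on a set of small \<open>q\<close>-mass is far from \<open>q\<close> in every power divergence;
the threshold for the mass is exactly \<open>exp (- renyi_rate \<alpha> x)\<close>.\<close>

lemma divergence_gt_of_small_support:
  assumes \<alpha>: "0 < \<alpha>" "\<alpha> \<le> 1" and x: "x \<in> divergence_levels \<alpha>"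
    and p: "prob_vector k p" and q: "\<And>j. j \<in> {1..k} \<Longrightarrow> q j > 0"
    and A: "A \<subseteq> {1..k}" "\<And>j. j \<in> {1..k} - A \<Longrightarrow> p j = 0"
    and small: "(\<Sum>j\<in>A. q j) < exp (- renyi_rate \<alpha> x)"
  shows "x < power_divergence \<alpha> k p q"
proof -
  define w where "w = (\<Sum>j\<in>A. q j)"
  have w: "w > 0" using supported_mass_pos(2)[OF p q A] by (simp add: w_def)
  show ?thesis
  proof (cases "\<alpha> = 1")
    case True
    have "ln w < ln (exp (- renyi_rate \<alpha> x))"
      using small w by (subst ln_less_cancel_iff) (auto simp: w_def)
    then have "x < - ln w" using True by (simp add: renyi_rate_def)
    also have "\<dots> \<le> power_divergence 1 k p q"
      unfolding w_def by (rule divergence_ge_supported[OF p q A])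
    finally show ?thesis using True by simp
  next
    case False
    then have neg: "\<alpha> - 1 < 0" "\<alpha> * (\<alpha> - 1) < 0" using \<alpha> by (auto simp: mult_less_0_iff)
    have "1 + \<alpha> * (\<alpha> - 1) * power_divergence \<alpha> k p q = power_sum \<alpha> k p q"
      using power_sum_eq_divergence[of \<alpha> k p q] False \<alpha> by simp
    also have "\<dots> \<le> w powr (1 - \<alpha>)"
      unfolding w_def using \<alpha> False by (intro power_sum_le_supported[OF p q A]) auto
    also have "\<dots> < exp (- renyi_rate \<alpha> x) powr (1 - \<alpha>)"
      using small w neg by (intro powr_less_mono2) (auto simp: w_def)
    also have "\<dots> = exp (ln (1 + \<alpha> * (\<alpha> - 1) * x))"
    proof -
      have "- renyi_rate \<alpha> x * (1 - \<alpha>) = ln (1 + \<alpha> * (\<alpha> - 1) * x)"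
        using False neg by (simp add: renyi_rate_def field_simps)
      then show ?thesis by (simp add: powr_def mult_ac)
    qed
    also have "\<dots> = 1 + \<alpha> * (\<alpha> - 1) * x"
      using x by (simp add: divergence_levels_def)
    finally show ?thesis using neg by (simp add: mult_less_cancel_left)
  qed
qed

text \<open>The longest initial segment \<open>{1..i}\<close> of mass less than \<open>t\<close> has the required property.\<close>

lemma exists_subset_mass:
  assumes q: "prob_vector k q" and m: "\<And>j. j \<in> {1..k} \<Longrightarrow> q j \<le> m" and t: "0 < t" "t \<le> 1"
  obtains A where "A \<subseteq> {1..k}" "t - m \<le> (\<Sum>j\<in>A. q j)" "(\<Sum>j\<in>A. q j) < t"
proof -
  define i where "i = (LEAST i. t \<le> (\<Sum>j=1..i. q j))"
  have ex: "t \<le> (\<Sum>j=1..k. q j)" using q t by (simp add: prob_vector_def)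
  have i: "t \<le> (\<Sum>j=1..i. q j)" "i \<le> k"
    unfolding i_def using ex by (rule LeastI, rule Least_le)
  have "i \<noteq> 0" using i(1) t by (intro notI) simp
  then obtain i' where i': "i = Suc i'" using not0_implies_Suc by blast
  have "\<not> t \<le> (\<Sum>j=1..i'. q j)"
    using not_less_Least[of i' "\<lambda>i. t \<le> (\<Sum>j=1..i. q j)"] i' by (simp add: i_def)
  moreover have "t \<le> (\<Sum>j=1..i'. q j) + q i" using i(1) i' by simp
  moreover have "q i \<le> m" using m[of i] i(2) i' by simp
  ultimately show thesis
    using i(2) i' by (intro that[of "{1..i'}"]) auto
qed

text \<open>The upper bound on the probability is the count of types together with
\<open>divergence_ge_renyi_rate\<close>; the lower bound is the probability that all observations fall into a
set of cells of mass just below \<open>exp (- renyi_rate \<alpha> x)\<close>.\<close>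

lemma bahadur_function_le_1:
  assumes \<alpha>: "0 < \<alpha>" "\<alpha> \<le> 1"
    and Q: "\<And>n. n \<ge> 1 \<Longrightarrow> prob_vector (k n) (Q n)"
    and A2: "assumption_A2 k Q"
    and sparse: "(\<lambda>n. real (k n) * ln (real n) / real n) \<longlonglongrightarrow> 0"
  shows "bahadur_function \<alpha> k Q (\<lambda>_. 1) (renyi_rate \<alpha>)"
  unfolding bahadur_function_def
proof (intro conjI ballI)
  show "continuous_on (divergence_levels \<alpha>) (renyi_rate \<alpha>)" by (rule continuous_on_renyi_rate)
  fix x assume x: "x \<in> divergence_levels \<alpha>"
  define g where "g = renyi_rate \<alpha> x"
  show "renyi_rate \<alpha> x > 0" using \<alpha> x by (rule renyi_rate_pos)
  then have g: "g > 0" by (simp add: g_def)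
  define pr where "pr = (\<lambda>n. measure_pmf.prob (multinomial_pmf (k n) n (Q n)) {X. divergence_statistic \<alpha> k Q n X > x})"
  have pos: "Q n j > 0" if "n \<ge> 1" "j \<in> {1..k n}" for n j
    using A2 that by (auto simp: assumption_A2_def)
  have "(\<lambda>n. - (1 / real n) * ln (pr n)) \<longlonglongrightarrow> g"
  proof (rule neg_log_prob_tendstoI)
    fix u assume u: "u < g"
    show "\<forall>\<^sub>F n in sequentially. \<exists>r. pr n \<le> (real n + 1) ^ k n * exp (- (real n * r)) \<and> u < 1 * r"
      using eventually_ge_at_top[of 1]
    proof eventually_elim
      case (elim n)
      have "pr n \<le> measure_pmf.prob (multinomial_pmf (k n) n (Q n)) {X. g \<le> power_divergence 1 (k n) (\<lambda>j. X j / n) (Q n)}"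
        unfolding pr_def
      proof (rule multinomial_prob_mono)
        fix X assume "X \<in> set_pmf (multinomial_pmf (k n) n (Q n))" "X \<in> {X. divergence_statistic \<alpha> k Q n X > x}"
        then show "X \<in> {X. g \<le> power_divergence 1 (k n) (\<lambda>j. X j / n) (Q n)}"
          using elim unfolding g_def divergence_statistic_def
          by (auto intro!: divergence_ge_renyi_rate \<alpha> x pos prob_vector_empirical Q)
      qed
      also have "\<dots> \<le> (real n + 1) ^ k n * exp (- (real n * g))"
        by (rule multinomial_prob_divergence_ge) (use elim Q pos in auto)
      finally show ?case using u by auto
    qed
  next
    fix u assume u: "g < u"
    define m where "m = (\<lambda>n. Max (Q n ` {1..k n}))"
    have "m \<longlonglongrightarrow> 0" using A2 by (simp add: assumption_A2_def m_def)
    then have "\<forall>\<^sub>F n in sequentially. m n < exp (- g) - exp (- u)"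
      using u by (intro order_tendstoD(2)) auto
    then show "\<forall>\<^sub>F n in sequentially. \<exists>s. exp (- (real n * s)) \<le> pr n \<and> 1 * s < u"
      using eventually_ge_at_top[of 1]
    proof eventually_elim
      case (elim n)
      have Qn: "prob_vector (k n) (Q n)" using Q elim by simp
      have "Q n j \<le> m n" if "j \<in> {1..k n}" for j
        unfolding m_def using that by (intro Max_ge) auto
      then obtain A where A: "A \<subseteq> {1..k n}" "exp (- g) - m n \<le> (\<Sum>j\<in>A. Q n j)" "(\<Sum>j\<in>A. Q n j) < exp (- g)"
        using g by (rule_tac exists_subset_mass[OF Qn, of "m n" "exp (- g)"]) auto
      define w where "w = (\<Sum>j\<in>A. Q n j)"
      have w: "exp (- u) < w" using A elim by (simp add: w_def)
      then have w0: "w > 0" using exp_gt_zero[of "- u"] by linarith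
      have "exp (- (real n * (- ln w))) = w ^ n"
        using w0 by (simp add: exp_of_nat_mult)
      also have "\<dots> \<le> measure_pmf.prob (multinomial_pmf (k n) n (Q n)) {X. \<forall>j\<in>{1..k n} - A. X j = 0}"
        unfolding w_def by (rule multinomial_prob_supported[OF Qn A(1)])
      also have "\<dots> \<le> pr n"
        unfolding pr_def
      proof (rule multinomial_prob_mono)
        fix X assume "X \<in> set_pmf (multinomial_pmf (k n) n (Q n))" "X \<in> {X. \<forall>j\<in>{1..k n} - A. X j = 0}"
        then show "X \<in> {X. divergence_statistic \<alpha> k Q n X > x}"
          using elim A(1,3) unfolding g_def divergence_statistic_def
          by (auto intro!: divergence_gt_of_small_support[where A = A] \<alpha> x pos prob_vector_empirical Qn)
      qed
      finally have "exp (- (real n * (- ln w))) \<le> pr n" .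
      moreover have "- ln w < u"
        using ln_less_cancel_iff[of "exp (- u)" w] w w0 by simp
      ultimately show ?case by (intro exI[of _ "- ln w"]) simp
    qed
  next
    show "(\<lambda>n. 1 * (real (k n) * ln (real n + 1) / real n)) \<longlonglongrightarrow> 0"
      using type_count_negligible[OF sparse, of "\<lambda>n. real (k n)"] by simp
  qed auto
  then show "(\<lambda>n. - (1 / real n) * ln (measure_pmf.prob (multinomial_pmf (k n) n (Q n))
      {X. divergence_statistic \<alpha> k Q n X > x})) \<longlonglongrightarrow> renyi_rate \<alpha> x"
    by (simp add: pr_def g_def)
qed

lemma one_minus_inverse_power_ge:
  assumes "k \<ge> 2"
  shows "exp (- (real n * (2 / real k))) \<le> (1 - 1 / real k) ^ n"
proof -
  define z where "z = 1 / real k"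
  have z: "0 \<le> z" "z \<le> 1/2" using assms by (auto simp: z_def field_simps)
  have "z\<^sup>2 \<le> z * (1/2)" unfolding power2_eq_square using z by (intro mult_left_mono) auto
  then have "- (2 * z) \<le> ln (1 - z)" using ln_one_minus_pos_lower_bound[OF z] by simp
  then have "exp (- (2 * z)) \<le> 1 - z" using z by (subst ln_ge_iff[symmetric]) auto
  then have "exp (- (2 * z)) ^ n \<le> (1 - z) ^ n" by (intro power_mono) auto
  then show ?thesis by (simp add: z_def flip: exp_of_nat_mult)
qed

text \<open>Estimates \<open>n choose l \<ge> (n / l) ^ l\<close> and \<open>1 - 1 / k \<ge> exp (- 2 / k)\<close> in the binomial law of one
cell count. The loss in the exponent per observation is of order \<open>l / n + 1 / k\<close>, negligible
against the leading term \<open>l / n * ln (k l / n)\<close> for the values of \<open>l\<close> that matter.\<close>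

lemma multinomial_uniform_cell_count_ge:
  assumes k: "k \<ge> 2" and Q: "prob_vector k q" "q 1 = 1 / real k" and l: "1 \<le> l" "l \<le> n"
  shows "exp (- (real n * (real l / real n * ln (real k * (real l / real n)) + 2 / real k))) \<le>
     measure_pmf.prob (multinomial_pmf k n q) {X. X 1 = l}"
proof -
  have n: "real n > 0" and l0: "real l > 0" and k0: "real k > 0" using l k by auto
  have "exp (- (real n * (real l / real n * ln (real k * (real l / real n)) + 2 / real k))) =
      exp (real l * ln (real n / (real l * real k))) * exp (- (real n * (2 / real k)))"
    using n l0 k0 by (simp add: ln_div ln_mult ring_distribs flip: exp_add)
  also have "exp (real l * ln (real n / (real l * real k))) = (real n / real l) ^ l * (1 / real k) ^ l"
    using n l0 k0 by (simp add: exp_of_nat_mult flip: power_mult_distrib)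
  also have "(real n / real l) ^ l * (1 / real k) ^ l * exp (- (real n * (2 / real k))) \<le>
      real (n choose l) * (1 / real k) ^ l * (1 - 1 / real k) ^ (n - l)"
  proof (intro mult_mono)
    show "(real n / real l) ^ l \<le> real (n choose l)" by (rule binomial_ge_n_over_k_pow_k[OF l(2)])
    have "exp (- (real n * (2 / real k))) \<le> (1 - 1 / real k) ^ n"
      by (rule one_minus_inverse_power_ge[OF k])
    also have "\<dots> \<le> (1 - 1 / real k) ^ (n - l)" using k by (intro power_decreasing) auto
    finally show "exp (- (real n * (2 / real k))) \<le> (1 - 1 / real k) ^ (n - l)" .
  qed auto
  also have "\<dots> = pmf (binomial_pmf n (q 1)) l" using k Q(2) by (subst pmf_binomial) auto
  also have "\<dots> = measure_pmf.prob (multinomial_pmf k n q) ((\<lambda>X. X 1) -` {l})"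
    using map_multinomial_pmf_cell[OF Q(1), of 1 n] k by (simp only: pmf_map[symmetric]) simp
  finally show ?thesis by (simp add: vimage_def)
qed

text \<open>The lower bound on the probability comes from the event that one particular cell contains \<open>l n\<close>
observations, where \<open>l n / n\<close> slightly exceeds \<open>(\<alpha> (\<alpha> - 1) x) powr (1 / \<alpha>) * k powr (1 / \<alpha> - 1)\<close>.
The condition on \<open>k powr (2 - 1 / \<alpha>)\<close> is what makes the logarithm of the number of types,
about \<open>k ln n\<close>, negligible against \<open>n k powr (1 / \<alpha> - 1) ln k\<close>.\<close>

lemma bahadur_function_gt_1:
  assumes \<alpha>: "1 < \<alpha>"
    and Q: "\<And>n. n \<ge> 1 \<Longrightarrow> prob_vector (k n) (Q n)"
    and uniform: "\<And>n j. n \<ge> 1 \<Longrightarrow> j \<in> {1..k n} \<Longrightarrow> Q n j = 1 / real (k n)"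
    and A1: "assumption_A1 k"
    and sparse: "(\<lambda>n. real (k n) powr (2 - 1 / \<alpha>) * ln (real n) / real n) \<longlonglongrightarrow> 0"
  shows "bahadur_function \<alpha> k Q (\<lambda>n. real (k n) powr (1 - 1 / \<alpha>) / ln (real (k n)))
     (\<lambda>x. (\<alpha> * (\<alpha> - 1) * x) powr (1 / \<alpha>) / \<alpha>)"
  unfolding bahadur_function_def
proof (intro conjI ballI)
  show "continuous_on (divergence_levels \<alpha>) (\<lambda>x. (\<alpha> * (\<alpha> - 1) * x) powr (1 / \<alpha>) / \<alpha>)"
    using \<alpha> by (intro continuous_intros) (auto simp: divergence_levels_def)
  fix x assume "x \<in> divergence_levels \<alpha>"
  then have x: "x > 0" by (simp add: divergence_levels_def)
  define y where "y = \<alpha> * (\<alpha> - 1) * x"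
  define g where "g = y powr (1 / \<alpha>) / \<alpha>"
  have y: "y > 0" using \<alpha> x by (simp add: y_def)
  have g: "g > 0" using y \<alpha> by (simp add: g_def)
  then show "(\<alpha> * (\<alpha> - 1) * x) powr (1 / \<alpha>) / \<alpha> > 0" by (simp add: g_def y_def)
  define c where "c = (\<lambda>n. real (k n) powr (1 - 1 / \<alpha>) / ln (real (k n)))"
  define pr where "pr = (\<lambda>n. measure_pmf.prob (multinomial_pmf (k n) n (Q n)) {X. divergence_statistic \<alpha> k Q n X > x})"
  have k_top: "filterlim k at_top sequentially" and kn: "\<And>n. n \<ge> 1 \<Longrightarrow> k n \<le> n"
    using A1 by (auto simp: assumption_A1_def)
  have k_large: "\<forall>\<^sub>F n in sequentially. P (k n)" if "\<forall>\<^sub>F m in sequentially. P m" for P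
    using k_top that by (rule eventually_compose_filterlim[rotated])
  have k_tendsto: "(\<lambda>n. f (k n)) \<longlonglongrightarrow> L" if "f \<longlonglongrightarrow> L" for f :: "nat \<Rightarrow> real" and L
    using filterlim_compose[OF that k_top] .
  have ln_k: "\<forall>\<^sub>F n in sequentially. 1 \<le> ln (real (k n))"
    by (rule k_large) real_asymp
  have to_uniform: "power_divergence \<beta> (k n) p (Q n) = power_divergence \<beta> (k n) p (\<lambda>_. 1 / real (k n))"
    if "n \<ge> 1" for \<beta> n p using uniform[OF that] by (intro power_divergence_cong) auto
  have "(\<lambda>n. - (c n / real n) * ln (pr n)) \<longlonglongrightarrow> g"
  proof (rule neg_log_prob_tendstoI)
    fix u assume u: "u < g"
    \<comment> \<open>any \<open>\<kappa>\<close> strictly between \<open>max 0 (u / g)\<close> and \<open>1\<close> would do\<close>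
    define \<kappa> where "\<kappa> = max (1/2) ((u / g + 1) / 2)"
    have \<kappa>: "0 < \<kappa>" "\<kappa> < 1" "u < \<kappa> * g"
    proof -
      have "u / g < 1" using u g by simp
      then show "0 < \<kappa>" "\<kappa> < 1" and "u < \<kappa> * g"
        using g by (auto simp: \<kappa>_def max_def field_simps)
    qed
    show "\<forall>\<^sub>F n in sequentially. \<exists>r. pr n \<le> (real n + 1) ^ k n * exp (- (real n * r)) \<and> u < c n * r"
      using k_large[OF uniform_divergence_lower_asymptotic[OF \<alpha> x \<kappa>(1,2)]] ln_k eventually_ge_at_top[of 1]
    proof eventually_elim
      case (elim n)
      define r where "r = \<kappa> * g * (real (k n) powr (1 / \<alpha> - 1) * ln (real (k n)))"
      have Qn: "prob_vector (k n) (Q n)" using Q elim by simp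
      have k0: "k n \<ge> 1" using Qn by (rule prob_vector_dim_pos)
      have "pr n \<le> measure_pmf.prob (multinomial_pmf (k n) n (Q n)) {X. r \<le> power_divergence 1 (k n) (\<lambda>j. X j / n) (Q n)}"
        unfolding pr_def
      proof (rule multinomial_prob_mono)
        fix X assume X: "X \<in> set_pmf (multinomial_pmf (k n) n (Q n))" "X \<in> {X. divergence_statistic \<alpha> k Q n X > x}"
        have "prob_vector (k n) (\<lambda>j. real (X j) / real n)"
          by (rule prob_vector_empirical[OF Qn X(1) elim(3)])
        then show "X \<in> {X. r \<le> power_divergence 1 (k n) (\<lambda>j. X j / n) (Q n)}"
          using X(2) elim(1) to_uniform[OF elim(3)]
          by (simp add: divergence_statistic_def r_def g_def y_def)
      qed
      also have "\<dots> \<le> (real n + 1) ^ k n * exp (- (real n * r))"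
        using elim k0 by (intro multinomial_prob_divergence_ge[OF Qn]) (auto simp: uniform)
      finally have "pr n \<le> (real n + 1) ^ k n * exp (- (real n * r))" .
      moreover have "c n * r = \<kappa> * g"
      proof -
        have "real (k n) powr (1 - 1 / \<alpha>) * real (k n) powr (1 / \<alpha> - 1) = 1"
          using k0 by (simp flip: powr_add)
        then show ?thesis using elim(2) by (simp add: c_def r_def mult_ac)
      qed
      ultimately show ?case using \<kappa>(3) by auto
    qed
  next
    fix u assume u: "g < u"
    define \<delta> where "\<delta> = (u / g - 1) / 2"
    have \<delta>: "\<delta> > 0" "(1 + \<delta>) * g < u"
    proof -
      have "1 < u / g" using u g by simp
      then show "\<delta> > 0" by (simp add: \<delta>_def)
      have "(1 + \<delta>) * g = (u + g) / 2" using g by (simp add: \<delta>_def field_simps)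
      then show "(1 + \<delta>) * g < u" using u by simp
    qed
    define \<tau> where "\<tau> = (1 + \<delta>) * y powr (1 / \<alpha>)"
    have \<tau>: "\<tau> > 0" using \<delta> y by (simp add: \<tau>_def)
    have \<tau>_powr: "\<tau> powr \<alpha> > y"
    proof -
      have "\<tau> powr \<alpha> = (1 + \<delta>) powr \<alpha> * y"
        using \<delta> y \<alpha> by (simp add: \<tau>_def powr_mult powr_powr)
      moreover have "(1 + \<delta>) powr \<alpha> > 1"
        using \<delta> \<alpha> by (intro gr_one_powr) auto
      ultimately show ?thesis using y by simp
    qed
    \<comment> \<open>the count of the overloaded cell; \<open>b n\<close> is its frequency relative to \<open>k powr (1 / \<alpha> - 1)\<close>, so
      that \<open>b n powr \<alpha>\<close> is its contribution to the power sum\<close>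
    define l where "l = (\<lambda>n. nat \<lceil>\<tau> * (real n / real (k n) powr (1 - 1 / \<alpha>))\<rceil>)"
    define b where "b = (\<lambda>n. real (k n) powr (1 - 1 / \<alpha>) * (real (l n) / real n))"
    have k1: "\<forall>\<^sub>F n in sequentially. 2 \<le> k n" by (rule k_large) (rule eventually_ge_at_top)
    have b: "b \<longlonglongrightarrow> \<tau>"
    proof (rule tendsto_sandwich)
      show "\<forall>\<^sub>F n in sequentially. \<tau> \<le> b n"
        using k1 eventually_ge_at_top[of 1]
      proof eventually_elim
        case (elim n)
        have "\<tau> * (real n / real (k n) powr (1 - 1 / \<alpha>)) \<le> real (l n)"
          unfolding l_def by (rule real_nat_ceiling_ge)
        then show ?case using elim by (simp add: b_def field_simps)
      qed
      show "\<forall>\<^sub>F n in sequentially. b n \<le> \<tau> + real (k n) powr (1 - 1 / \<alpha>) / real n"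
        using k1 eventually_ge_at_top[of 1]
      proof eventually_elim
        case (elim n)
        have "0 \<le> \<tau> * (real n / real (k n) powr (1 - 1 / \<alpha>))" using \<tau> by simp
        then have "real (l n) \<le> \<tau> * (real n / real (k n) powr (1 - 1 / \<alpha>)) + 1"
          unfolding l_def by linarith
        then have "b n \<le> real (k n) powr (1 - 1 / \<alpha>) * ((\<tau> * (real n / real (k n) powr (1 - 1 / \<alpha>)) + 1) / real n)"
          unfolding b_def using elim by (intro mult_left_mono divide_right_mono) auto
        also have "\<dots> = \<tau> + real (k n) powr (1 - 1 / \<alpha>) / real n"
          using elim by (simp add: field_simps)
        finally show ?case .
      qed
      have "(\<lambda>n. real (k n) powr (1 - 1 / \<alpha>) / real n) \<longlonglongrightarrow> 0"
      proof (rule tendsto_sandwich[where f = "\<lambda>_. 0" and h = "\<lambda>n. real (k n) powr (2 - 1 / \<alpha>) * ln (real n) / real n"])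
        show "\<forall>\<^sub>F n in sequentially. real (k n) powr (1 - 1 / \<alpha>) / real n \<le> real (k n) powr (2 - 1 / \<alpha>) * ln (real n) / real n"
          using k1 ln_k eventually_ge_at_top[of 1]
        proof eventually_elim
          case (elim n)
          have "ln (real (k n)) \<le> ln (real n)" using kn[OF elim(3)] elim by (intro ln_mono) auto
          with elim(2) have "1 \<le> ln (real n)" by linarith
          then have "real (k n) powr (1 - 1 / \<alpha>) * 1 \<le> real (k n) powr (2 - 1 / \<alpha>) * ln (real n)"
            using elim by (intro mult_mono powr_mono) auto
          then show ?case using elim by (intro divide_right_mono) auto
        qed
      qed (use sparse in auto)
      from tendsto_add[OF tendsto_const this, of \<tau>]
      show "(\<lambda>n. \<tau> + real (k n) powr (1 - 1 / \<alpha>) / real n) \<longlonglongrightarrow> \<tau>" by simp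
    qed auto
    have lim_k: "(\<lambda>n. 1 / real (k n)) \<longlonglongrightarrow> 0" "(\<lambda>n. real (k n) powr (1 / \<alpha> - 1)) \<longlonglongrightarrow> 0"
      "(\<lambda>n. real (k n) powr (- 1 / \<alpha>) / ln (real (k n))) \<longlonglongrightarrow> 0" "(\<lambda>n. 1 / ln (real (k n))) \<longlonglongrightarrow> 0"
    proof -
      show "(\<lambda>n. 1 / real (k n)) \<longlonglongrightarrow> 0" by (rule k_tendsto) real_asymp
      have "1 / \<alpha> - 1 < 0" using \<alpha> by simp
      then show "(\<lambda>n. real (k n) powr (1 / \<alpha> - 1)) \<longlonglongrightarrow> 0"
        by (intro k_tendsto[of "\<lambda>m. real m powr (1 / \<alpha> - 1)"]) real_asymp
      have "- 1 / \<alpha> < 0" using \<alpha> by simp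
      then show "(\<lambda>n. real (k n) powr (- 1 / \<alpha>) / ln (real (k n))) \<longlonglongrightarrow> 0"
        by (intro k_tendsto[of "\<lambda>m. real m powr (- 1 / \<alpha>) / ln (real m)"]) real_asymp
      show "(\<lambda>n. 1 / ln (real (k n))) \<longlonglongrightarrow> 0" by (rule k_tendsto) real_asymp
    qed
    have "(\<lambda>n. b n powr \<alpha> - 1 / real (k n) - \<alpha> * (b n * real (k n) powr (1 / \<alpha> - 1))) \<longlonglongrightarrow> \<tau> powr \<alpha> - 0 - \<alpha> * (\<tau> * 0)"
      using \<tau> by (intro tendsto_diff tendsto_mult tendsto_powr b lim_k tendsto_const) auto
    then have ev_gt: "\<forall>\<^sub>F n in sequentially. y < b n powr \<alpha> - 1 / real (k n) - \<alpha> * (b n * real (k n) powr (1 / \<alpha> - 1))"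
      using \<tau>_powr by (intro order_tendstoD(1)) auto
    have "(\<lambda>n. b n * real (k n) powr (1 / \<alpha> - 1)) \<longlonglongrightarrow> \<tau> * 0"
      by (intro tendsto_mult b lim_k)
    then have ev_lt: "\<forall>\<^sub>F n in sequentially. b n * real (k n) powr (1 / \<alpha> - 1) < 1"
      by (intro order_tendstoD(2)) auto
    have "(\<lambda>n. b n * (1 / \<alpha> + ln (b n) * (1 / ln (real (k n)))) + 2 * (real (k n) powr (- 1 / \<alpha>) / ln (real (k n)))) \<longlonglongrightarrow>
        \<tau> * (1 / \<alpha> + ln \<tau> * 0) + 2 * 0"
      using \<tau> by (intro tendsto_add tendsto_mult tendsto_ln b lim_k tendsto_const) auto
    moreover have "\<tau> * (1 / \<alpha> + ln \<tau> * 0) + 2 * 0 = (1 + \<delta>) * g" by (simp add: \<tau>_def g_def)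
    ultimately have ev_rate: "\<forall>\<^sub>F n in sequentially.
        b n * (1 / \<alpha> + ln (b n) * (1 / ln (real (k n)))) + 2 * (real (k n) powr (- 1 / \<alpha>) / ln (real (k n))) < u"
      using \<delta>(2) by (intro order_tendstoD(2)) auto
    have ev_pos: "\<forall>\<^sub>F n in sequentially. 0 < b n" using b \<tau> by (rule order_tendstoD(1))
    show "\<forall>\<^sub>F n in sequentially. \<exists>s. exp (- (real n * s)) \<le> pr n \<and> c n * s < u"
      using ev_gt ev_lt ev_rate ev_pos ln_k k1 eventually_ge_at_top[of 1]
    proof eventually_elim
      case (elim n)
      define h where "h = real (l n) / real n"
      have Qn: "prob_vector (k n) (Q n)" using Q elim by simp
      have k0: "real (k n) > 0" using elim by simp
      have "real (k n) powr (1 - 1 / \<alpha>) * real (k n) powr (1 / \<alpha> - 1) = 1"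
        using k0 by (simp flip: powr_add)
      then have h: "h = b n * real (k n) powr (1 / \<alpha> - 1)"
        by (simp add: b_def h_def mult_ac)
      then have "0 < h" "h < 1" using elim k0 by auto
      then have l: "1 \<le> l n" "l n \<le> n" using elim by (auto simp: h_def field_simps)
      define s where "s = h * ln (real (k n) * h) + 2 / real (k n)"
      have "exp (- (real n * s)) \<le> measure_pmf.prob (multinomial_pmf (k n) n (Q n)) {X. X 1 = l n}"
        unfolding s_def h_def using elim l
        by (intro multinomial_uniform_cell_count_ge Qn uniform) auto
      also have "\<dots> \<le> pr n"
        unfolding pr_def
      proof (rule multinomial_prob_mono)
        fix X assume X: "X \<in> set_pmf (multinomial_pmf (k n) n (Q n))" "X \<in> {X. X 1 = l n}"
        define p where "p = (\<lambda>j. real (X j) / real n)"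
        have p: "prob_vector (k n) p"
          unfolding p_def using elim by (intro prob_vector_empirical[OF Qn X(1)]) auto
        have p1: "p 1 = h" using X(2) by (simp add: p_def h_def)
        have "real (k n) powr (\<alpha> - 1) * h powr \<alpha> = b n powr \<alpha>"
        proof -
          have "h powr \<alpha> = b n powr \<alpha> * real (k n) powr ((1 / \<alpha> - 1) * \<alpha>)"
            using elim by (simp add: h powr_mult powr_powr)
          also have "(1 / \<alpha> - 1) * \<alpha> = 1 - \<alpha>" using \<alpha> by (simp add: field_simps)
          finally show ?thesis using k0 by (simp add: mult_ac flip: powr_add)
        qed
        then have "1 + y < power_sum \<alpha> (k n) p (\<lambda>_. 1 / real (k n))"
          using uniform_power_sum_ge_cell[OF p _ \<alpha>] elim unfolding p1 h by force
        then have "y < \<alpha> * (\<alpha> - 1) * power_divergence \<alpha> (k n) p (\<lambda>_. 1 / real (k n))"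
          using power_sum_eq_divergence[of \<alpha> "k n" p "\<lambda>_. 1 / real (k n)"] \<alpha> by simp
        then have "x < power_divergence \<alpha> (k n) p (\<lambda>_. 1 / real (k n))"
          using \<alpha> by (simp add: y_def)
        then show "X \<in> {X. divergence_statistic \<alpha> k Q n X > x}"
          using to_uniform[of n \<alpha> p] elim by (simp add: divergence_statistic_def p_def)
      qed
      finally have "exp (- (real n * s)) \<le> pr n" .
      moreover have "c n * s < u"
      proof -
        have "real (k n) * h = b n * real (k n) powr (1 / \<alpha>)"
          using k0 by (simp add: h powr_diff)
        then have "ln (real (k n) * h) = ln (b n) + 1 / \<alpha> * ln (real (k n))"
          using elim k0 by (simp add: ln_mult ln_powr)
        moreover have "real (k n) powr (1 - 1 / \<alpha>) * h = b n" by (simp add: b_def h_def)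
        moreover have "real (k n) powr (1 - 1 / \<alpha>) / real (k n) = real (k n) powr (- 1 / \<alpha>)"
          using k0 by (simp add: powr_diff powr_minus field_simps)
        ultimately have "c n * s = b n * (1 / \<alpha> + ln (b n) * (1 / ln (real (k n)))) + 2 * (real (k n) powr (- 1 / \<alpha>) / ln (real (k n)))"
        proof -
          assume 1: "ln (real (k n) * h) = ln (b n) + 1 / \<alpha> * ln (real (k n))"
            and 2: "real (k n) powr (1 - 1 / \<alpha>) * h = b n"
            and 3: "real (k n) powr (1 - 1 / \<alpha>) / real (k n) = real (k n) powr (- 1 / \<alpha>)"
          have "c n * s = (real (k n) powr (1 - 1 / \<alpha>) * h) * ln (real (k n) * h) / ln (real (k n)) +
              2 * ((real (k n) powr (1 - 1 / \<alpha>) / real (k n)) / ln (real (k n)))"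
            by (simp add: c_def s_def ring_distribs add_divide_distrib mult_ac)
          also have "\<dots> = b n * (ln (b n) + 1 / \<alpha> * ln (real (k n))) / ln (real (k n)) +
              2 * (real (k n) powr (- 1 / \<alpha>) / ln (real (k n)))"
            by (simp only: 1 2 3)
          also have "b n * (ln (b n) + 1 / \<alpha> * ln (real (k n))) / ln (real (k n)) = b n * (1 / \<alpha> + ln (b n) * (1 / ln (real (k n))))"
            using elim(5) by (simp add: ring_distribs add_divide_distrib)
          finally show ?thesis .
        qed
        then show ?thesis using elim by simp
      qed
      ultimately show ?case by blast
    qed
  next
    show "\<forall>\<^sub>F n in sequentially. 0 \<le> c n"
      using ln_k by eventually_elim (simp add: c_def)
    have "\<forall>\<^sub>F n in sequentially. 0 \<le> c n * real (k n) \<and> c n * real (k n) \<le> real (k n) powr (2 - 1 / \<alpha>)"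
      using ln_k
    proof eventually_elim
      case (elim n)
      then have k0: "real (k n) > 0" by (cases "k n") auto
      have "real (k n) powr (1 - 1 / \<alpha>) / ln (real (k n)) * real (k n) \<le> real (k n) powr (1 - 1 / \<alpha>) / 1 * real (k n)"
        using elim by (intro mult_right_mono divide_left_mono) auto
      also have "\<dots> = real (k n) powr (2 - 1 / \<alpha>)"
        using k0 by (simp add: powr_diff power2_eq_square)
      finally show ?case using elim by (simp add: c_def)
    qed
    from type_count_negligible[OF sparse this]
    show "(\<lambda>n. c n * (real (k n) * ln (real n + 1) / real n)) \<longlonglongrightarrow> 0"
      by (simp add: mult_ac)
  qed
  then show "(\<lambda>n. - (real (k n) powr (1 - 1 / \<alpha>) / ln (real (k n)) / real n) *
      ln (measure_pmf.prob (multinomial_pmf (k n) n (Q n)) {X. divergence_statistic \<alpha> k Q n X > x}))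
      \<longlonglongrightarrow> (\<alpha> * (\<alpha> - 1) * x) powr (1 / \<alpha>) / \<alpha>"
    by (simp add: c_def pr_def g_def y_def)
qed

section \<open>Matching sample sizes and Bahadur efficiency\<close>

text \<open>With \<open>t = ln x\<close> this is the monotonicity of \<open>exp (\<beta> t) / t\<close> on \<open>\<beta> t \<ge> 1\<close>.\<close>

lemma powr_div_ln_mono:
  fixes \<beta> x y :: real
  assumes "0 < \<beta>" "exp (1 / \<beta>) \<le> x" "x \<le> y"
  shows "x powr \<beta> / ln x \<le> y powr \<beta> / ln y"
proof -
  have pos: "0 < x" "0 < y" using assms exp_gt_zero[of "1 / \<beta>"] by linarith+
  define t where "t = ln x"
  define t' where "t' = ln y"
  have "1 / \<beta> \<le> t" unfolding t_def using assms(2) pos by (simp add: ln_ge_iff)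
  then have t1: "1 \<le> \<beta> * t" using assms(1) by (simp add: field_simps)
  then have t: "0 < t" using assms(1) by (smt (verit) mult_nonneg_nonpos)
  have tt': "t \<le> t'" unfolding t_def t'_def using pos assms(3) by simp
  have "t' = t + (t' - t) * 1" by simp
  also have "\<dots> \<le> t + (t' - t) * (\<beta> * t)"
    using tt' t1 by (intro add_left_mono mult_left_mono) auto
  also have "\<dots> = t * (1 + \<beta> * (t' - t))" by (simp add: algebra_simps)
  also have "\<dots> \<le> t * exp (\<beta> * (t' - t))"
    using t by (intro mult_left_mono exp_ge_add_one_self) auto
  finally have "t' * exp (\<beta> * t) \<le> t * exp (\<beta> * (t' - t)) * exp (\<beta> * t)"
    by (rule mult_right_mono) simp
  also have "\<dots> = t * exp (\<beta> * t')" by (simp add: algebra_simps flip: exp_add)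
  finally have "exp (\<beta> * t) / t \<le> exp (\<beta> * t') / t'"
    using t tt' by (simp add: field_simps)
  then show ?thesis using pos by (simp add: powr_def t_def t'_def)
qed

text \<open>
The second generating sequence \<open>c2\<close> is eventually positive and nondecreasing and grows faster than
\<open>c1\<close>. The target \<open>r n / c1 n\<close> is the value that \<open>m n / c2 (m n)\<close> has to match.
\<close>

context
  fixes c1 c2 :: "nat \<Rightarrow> real" and r :: real and N :: nat
  assumes r: "r > 0"
    and c1: "\<And>n. n \<ge> N \<Longrightarrow> c1 n > 0"
    and c2: "\<And>n. n \<ge> N \<Longrightarrow> c2 n > 0" "\<And>m n. N \<le> m \<Longrightarrow> m \<le> n \<Longrightarrow> c2 m \<le> c2 n"
    and ratio: "filterlim (\<lambda>n. c2 n / c1 n) at_top sequentially"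
begin

text \<open>At equal sample sizes the second statistic eventually stays below any positive fraction of the target.\<close>

lemma eventually_unmatched:
  assumes "B > 0"
  shows "\<forall>\<^sub>F n in sequentially. real n / c2 n < B * (r * (real n / c1 n))"
proof -
  have "\<forall>\<^sub>F n in sequentially. 1 / (B * r) < c2 n / c1 n"
    using ratio by (simp add: filterlim_at_top_dense)
  then show ?thesis using eventually_ge_at_top[of N] eventually_gt_at_top[of 0]
  proof eventually_elim
    case (elim n)
    then show ?case using c1[of n] c2(1)[of n] r assms by (simp add: field_simps)
  qed
qed

text \<open>The sequence \<open>n / c2 n\<close> tends to infinity and eventually grows at most by the factor \<open>(l + 1) / l\<close> from \<open>l\<close>
to \<open>l + 1\<close>, although it may drop. So the first index from \<open>n\<close> on at which it reaches its target
overshoots the target only by a factor close to \<open>1\<close>. This index exceeds \<open>n\<close> by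
\<open>eventually_unmatched\<close>.\<close>

lemma ex_matching_sample_sizes:
  assumes "filterlim (\<lambda>n. real n / c2 n) at_top sequentially"
  shows "\<exists>m. matching_sample_sizes c1 c2 r m"
proof -
  define y where "y = (\<lambda>n. r * (real n / c1 n))"
  define f where "f = (\<lambda>n. real n / c2 n)"
  define m where "m = (\<lambda>n. LEAST m. n \<le> m \<and> y n \<le> f m)"
  have m: "n \<le> m n" "y n \<le> f (m n)" for n
  proof -
    have "\<forall>\<^sub>F l in sequentially. y n \<le> f l"
      using assms by (simp add: filterlim_at_top f_def)
    then have "\<exists>l. n \<le> l \<and> y n \<le> f l"
      using eventually_ge_at_top[of n] by (metis (mono_tags, lifting) eventually_conj eventually_sequentially order_refl)
    then have "n \<le> m n \<and> y n \<le> f (m n)" unfolding m_def by (rule LeastI_ex)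
    then show "n \<le> m n" "y n \<le> f (m n)" by auto
  qed
  have unmatched: "\<forall>\<^sub>F n in sequentially. f n < y n"
    using eventually_unmatched[of 1] by (simp add: f_def y_def)
  then have gt: "\<forall>\<^sub>F n in sequentially. n < m n"
    by eventually_elim (use m in \<open>metis le_neq_implies_less not_less\<close>)
  have "filterlim m at_top sequentially"
    by (rule filterlim_at_top_mono[OF filterlim_ident]) (use m in auto)
  moreover have "(\<lambda>n. f (m n)) \<sim>[sequentially] y"
  proof (rule asymp_equivI', rule tendsto_sandwich)
    have y_pos: "\<forall>\<^sub>F n in sequentially. 0 < y n"
      using eventually_ge_at_top[of N] eventually_gt_at_top[of 0]
      by eventually_elim (use c1 r in \<open>simp add: y_def\<close>)
    show "\<forall>\<^sub>F n in sequentially. 1 \<le> f (m n) / y n"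
      using y_pos by eventually_elim (use m in simp)
    show "\<forall>\<^sub>F n in sequentially. f (m n) / y n \<le> 1 + 1 / real n"
      using y_pos gt eventually_ge_at_top[of N] eventually_gt_at_top[of 0]
    proof eventually_elim
      case (elim n)
      define l where "l = m n - 1"
      have l: "m n = Suc l" "n \<le> l" using elim by (auto simp: l_def)
      have "\<not> (n \<le> l \<and> y n \<le> f l)"
        using not_less_Least[of l "\<lambda>m. n \<le> m \<and> y n \<le> f m"] l(1) by (simp add: m_def)
      then have fl: "f l < y n" using l by simp
      have "f (m n) = (real l + 1) / c2 (Suc l)" by (simp add: f_def l)
      also have "\<dots> \<le> (real l + 1) / c2 l"
        using c2(1)[of l] c2(2)[of l "Suc l"] l elim by (intro divide_left_mono) auto
      also have "\<dots> = (1 + 1 / real l) * f l"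
        using l elim c2(1)[of l] by (simp add: f_def field_simps)
      also have "\<dots> \<le> (1 + 1 / real n) * y n"
        using fl l elim c2(1)[of l] by (intro mult_mono add_left_mono divide_left_mono) (auto simp: f_def)
      finally show ?case using elim by (simp add: field_simps)
    qed
    show "(\<lambda>n. 1 + 1 / real n) \<longlonglongrightarrow> 1" by real_asymp
  qed auto
  moreover have "\<forall>\<^sub>F n in sequentially. \<forall>l\<in>{m n..n}. real l / c2 l \<ge> (1 - \<epsilon>) * (real (m n) / c2 (m n))" for \<epsilon>
    using gt by eventually_elim auto
  ultimately show ?thesis
    unfolding matching_sample_sizes_def f_def y_def by blast
qed

text \<open>If \<open>m n < n\<close>, the last clause in the definition of matching sample sizes, applied to \<open>l = n\<close>, would
contradict \<open>eventually_unmatched\<close>. So \<open>m n \<ge> n\<close>, and the quotient is at least \<open>c2 n / c1 n\<close>.\<close>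

lemma matching_sample_sizes_ratio_infinite:
  assumes m: "matching_sample_sizes c1 c2 r m"
  shows "(\<lambda>n. ereal (c2 (m n) / c1 n)) \<longlonglongrightarrow> \<infinity>"
proof -
  define y where "y = (\<lambda>n. r * (real n / c1 n))"
  define f where "f = (\<lambda>n. real n / c2 n)"
  have equiv: "(\<lambda>n. f (m n)) \<sim>[sequentially] y"
    and "\<forall>\<epsilon>>0. \<forall>\<^sub>F n in sequentially. \<forall>l\<in>{m n..n}. f l \<ge> (1 - \<epsilon>) * f (m n)"
    using m unfolding matching_sample_sizes_def f_def y_def by blast+
  then have last: "\<forall>\<^sub>F n in sequentially. \<forall>l\<in>{m n..n}. f l \<ge> (1 - 1/2) * f (m n)"
    by (elim allE[of _ "1/2"]) simp
  have y_pos: "\<forall>\<^sub>F n in sequentially. 0 < y n"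
    using eventually_ge_at_top[of N] eventually_gt_at_top[of 0]
    by eventually_elim (use c1 r in \<open>simp add: y_def\<close>)
  have "((\<lambda>n. if f (m n) = 0 \<and> y n = 0 then 1 else f (m n) / y n) \<longlongrightarrow> 1) sequentially"
    using equiv by (simp add: asymp_equiv_def)
  then have "\<forall>\<^sub>F n in sequentially. 1/2 < (if f (m n) = 0 \<and> y n = 0 then 1 else f (m n) / y n)"
    by (rule order_tendstoD(1)) simp
  then have half: "\<forall>\<^sub>F n in sequentially. y n / 2 < f (m n)"
    using y_pos by eventually_elim (auto simp: field_simps split: if_splits)
  have "\<forall>\<^sub>F n in sequentially. f n < 1/4 * y n"
    using eventually_unmatched[of "1/4"] by (simp add: f_def y_def)
  then have ge: "\<forall>\<^sub>F n in sequentially. n \<le> m n"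
    using half last
  proof eventually_elim
    case (elim n)
    show ?case
    proof (rule ccontr)
      assume "\<not> n \<le> m n"
      then have "(1 - 1/2) * f (m n) \<le> f n" using elim(3) by simp
      then show False using elim(1,2) by simp
    qed
  qed
  have "\<forall>\<^sub>F n in sequentially. c2 n / c1 n \<le> c2 (m n) / c1 n"
    using ge eventually_ge_at_top[of N]
    by eventually_elim (use c1 c2 in \<open>simp add: divide_right_mono less_imp_le\<close>)
  then have "filterlim (\<lambda>n. c2 (m n) / c1 n) at_top sequentially"
    by (rule filterlim_at_top_mono[OF ratio])
  then show ?thesis by (simp add: tendsto_PInfty_eq_at_top)
qed

end

lemma matching_sample_sizes_constant:
  assumes r: "r > 0"
  shows "\<exists>m. matching_sample_sizes (\<lambda>_. 1) (\<lambda>_. 1) r m"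
proof -
  define m where "m = (\<lambda>n::nat. nat \<lceil>r * real n\<rceil>)"
  have m: "r * real n \<le> real (m n)" "real (m n) \<le> r * real n + 1" for n
  proof -
    show "r * real n \<le> real (m n)" unfolding m_def by (rule real_nat_ceiling_ge)
    have "0 \<le> r * real n" using r by simp
    then show "real (m n) \<le> r * real n + 1" unfolding m_def by linarith
  qed
  have "filterlim (\<lambda>n. real (m n)) at_top sequentially"
  proof (rule filterlim_at_top_mono)
    show "filterlim (\<lambda>n. r * real n) at_top sequentially" using r by real_asymp
  qed (use m in auto)
  then have "filterlim m at_top sequentially"
    by (simp add: filterlim_real_sequentially filterlim_sequentially_iff_filterlim_real)
  moreover have "(\<lambda>n. real (m n)) \<sim>[sequentially] (\<lambda>n. r * real n)"
  proof (rule asymp_equivI', rule tendsto_sandwich)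
    show "\<forall>\<^sub>F n in sequentially. 1 \<le> real (m n) / (r * real n)"
      using eventually_gt_at_top[of 0] by eventually_elim (use m r in simp)
    show "\<forall>\<^sub>F n in sequentially. real (m n) / (r * real n) \<le> (r * real n + 1) / (r * real n)"
      using eventually_gt_at_top[of 0] by eventually_elim (use m r in \<open>intro divide_right_mono, auto\<close>)
    show "(\<lambda>n. (r * real n + 1) / (r * real n)) \<longlonglongrightarrow> 1" using r by real_asymp
  qed auto
  moreover have "(1 - \<epsilon>) * real (m n) \<le> real l" if "\<epsilon> > 0" "m n \<le> l" for \<epsilon> :: real and l n
  proof -
    have "(1 - \<epsilon>) * real (m n) \<le> 1 * real (m n)" using that by (intro mult_right_mono) auto
    then show ?thesis using that by simp
  qed
  ultimately show ?thesis
    unfolding matching_sample_sizes_def by (intro exI[of _ m]) auto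
qed

text \<open>For \<open>\<alpha>1 < 1\<close> the claim is that the limit of the power sums of order \<open>\<alpha>1\<close> is not \<open>0\<close>, i.e. that the
Renyi divergences of order \<open>\<alpha>1\<close> stay bounded. They lie below those of order \<open>\<alpha>2\<close>: by
log-convexity for \<open>\<alpha>2 < 1\<close>, and by comparison with the information divergence for \<open>\<alpha>2 \<ge> 1\<close>.\<close>

lemma divergence_level_below:
  assumes \<alpha>: "0 < \<alpha>1" "\<alpha>1 < \<alpha>2"
    and P: "\<And>n. n \<ge> 1 \<Longrightarrow> prob_vector (k n) (P n)"
    and Q: "\<And>n j. n \<ge> 1 \<Longrightarrow> j \<in> {1..k n} \<Longrightarrow> Q n j > 0"
    and A3: "assumption_A3 \<alpha>1 \<Delta>1 k P Q" "assumption_A3 \<alpha>2 \<Delta>2 k P Q"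
    and \<Delta>2: "\<Delta>2 \<in> divergence_levels \<alpha>2"
  shows "\<Delta>1 \<in> divergence_levels \<alpha>1"
proof -
  have pos: "0 < \<Delta>1" and D1: "(\<lambda>n. power_divergence \<alpha>1 (k n) (P n) (Q n)) \<longlonglongrightarrow> \<Delta>1"
    and D2: "(\<lambda>n. power_divergence \<alpha>2 (k n) (P n) (Q n)) \<longlonglongrightarrow> \<Delta>2"
    using A3 by (auto simp: assumption_A3_def)
  show ?thesis
  proof (cases "\<alpha>1 < 1")
    case False
    then have "0 \<le> \<alpha>1 * (\<alpha>1 - 1) * \<Delta>1" using \<alpha> pos by (intro mult_nonneg_nonneg) auto
    then show ?thesis using pos by (simp add: divergence_levels_def)
  next
    case True
    define H where "H = (\<lambda>\<alpha> n. 1 + \<alpha> * (\<alpha> - 1) * power_divergence \<alpha> (k n) (P n) (Q n))"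
    define h2 where "h2 = 1 + \<alpha>2 * (\<alpha>2 - 1) * \<Delta>2"
    have h2: "h2 > 0" using \<Delta>2 by (simp add: divergence_levels_def h2_def)
    have H1: "H \<alpha>1 \<longlonglongrightarrow> 1 + \<alpha>1 * (\<alpha>1 - 1) * \<Delta>1" and H2: "H \<alpha>2 \<longlonglongrightarrow> h2"
      unfolding H_def h2_def by (intro tendsto_intros D1 D2)+
    have H_power_sum: "H \<alpha> n = power_sum \<alpha> (k n) (P n) (Q n)" if "\<alpha> \<noteq> 0" "\<alpha> \<noteq> 1" for \<alpha> n
      using power_sum_eq_divergence[OF that] by (simp add: H_def)
    have "\<exists>e>0. \<forall>\<^sub>F n in sequentially. e \<le> H \<alpha>1 n"
    proof (cases "\<alpha>2 < 1")
      case \<alpha>2: True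
      define t where "t = (1 - \<alpha>2) / (1 - \<alpha>1)"
      have t: "t > 0" using \<alpha> \<alpha>2 by (simp add: t_def)
      have "\<forall>\<^sub>F n in sequentially. h2 / 2 < H \<alpha>2 n"
        using h2 by (intro order_tendstoD(1)[OF H2]) simp
      then have "\<forall>\<^sub>F n in sequentially. (h2 / 2) powr (1 / t) \<le> H \<alpha>1 n"
        using eventually_ge_at_top[of 1]
      proof eventually_elim
        case (elim n)
        have "H \<alpha>1 n > 0"
          using power_sum_pos[where q = "Q n" and \<alpha> = \<alpha>1, OF P[OF elim(2)] Q[OF elim(2)]] \<alpha> \<alpha>2 by (simp add: H_power_sum)
        have "h2 / 2 \<le> H \<alpha>1 n powr t"
          using power_sum_lyapunov[where q = "Q n", OF P[OF elim(2)] Q[OF elim(2)] \<alpha>(2) \<alpha>2] elim \<alpha> \<alpha>2 by (simp add: H_power_sum t_def)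
        then have "(h2 / 2) powr (1 / t) \<le> (H \<alpha>1 n powr t) powr (1 / t)"
          using h2 t by (intro powr_mono2) auto
        then show ?case using t \<open>H \<alpha>1 n > 0\<close> by (simp add: powr_powr)
      qed
      then show ?thesis using h2 by (intro exI[of _ "(h2 / 2) powr (1 / t)"]) auto
    next
      case \<alpha>2: False
      have "\<exists>C. \<forall>\<^sub>F n in sequentially. power_divergence 1 (k n) (P n) (Q n) \<le> C"
      proof (cases "\<alpha>2 = 1")
        case True
        have "\<forall>\<^sub>F n in sequentially. power_divergence \<alpha>2 (k n) (P n) (Q n) < \<Delta>2 + 1"
          by (rule order_tendstoD(2)[OF D2]) simp
        then show ?thesis
          using True by (intro exI[of _ "\<Delta>2 + 1"]) (auto elim: eventually_mono)
      next
        case False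
        have "\<forall>\<^sub>F n in sequentially. H \<alpha>2 n < h2 + 1"
          by (rule order_tendstoD(2)[OF H2]) simp
        then have "\<forall>\<^sub>F n in sequentially. power_divergence 1 (k n) (P n) (Q n) \<le> ln (h2 + 1) / (\<alpha>2 - 1)"
          using eventually_ge_at_top[of 1]
        proof eventually_elim
          case (elim n)
          have "exp ((\<alpha>2 - 1) * power_divergence 1 (k n) (P n) (Q n)) \<le> h2 + 1"
            using exp_divergence_le_power_sum[where q = "Q n" and \<alpha> = \<alpha>2, OF P[OF elim(2)] Q[OF elim(2)]] elim \<alpha>2 False by (simp add: H_power_sum)
          then have "ln (exp ((\<alpha>2 - 1) * power_divergence 1 (k n) (P n) (Q n))) \<le> ln (h2 + 1)"
            by (intro ln_mono) auto
          then show ?case using \<alpha>2 False by (simp add: field_simps)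
        qed
        then show ?thesis by blast
      qed
      then obtain C where C: "\<forall>\<^sub>F n in sequentially. power_divergence 1 (k n) (P n) (Q n) \<le> C" by blast
      then have "\<forall>\<^sub>F n in sequentially. exp ((\<alpha>1 - 1) * C) \<le> H \<alpha>1 n"
        using eventually_ge_at_top[of 1]
      proof eventually_elim
        case (elim n)
        have "exp ((\<alpha>1 - 1) * C) \<le> exp ((\<alpha>1 - 1) * power_divergence 1 (k n) (P n) (Q n))"
          using elim True by (simp add: mult_left_mono_neg)
        also have "\<dots> \<le> H \<alpha>1 n"
          using exp_divergence_le_power_sum[where q = "Q n" and \<alpha> = \<alpha>1, OF P[OF elim(2)] Q[OF elim(2)]] elim \<alpha> True by (simp add: H_power_sum)
        finally show ?case .
      qed
      then show ?thesis by (intro exI[of _ "exp ((\<alpha>1 - 1) * C)"]) auto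
    qed
    then obtain e where e: "e > 0" "\<forall>\<^sub>F n in sequentially. e \<le> H \<alpha>1 n" by blast
    have "e \<le> 1 + \<alpha>1 * (\<alpha>1 - 1) * \<Delta>1"
      using H1 e(2) by (intro tendsto_lowerbound) auto
    then show ?thesis using e pos by (simp add: divergence_levels_def)
  qed
qed

theorem theorem13:
  fixes \<alpha>1 \<alpha>2 \<Delta>1 \<Delta>2 :: real
    and k :: "nat \<Rightarrow> nat"
    and P Q :: "nat \<Rightarrow> nat \<Rightarrow> real"
  assumes "0 < \<alpha>1" and "\<alpha>1 < \<alpha>2"
    and "assumption_A \<alpha>1 \<alpha>2 \<Delta>1 \<Delta>2 k P Q"
  shows
    "((\<lambda>n. real (k n) * ln (real n) / real n) \<longlonglongrightarrow> 0 \<longrightarrow>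
        (\<alpha>2 < 1 \<and> 1 + \<alpha>2 * (\<alpha>2 - 1) * \<Delta>2 > 0 \<longrightarrow>
           has_bahadur_efficiency \<alpha>1 \<alpha>2 \<Delta>1 \<Delta>2 k P Q
             (ereal ((\<alpha>2 - 1) / (\<alpha>1 - 1) *
                (ln (1 + \<alpha>1 * (\<alpha>1 - 1) * \<Delta>1) / ln (1 + \<alpha>2 * (\<alpha>2 - 1) * \<Delta>2))))) \<and>
        (\<alpha>2 = 1 \<longrightarrow>
           has_bahadur_efficiency \<alpha>1 \<alpha>2 \<Delta>1 \<Delta>2 k P Q
             (ereal (1 / (\<alpha>1 - 1) * (ln (1 + \<alpha>1 * (\<alpha>1 - 1) * \<Delta>1) / \<Delta>2))))) \<and>
     ((\<lambda>n. real (k n) powr (2 - 1 / \<alpha>2) * ln (real n) / real n) \<longlonglongrightarrow> 0 \<longrightarrow>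
        (\<forall>n\<ge>1. \<forall>j\<in>{1..k n}. Q n j = 1 / real (k n)) \<longrightarrow>
        \<alpha>2 > 1 \<longrightarrow>
          has_bahadur_efficiency \<alpha>1 \<alpha>2 \<Delta>1 \<Delta>2 k P Q \<infinity>)"
proof -
  note \<alpha> = assms(1,2)
  have \<alpha>2_pos: "0 < \<alpha>2" using \<alpha> by simp
  have PQ: "\<And>n. n \<ge> 1 \<Longrightarrow> prob_vector (k n) (P n) \<and> prob_vector (k n) (Q n)"
    and A1: "assumption_A1 k" and A2: "assumption_A2 k Q"
    and A3: "assumption_A3 \<alpha>1 \<Delta>1 k P Q" "assumption_A3 \<alpha>2 \<Delta>2 k P Q"
    using assms(3) by (auto simp: assumption_A_def)
  have Q: "\<And>n. n \<ge> 1 \<Longrightarrow> prob_vector (k n) (Q n)" using PQ by blast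
  have Q_pos: "\<And>n j. n \<ge> 1 \<Longrightarrow> j \<in> {1..k n} \<Longrightarrow> Q n j > 0"
    using A2 by (simp add: assumption_A2_def)
  have k_top: "filterlim k at_top sequentially" and k_le: "\<And>n. n \<ge> 1 \<Longrightarrow> k n \<le> n"
    and k_mono: "\<And>m n. 1 \<le> m \<Longrightarrow> m \<le> n \<Longrightarrow> k m \<le> k n"
    using A1 by (auto simp: assumption_A1_def mono_on_def)
  have \<Delta>2_pos: "\<Delta>2 > 0" using A3(2) by (simp add: assumption_A3_def)
  have level1: "\<Delta>1 \<in> divergence_levels \<alpha>1" if "\<Delta>2 \<in> divergence_levels \<alpha>2"
    using divergence_level_below[OF \<alpha> _ Q_pos A3 that] PQ by blast
  have level2: "\<Delta>2 \<in> divergence_levels \<alpha>2" if "\<alpha>2 \<ge> 1"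
  proof -
    have "0 \<le> \<alpha>2 * (\<alpha>2 - 1) * \<Delta>2" using that \<alpha>2_pos \<Delta>2_pos by (intro mult_nonneg_nonneg) auto
    then show ?thesis using \<Delta>2_pos by (simp add: divergence_levels_def)
  qed
  have efficiencyI: "has_bahadur_efficiency \<alpha>1 \<alpha>2 \<Delta>1 \<Delta>2 k P Q (ereal (g1 \<Delta>1 / g2 \<Delta>2) * L)"
    if sparse: "(\<lambda>n. real (k n) * ln (real n) / real n) \<longlonglongrightarrow> 0"
      and \<Delta>2: "\<Delta>2 \<in> divergence_levels \<alpha>2"
      and g: "bahadur_function \<alpha>1 k Q c1 g1" "bahadur_function \<alpha>2 k Q c2 g2"
      and m: "\<And>r. r > 0 \<Longrightarrow> \<exists>m. matching_sample_sizes c1 c2 r m"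
        "\<And>r m. r > 0 \<Longrightarrow> matching_sample_sizes c1 c2 r m \<Longrightarrow> (\<lambda>n. ereal (c2 (m n) / c1 n)) \<longlonglongrightarrow> L"
      and L: "0 \<le> L"
    for c1 c2 g1 g2 L
  proof -
    have "g1 \<Delta>1 > 0" "g2 \<Delta>2 > 0"
      using g level1[OF \<Delta>2] \<Delta>2 by (auto simp: bahadur_function_def)
    then have "g1 \<Delta>1 / g2 \<Delta>2 > 0" by simp
    then show ?thesis
      unfolding has_bahadur_efficiency_def
      using assms(3) consistent_divergence_statistic[OF \<alpha>(1) PQ A1 A2 A3(1) sparse]
        consistent_divergence_statistic[OF \<alpha>2_pos PQ A1 A2 A3(2) sparse] level1[OF \<Delta>2] \<Delta>2 g m L
      by blast
  qed
  have efficiency_le_1: "has_bahadur_efficiency \<alpha>1 \<alpha>2 \<Delta>1 \<Delta>2 k P Q (ereal (renyi_rate \<alpha>1 \<Delta>1 / renyi_rate \<alpha>2 \<Delta>2))"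
    if sparse: "(\<lambda>n. real (k n) * ln (real n) / real n) \<longlonglongrightarrow> 0"
      and "\<alpha>2 \<le> 1" and \<Delta>2: "\<Delta>2 \<in> divergence_levels \<alpha>2"
  proof -
    have "has_bahadur_efficiency \<alpha>1 \<alpha>2 \<Delta>1 \<Delta>2 k P Q (ereal (renyi_rate \<alpha>1 \<Delta>1 / renyi_rate \<alpha>2 \<Delta>2) * 1)"
      using \<alpha> \<alpha>2_pos \<open>\<alpha>2 \<le> 1\<close>
      by (intro efficiencyI[where ?c1.0 = "\<lambda>_. 1" and ?c2.0 = "\<lambda>_. 1"] sparse \<Delta>2
          bahadur_function_le_1 Q A2 matching_sample_sizes_constant) (auto simp: one_ereal_def)
    then show ?thesis by simp
  qed
  have efficiency_infinite: "has_bahadur_efficiency \<alpha>1 \<alpha>2 \<Delta>1 \<Delta>2 k P Q \<infinity>"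
    if sparse2: "(\<lambda>n. real (k n) powr (2 - 1 / \<alpha>2) * ln (real n) / real n) \<longlonglongrightarrow> 0"
      and uniform: "\<forall>n\<ge>1. \<forall>j\<in>{1..k n}. Q n j = 1 / real (k n)" and "\<alpha>2 > 1"
  proof -
    have k_pos: "\<And>n. n \<ge> 1 \<Longrightarrow> k n \<ge> 1" using Q prob_vector_dim_pos by blast
    have sparse_exponent: "(\<lambda>n. real (k n) powr a * ln (real n) / real n) \<longlonglongrightarrow> 0" if "a \<le> 2 - 1 / \<alpha>2" for a
    proof (rule tendsto_sandwich[OF _ _ tendsto_const sparse2])
      show "\<forall>\<^sub>F n in sequentially. real (k n) powr a * ln (real n) / real n \<le> real (k n) powr (2 - 1 / \<alpha>2) * ln (real n) / real n"
        using eventually_ge_at_top[of 1]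
      proof eventually_elim
        case (elim n)
        then show ?case
          using that k_pos[of n] by (intro divide_right_mono mult_right_mono powr_mono) auto
      qed
      show "\<forall>\<^sub>F n in sequentially. 0 \<le> real (k n) powr a * ln (real n) / real n"
        using eventually_ge_at_top[of 1] by eventually_elim auto
    qed
    have sparse: "(\<lambda>n. real (k n) * ln (real n) / real n) \<longlonglongrightarrow> 0"
    proof -
      have "real (k n) powr 1 = real (k n)" for n by simp
      moreover have "1 \<le> 2 - 1 / \<alpha>2" using \<open>\<alpha>2 > 1\<close> by simp
      ultimately show ?thesis using sparse_exponent[of 1] by simp
    qed
    have k_large: "\<forall>\<^sub>F n in sequentially. R (k n)" if "\<forall>\<^sub>F m in sequentially. R m" for R
      using k_top that by (rule eventually_compose_filterlim[rotated])
    define \<beta>2 where "\<beta>2 = 1 - 1 / \<alpha>2"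
    define c2 where "c2 = (\<lambda>n. real (k n) powr \<beta>2 / ln (real (k n)))"
    have \<beta>2: "0 < \<beta>2" "\<beta>2 < 1" using \<open>\<alpha>2 > 1\<close> by (auto simp: \<beta>2_def)
    have bf2: "bahadur_function \<alpha>2 k Q c2 (\<lambda>x. (\<alpha>2 * (\<alpha>2 - 1) * x) powr (1 / \<alpha>2) / \<alpha>2)"
      unfolding c2_def \<beta>2_def using uniform by (intro bahadur_function_gt_1 \<open>\<alpha>2 > 1\<close> Q A1 sparse2) auto
    obtain c1 g1 where bf1: "bahadur_function \<alpha>1 k Q c1 g1"
      and c1: "\<forall>\<^sub>F n in sequentially. c1 n > 0" "filterlim (\<lambda>n. c2 n / c1 n) at_top sequentially"
    proof (cases "\<alpha>1 \<le> 1")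
      case True
      show thesis
      proof (rule that)
        show "bahadur_function \<alpha>1 k Q (\<lambda>_. 1) (renyi_rate \<alpha>1)"
          by (intro bahadur_function_le_1 \<alpha> True Q A2 sparse)
        have "filterlim (\<lambda>m. real m powr \<beta>2 / ln (real m)) at_top sequentially"
          using \<beta>2 by real_asymp
        from filterlim_compose[OF this k_top]
        show "filterlim (\<lambda>n. c2 n / 1) at_top sequentially" by (simp add: c2_def)
      qed auto
    next
      case False
      define \<beta>1 where "\<beta>1 = 1 - 1 / \<alpha>1"
      have \<beta>1: "\<beta>1 < \<beta>2" using False \<alpha> by (simp add: \<beta>1_def \<beta>2_def field_simps)
      show thesis
      proof (rule that)
        have "2 - 1 / \<alpha>1 \<le> 2 - 1 / \<alpha>2" using \<beta>1 by (simp add: \<beta>1_def \<beta>2_def)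
        then show "bahadur_function \<alpha>1 k Q (\<lambda>n. real (k n) powr \<beta>1 / ln (real (k n)))
            (\<lambda>x. (\<alpha>1 * (\<alpha>1 - 1) * x) powr (1 / \<alpha>1) / \<alpha>1)"
          unfolding \<beta>1_def using uniform False by (intro bahadur_function_gt_1 Q A1 sparse_exponent) auto
        have "\<forall>\<^sub>F m in sequentially. real m powr \<beta>1 / ln (real m) > 0"
          using eventually_gt_at_top[of 1] by eventually_elim auto
        then show "\<forall>\<^sub>F n in sequentially. real (k n) powr \<beta>1 / ln (real (k n)) > 0"
          by (rule k_large)
        have "filterlim (\<lambda>m. (real m powr \<beta>2 / ln (real m)) / (real m powr \<beta>1 / ln (real m))) at_top sequentially"
          using \<beta>1 by real_asymp
        from filterlim_compose[OF this k_top]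
        show "filterlim (\<lambda>n. c2 n / (real (k n) powr \<beta>1 / ln (real (k n)))) at_top sequentially"
          by (simp add: c2_def)
      qed
    qed
    \<comment> \<open>from \<open>k n \<ge> exp (1 / \<beta>2)\<close> on, \<open>c2\<close> is monotone; \<open>k n \<ge> 3\<close> makes it positive\<close>
    have "\<forall>\<^sub>F n in sequentially. max (exp (1 / \<beta>2)) 3 \<le> real (k n)"
      by (rule k_large) real_asymp
    with c1(1) eventually_ge_at_top[of 1]
    have "\<forall>\<^sub>F n in sequentially. c1 n > 0 \<and> exp (1 / \<beta>2) \<le> real (k n) \<and> 3 \<le> real (k n) \<and> 1 \<le> n"
      by eventually_elim auto
    then obtain N where N: "\<And>n. n \<ge> N \<Longrightarrow> c1 n > 0 \<and> exp (1 / \<beta>2) \<le> real (k n) \<and> 3 \<le> real (k n) \<and> 1 \<le> n"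
      by (auto simp: eventually_sequentially)
    have N1: "c1 n > 0" "c2 n > 0" if "n \<ge> N" for n
      using N[OF that] by (auto simp: c2_def intro!: divide_pos_pos ln_gt_zero)
    have N2: "c2 m \<le> c2 n" if "N \<le> m" "m \<le> n" for m n
      unfolding c2_def using N[OF that(1)] k_mono[of m n] that \<beta>2 by (intro powr_div_ln_mono) auto
    have n_top: "filterlim (\<lambda>n. real n / c2 n) at_top sequentially"
    proof (rule filterlim_at_top_mono)
      have "(\<lambda>n. real (k n) / real n) \<longlonglongrightarrow> 0"
      proof (rule tendsto_sandwich[OF _ _ tendsto_const sparse])
        have "\<forall>\<^sub>F n::nat in sequentially. 1 \<le> ln (real n)" by real_asymp
        then show "\<forall>\<^sub>F n in sequentially. real (k n) / real n \<le> real (k n) * ln (real n) / real n"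
          by eventually_elim (intro divide_right_mono, simp_all add: mult_le_cancel_left1)
      qed auto
      moreover have "\<forall>\<^sub>F n in sequentially. 0 < real (k n) / real n"
        using eventually_ge_at_top[of 1] by eventually_elim (use k_pos in force)
      ultimately show "filterlim (\<lambda>n. inverse (real (k n) / real n)) at_top sequentially"
        by (rule filterlim_inverse_at_top)
      have "\<forall>\<^sub>F m::nat in sequentially. real m powr \<beta>2 / ln (real m) \<le> real m" using \<beta>2 by real_asymp
      from k_large[OF this] show "\<forall>\<^sub>F n in sequentially. inverse (real (k n) / real n) \<le> real n / c2 n"
        using eventually_ge_at_top[of N]
      proof eventually_elim
        case (elim n)
        then have "c2 n \<le> real (k n)" by (simp add: c2_def)
        then have "real n / real (k n) \<le> real n / c2 n"
          using N1(2)[OF elim(2)] N[OF elim(2)] by (intro divide_left_mono mult_pos_pos) auto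
        then show ?case by simp
      qed
    qed
    let ?g2 = "\<lambda>x. (\<alpha>2 * (\<alpha>2 - 1) * x) powr (1 / \<alpha>2) / \<alpha>2"
    have "has_bahadur_efficiency \<alpha>1 \<alpha>2 \<Delta>1 \<Delta>2 k P Q (ereal (g1 \<Delta>1 / ?g2 \<Delta>2) * \<infinity>)"
    proof (rule efficiencyI[OF sparse _ bf1 bf2])
      show "\<Delta>2 \<in> divergence_levels \<alpha>2" using level2 \<open>\<alpha>2 > 1\<close> by simp
      show "\<exists>m. matching_sample_sizes c1 c2 r m" if "r > 0" for r
        using ex_matching_sample_sizes[of r N c1 c2] that N1 N2 c1(2) n_top by blast
      show "(\<lambda>n. ereal (c2 (m n) / c1 n)) \<longlonglongrightarrow> \<infinity>" if "r > 0" "matching_sample_sizes c1 c2 r m" for r m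
        using matching_sample_sizes_ratio_infinite[of r N c1 c2 m] that N1 N2 c1(2) by blast
    qed simp
    moreover have "g1 \<Delta>1 / ?g2 \<Delta>2 > 0"
    proof -
      have "\<Delta>2 \<in> divergence_levels \<alpha>2" using level2 \<open>\<alpha>2 > 1\<close> by simp
      then have "g1 \<Delta>1 > 0" "?g2 \<Delta>2 > 0"
        using bf1 bf2 level1 by (auto simp: bahadur_function_def)
      then show ?thesis by (rule divide_pos_pos)
    qed
    moreover have "ereal a * \<infinity> = \<infinity>" if "a > 0" for a :: real
      using that by simp
    ultimately show ?thesis by (simp only:)
  qed
  show ?thesis
  proof (intro conjI impI)
    assume sparse: "(\<lambda>n. real (k n) * ln (real n) / real n) \<longlonglongrightarrow> 0"
      and *: "\<alpha>2 < 1 \<and> 1 + \<alpha>2 * (\<alpha>2 - 1) * \<Delta>2 > 0"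
    then have "\<Delta>2 \<in> divergence_levels \<alpha>2" using \<Delta>2_pos by (simp add: divergence_levels_def)
    moreover have "renyi_rate \<alpha>1 \<Delta>1 / renyi_rate \<alpha>2 \<Delta>2 = (\<alpha>2 - 1) / (\<alpha>1 - 1) *
        (ln (1 + \<alpha>1 * (\<alpha>1 - 1) * \<Delta>1) / ln (1 + \<alpha>2 * (\<alpha>2 - 1) * \<Delta>2))"
      using * \<alpha> by (simp add: renyi_rate_def)
    ultimately show "has_bahadur_efficiency \<alpha>1 \<alpha>2 \<Delta>1 \<Delta>2 k P Q
       (ereal ((\<alpha>2 - 1) / (\<alpha>1 - 1) *
          (ln (1 + \<alpha>1 * (\<alpha>1 - 1) * \<Delta>1) / ln (1 + \<alpha>2 * (\<alpha>2 - 1) * \<Delta>2))))"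
      using efficiency_le_1[OF sparse] * by simp
  next
    assume sparse: "(\<lambda>n. real (k n) * ln (real n) / real n) \<longlonglongrightarrow> 0" and *: "\<alpha>2 = 1"
    have "renyi_rate \<alpha>1 \<Delta>1 / renyi_rate \<alpha>2 \<Delta>2 = 1 / (\<alpha>1 - 1) * (ln (1 + \<alpha>1 * (\<alpha>1 - 1) * \<Delta>1) / \<Delta>2)"
      using * \<alpha> by (simp add: renyi_rate_def)
    then show "has_bahadur_efficiency \<alpha>1 \<alpha>2 \<Delta>1 \<Delta>2 k P Q
       (ereal (1 / (\<alpha>1 - 1) * (ln (1 + \<alpha>1 * (\<alpha>1 - 1) * \<Delta>1) / \<Delta>2)))"
      using efficiency_le_1[OF sparse] * level2 by simp
  qed (use efficiency_infinite in blast)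
qed

end
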